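(* Suppose that $A$ is a field, and that $\Gamma$ is a graded $A$-coalgebra such that the dual algebra $\Gamma^*$ is finite-type and connected. Then every graded $\Gamma^*$-module is the limit, in the category of graded $\Gamma^*$-modules, of a Mittag-Leffler sequence of rational graded $\Gamma^*$-modules.
   Context: Gradings are $\mathbb{Z}$-gradings; modules are left modules and comodules are right comodules. $\Gamma^*$ is the graded $A$-linear dual algebra of $\Gamma$, with degree $n$ summand $\mathrm{Hom}_A(\Gamma^{-n},A)$ and the convolution product. "Finite-type and connected" means that each degree of $\Gamma^*$ is finite-dimensional over $A$, $\Gamma^*$ is one-dimensional in degree $0$, and $\Gamma^*$ is trivial in negative degrees. A graded $\Gamma^*$-module is rational if it is isomorphic to $\iota M$ for some graded $\Gamma$-comodule $M$, where $\iota M$ is the graded $A$-module $M$ with the adjoint action: $f\in\Gamma^*$ acts by $M\xrightarrow{\psi_M}M\otimes_A\Gamma\xrightarrow{M\otimes f}M\otimes_A A\cong M$, with $\psi_M$ the coaction. A sequence here is an inverse sequence $\dots\to N_2\to N_1\to N_0$; it is Mittag-Leffler if it satisfies the usual Mittag-Leffler condition in each grading degree. *)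

theory Defs
  imports "Jordan_Normal_Form.Missing_VectorSpace"
begin

section \<open>Graded modules\<close>

text \<open>A \<open>\<int>\<close>-graded module is the family of its homogeneous pieces. A family of maps indexed
  by degree is only relevant on the carriers of the pieces.\<close>

type_synonym ('a, 'm) gmod = "int \<Rightarrow> ('a, 'm) module"

definition graded_module :: "('a, 'r) ring_scheme \<Rightarrow> ('a, 'm) gmod \<Rightarrow> bool"
  where "graded_module A M \<longleftrightarrow> (\<forall>n. module A (M n))"

definition graded_hom ::
    "('a, 'r) ring_scheme \<Rightarrow> ('a, 'm) gmod \<Rightarrow> ('a, 'n) gmod \<Rightarrow> (int \<Rightarrow> 'm \<Rightarrow> 'n) \<Rightarrow> bool"
  where "graded_hom A M N \<phi> \<longleftrightarrow> (\<forall>n. \<phi> n \<in> module_hom A (M n) (N n))"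

definition ground :: "('a, 'r) ring_scheme \<Rightarrow> ('a, 'a) gmod"
  where \<comment> \<open>\<open>A\<close> itself, concentrated in degree 0\<close>
    "ground A n = \<lparr>carrier = (if n = 0 then carrier A else {\<zero>\<^bsub>A\<^esub>}), mult = mult A, one = one A,
       zero = zero A, add = add A, smult = mult A\<rparr>"


section \<open>Tensor products\<close>

text \<open>The degree \<open>n\<close> piece of \<open>M \<otimes>\<^sub>A N\<close> is the direct sum over \<open>i\<close> of
  \<open>M i \<otimes>\<^sub>A N (n - i)\<close>. It is presented by generators and relations: a list of triples \<open>(i, x, y)\<close>
  stands for the formal sum of the symbols \<open>x \<otimes> y\<close> with \<open>x\<close> in degree \<open>i\<close> and \<open>y\<close> in degree
  \<open>n - i\<close>, and such sums are taken modulo the bilinearity relations. Scalar multiples of symbols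
  are not needed in the formal sums, because a scalar can be moved into the left factor.\<close>

definition formal_tensors ::
    "('a, 'm) gmod \<Rightarrow> ('a, 'n) gmod \<Rightarrow> int \<Rightarrow> (int \<times> 'm \<times> 'n) list set"
  where "formal_tensors M N n =
    lists {(i, x, y). x \<in> carrier (M i) \<and> y \<in> carrier (N (n - i))}"

inductive tensor_eq ::
    "('a, 'r) ring_scheme \<Rightarrow> ('a, 'm) gmod \<Rightarrow> ('a, 'n) gmod \<Rightarrow> int \<Rightarrow>
      (int \<times> 'm \<times> 'n) list \<Rightarrow> (int \<times> 'm \<times> 'n) list \<Rightarrow> bool"
  for A M N n where
  refl: "xs \<in> formal_tensors M N n \<Longrightarrow> tensor_eq A M N n xs xs"
| sym: "tensor_eq A M N n xs ys \<Longrightarrow> tensor_eq A M N n ys xs"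
| trans: "tensor_eq A M N n xs ys \<Longrightarrow> tensor_eq A M N n ys zs \<Longrightarrow> tensor_eq A M N n xs zs"
| append: "tensor_eq A M N n xs xs' \<Longrightarrow> tensor_eq A M N n ys ys' \<Longrightarrow>
    tensor_eq A M N n (xs @ ys) (xs' @ ys')"
| commute: "xs \<in> formal_tensors M N n \<Longrightarrow> ys \<in> formal_tensors M N n \<Longrightarrow>
    tensor_eq A M N n (xs @ ys) (ys @ xs)"
| add_left: "x \<in> carrier (M i) \<Longrightarrow> x' \<in> carrier (M i) \<Longrightarrow> y \<in> carrier (N (n - i)) \<Longrightarrow>
    tensor_eq A M N n [(i, x \<oplus>\<^bsub>M i\<^esub> x', y)] [(i, x, y), (i, x', y)]"
| add_right: "x \<in> carrier (M i) \<Longrightarrow> y \<in> carrier (N (n - i)) \<Longrightarrow> y' \<in> carrier (N (n - i)) \<Longrightarrow>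
    tensor_eq A M N n [(i, x, y \<oplus>\<^bsub>N (n - i)\<^esub> y')] [(i, x, y), (i, x, y')]"
| zero_left: "y \<in> carrier (N (n - i)) \<Longrightarrow> tensor_eq A M N n [(i, \<zero>\<^bsub>M i\<^esub>, y)] []"
| balanced: "a \<in> carrier A \<Longrightarrow> x \<in> carrier (M i) \<Longrightarrow> y \<in> carrier (N (n - i)) \<Longrightarrow>
    tensor_eq A M N n [(i, a \<odot>\<^bsub>M i\<^esub> x, y)] [(i, x, a \<odot>\<^bsub>N (n - i)\<^esub> y)]"

definition tensor_class ::
    "('a, 'r) ring_scheme \<Rightarrow> ('a, 'm) gmod \<Rightarrow> ('a, 'n) gmod \<Rightarrow> int \<Rightarrow>
      (int \<times> 'm \<times> 'n) list \<Rightarrow> (int \<times> 'm \<times> 'n) list set"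
  where "tensor_class A M N n xs = {ys. tensor_eq A M N n xs ys}"

definition representative :: "(int \<times> 'm \<times> 'n) list set \<Rightarrow> (int \<times> 'm \<times> 'n) list"
  where "representative X = (SOME xs. xs \<in> X)"

definition tensor :: "('a, 'r) ring_scheme \<Rightarrow> ('a, 'm) gmod \<Rightarrow> ('a, 'n) gmod \<Rightarrow>
    ('a, (int \<times> 'm \<times> 'n) list set) gmod"
  where "tensor A M N n =
    \<lparr>carrier = tensor_class A M N n ` formal_tensors M N n,
     mult = undefined, one = undefined,
     zero = tensor_class A M N n [],
     add = (\<lambda>X Y. tensor_class A M N n (representative X @ representative Y)),
     smult = (\<lambda>a X. tensor_class A M N n
       (map (\<lambda>(i, x, y). (i, a \<odot>\<^bsub>M i\<^esub> x, y)) (representative X)))\<rparr>"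

definition pure_tensor ::
    "('a, 'r) ring_scheme \<Rightarrow> ('a, 'm) gmod \<Rightarrow> ('a, 'n) gmod \<Rightarrow> int \<Rightarrow>
      int \<Rightarrow> 'm \<Rightarrow> 'n \<Rightarrow> (int \<times> 'm \<times> 'n) list set"
  where "pure_tensor A M N n i x y = tensor_class A M N n [(i, x, y)]"

definition formal_eval ::
    "('p, 'z) ring_scheme \<Rightarrow> (int \<Rightarrow> 'm \<Rightarrow> 'n \<Rightarrow> 'p) \<Rightarrow> (int \<times> 'm \<times> 'n) list \<Rightarrow> 'p"
  where "formal_eval P \<beta> xs = foldr (\<lambda>(i, x, y) s. \<beta> i x y \<oplus>\<^bsub>P\<^esub> s) xs \<zero>\<^bsub>P\<^esub>"

definition tensor_lift ::
    "('p, 'z) ring_scheme \<Rightarrow> (int \<Rightarrow> 'm \<Rightarrow> 'n \<Rightarrow> 'p) \<Rightarrow> (int \<times> 'm \<times> 'n) list set \<Rightarrow> 'p"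
  where \<comment> \<open>the linear map to \<open>P\<close> out of a piece of a tensor product that is induced by bilinear maps
      \<open>\<beta> i\<close>; see \<open>tensor_lift_pure\<close>\<close>
    "tensor_lift P \<beta> X = formal_eval P \<beta> (representative X)"

definition tensor_map ::
    "('a, 'r) ring_scheme \<Rightarrow> ('a, 'm2) gmod \<Rightarrow> ('a, 'n2) gmod \<Rightarrow>
      (int \<Rightarrow> 'm \<Rightarrow> 'm2) \<Rightarrow> (int \<Rightarrow> 'n \<Rightarrow> 'n2) \<Rightarrow>
      int \<Rightarrow> (int \<times> 'm \<times> 'n) list set \<Rightarrow> (int \<times> 'm2 \<times> 'n2) list set"
  where \<comment> \<open>\<open>\<phi> \<otimes> \<psi> : M \<otimes> N \<rightarrow> M' \<otimes> N'\<close>\<close>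
    "tensor_map A M' N' \<phi> \<psi> n =
      tensor_lift (tensor A M' N' n) (\<lambda>i x y. pure_tensor A M' N' n i (\<phi> i x) (\<psi> (n - i) y))"

definition tensor_assoc ::
    "('a, 'r) ring_scheme \<Rightarrow> ('a, 'm) gmod \<Rightarrow> ('a, 'n) gmod \<Rightarrow> ('a, 'p) gmod \<Rightarrow> int \<Rightarrow>
      (int \<times> (int \<times> 'm \<times> 'n) list set \<times> 'p) list set \<Rightarrow>
      (int \<times> 'm \<times> (int \<times> 'n \<times> 'p) list set) list set"
  where \<comment> \<open>\<open>(M \<otimes> N) \<otimes> P \<cong> M \<otimes> (N \<otimes> P)\<close>\<close>
    "tensor_assoc A M N P n =
      tensor_lift (tensor A M (tensor A N P) n) (\<lambda>i u z.
        tensor_lift (tensor A M (tensor A N P) n) (\<lambda>j x y.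
          pure_tensor A M (tensor A N P) n j x (pure_tensor A N P (n - j) (i - j) y z)) u)"

text \<open>\<open>M \<otimes> A \<cong> M\<close> and \<open>A \<otimes> M \<cong> M\<close>. A symbol \<open>x \<otimes> a\<close> of degree \<open>n\<close> with \<open>x\<close> not of degree \<open>n\<close>
  vanishes, because \<open>a\<close> then lies in a trivial piece of \<open>ground A\<close>.\<close>

definition right_unit :: "('a, 'm) gmod \<Rightarrow> int \<Rightarrow> (int \<times> 'm \<times> 'a) list set \<Rightarrow> 'm"
  where "right_unit M n = tensor_lift (M n) (\<lambda>i x a. if i = n then a \<odot>\<^bsub>M n\<^esub> x else \<zero>\<^bsub>M n\<^esub>)"

definition left_unit :: "('a, 'm) gmod \<Rightarrow> int \<Rightarrow> (int \<times> 'a \<times> 'm) list set \<Rightarrow> 'm"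
  where "left_unit M n = tensor_lift (M n) (\<lambda>i a x. if i = 0 then a \<odot>\<^bsub>M n\<^esub> x else \<zero>\<^bsub>M n\<^esub>)"


subsection \<open>Adequacy of the construction\<close>

definition bilinear_maps ::
    "('a, 'r) ring_scheme \<Rightarrow> ('a, 'm) gmod \<Rightarrow> ('a, 'n) gmod \<Rightarrow> int \<Rightarrow> ('a, 'p) module \<Rightarrow>
      (int \<Rightarrow> 'm \<Rightarrow> 'n \<Rightarrow> 'p) \<Rightarrow> bool"
  where "bilinear_maps A M N n P \<beta> \<longleftrightarrow>
    (\<forall>i. \<forall>x\<in>carrier (M i). (\<lambda>y. \<beta> i x y) \<in> module_hom A (N (n - i)) P) \<and>
    (\<forall>i. \<forall>y\<in>carrier (N (n - i)). (\<lambda>x. \<beta> i x y) \<in> module_hom A (M i) P)"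

lemma formal_tensors_Nil [simp]: "[] \<in> formal_tensors M N n"
  by (simp add: formal_tensors_def)

lemma formal_tensors_Cons [simp]:
  "(i, x, y) # xs \<in> formal_tensors M N n \<longleftrightarrow>
    x \<in> carrier (M i) \<and> y \<in> carrier (N (n - i)) \<and> xs \<in> formal_tensors M N n"
  by (simp add: formal_tensors_def)

lemma formal_tensors_append [simp]:
  "xs @ ys \<in> formal_tensors M N n \<longleftrightarrow>
    xs \<in> formal_tensors M N n \<and> ys \<in> formal_tensors M N n"
  by (auto simp: formal_tensors_def)

context
  fixes A :: "('a, 'r) ring_scheme" and M :: "('a, 'm) gmod" and N :: "('a, 'n) gmod"
  assumes gm: "graded_module A M" "graded_module A N"
begin

lemma pieces_module: "module A (M i)" "module A (N i)"
  using gm by (auto simp: graded_module_def)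

lemma tensor_eq_formal:
  "tensor_eq A M N n xs ys \<Longrightarrow> xs \<in> formal_tensors M N n \<and> ys \<in> formal_tensors M N n"
proof (induction rule: tensor_eq.induct)
  case (add_left x i x' y)
  interpret module A "M i" by (rule pieces_module)
  show ?case using add_left by simp
next
  case (add_right x i y y')
  interpret module A "N (n - i)" by (rule pieces_module)
  show ?case using add_right by simp
next
  case (zero_left y i)
  interpret module A "M i" by (rule pieces_module)
  show ?case using zero_left by simp
next
  case (balanced a x i y)
  interpret M: module A "M i" by (rule pieces_module)
  interpret N: module A "N (n - i)" by (rule pieces_module)
  show ?case using balanced by simp
qed simp_all

lemma tensor_class_eq_iff:
  assumes "xs \<in> formal_tensors M N n"
  shows "tensor_class A M N n xs = tensor_class A M N n ys \<longleftrightarrow> tensor_eq A M N n xs ys"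
proof
  assume "tensor_class A M N n xs = tensor_class A M N n ys"
  moreover have "xs \<in> tensor_class A M N n xs"
    using assms by (simp add: tensor_class_def tensor_eq.refl)
  ultimately have "tensor_eq A M N n ys xs"
    by (simp add: tensor_class_def)
  then show "tensor_eq A M N n xs ys"
    by (rule tensor_eq.sym)
next
  assume eq: "tensor_eq A M N n xs ys"
  show "tensor_class A M N n xs = tensor_class A M N n ys"
    unfolding tensor_class_def
    by (intro Collect_cong iffI)
      (erule tensor_eq.trans[OF tensor_eq.sym[OF eq]] tensor_eq.trans[OF eq])+
qed

lemma tensor_class_eqI:
  "tensor_eq A M N n xs ys \<Longrightarrow> tensor_class A M N n xs = tensor_class A M N n ys"
  using tensor_class_eq_iff tensor_eq_formal by blast

lemma representative_eq:
  assumes "xs \<in> formal_tensors M N n"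
  shows "tensor_eq A M N n xs (representative (tensor_class A M N n xs))"
  unfolding representative_def tensor_class_def
  by (rule someI2[of _ xs]) (use assms in \<open>auto intro: tensor_eq.refl\<close>)

lemma representative_formal:
  assumes "X \<in> carrier (tensor A M N n)"
  shows "representative X \<in> formal_tensors M N n" "tensor_class A M N n (representative X) = X"
proof -
  obtain xs where xs: "xs \<in> formal_tensors M N n" "X = tensor_class A M N n xs"
    using assms by (auto simp: tensor_def)
  show "representative X \<in> formal_tensors M N n"
    using representative_eq[OF xs(1)] xs(2) tensor_eq_formal by blast
  show "tensor_class A M N n (representative X) = X"
    using tensor_class_eqI[OF representative_eq[OF xs(1)]] xs(2) by simp
qed

lemma tensor_add_class:
  assumes "xs \<in> formal_tensors M N n" "ys \<in> formal_tensors M N n"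
  shows "tensor_class A M N n xs \<oplus>\<^bsub>tensor A M N n\<^esub> tensor_class A M N n ys =
    tensor_class A M N n (xs @ ys)"
proof -
  have "tensor_eq A M N n (xs @ ys) (representative (tensor_class A M N n xs) @
      representative (tensor_class A M N n ys))"
    by (intro tensor_eq.append representative_eq assms)
  then show ?thesis
    by (simp add: tensor_def tensor_class_eqI)
qed

abbreviation (input) scale_left :: "'a \<Rightarrow> (int \<times> 'm \<times> 'n) list \<Rightarrow> (int \<times> 'm \<times> 'n) list"
  where "scale_left a \<equiv> map (\<lambda>(i, x, y). (i, a \<odot>\<^bsub>M i\<^esub> x, y))"

lemma scale_formal:
  assumes "a \<in> carrier A" "xs \<in> formal_tensors M N n"
  shows "scale_left a xs \<in> formal_tensors M N n"
  using assms(2)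
proof (induction xs)
  case (Cons z xs)
  obtain i x y where z: "z = (i, x, y)" by (cases z)
  interpret module A "M i" by (rule pieces_module)
  show ?case using Cons assms(1) z by simp
qed simp

lemma scale_eq:
  assumes a: "a \<in> carrier A"
  shows "tensor_eq A M N n xs ys \<Longrightarrow> tensor_eq A M N n (scale_left a xs) (scale_left a ys)"
proof (induction rule: tensor_eq.induct)
  case (refl xs)
  then show ?case by (intro tensor_eq.refl scale_formal a)
next
  case (sym xs ys)
  show ?case by (rule tensor_eq.sym[OF sym.IH])
next
  case (trans xs ys zs)
  show ?case by (rule tensor_eq.trans[OF trans.IH])
next
  case (append xs xs' ys ys')
  then show ?case by (simp add: tensor_eq.append)
next
  case (commute xs ys)
  then show ?case unfolding map_append by (intro tensor_eq.commute scale_formal a)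
next
  case (add_left x i x' y)
  interpret module A "M i" by (rule pieces_module)
  show ?case using add_left a by (simp add: smult_r_distr tensor_eq.add_left)
next
  case (add_right x i y y')
  interpret module A "M i" by (rule pieces_module)
  show ?case using add_right a by (simp add: tensor_eq.add_right)
next
  case (zero_left y i)
  interpret module A "M i" by (rule pieces_module)
  show ?case using zero_left a by (simp add: tensor_eq.zero_left)
next
  case (balanced b x i y)
  interpret module A "M i" by (rule pieces_module)
  have "a \<odot>\<^bsub>M i\<^esub> (b \<odot>\<^bsub>M i\<^esub> x) = b \<odot>\<^bsub>M i\<^esub> (a \<odot>\<^bsub>M i\<^esub> x)"
    using balanced a by (simp add: smult_assoc1[symmetric] R.m_comm)
  then show ?case using balanced a by (simp add: tensor_eq.balanced)
qed

lemma tensor_smult_class: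
  assumes "a \<in> carrier A" "xs \<in> formal_tensors M N n"
  shows "a \<odot>\<^bsub>tensor A M N n\<^esub> tensor_class A M N n xs = tensor_class A M N n (scale_left a xs)"
  using tensor_class_eqI[OF scale_eq[OF assms(1) representative_eq[OF assms(2)]]]
  by (simp add: tensor_def)

lemma scale_one:
  assumes "xs \<in> formal_tensors M N n"
  shows "scale_left \<one>\<^bsub>A\<^esub> xs = xs"
  using assms
proof (induction xs)
  case (Cons z xs)
  obtain i x y where z: "z = (i, x, y)" by (cases z)
  interpret module A "M i" by (rule pieces_module)
  show ?case using Cons z by simp
qed simp

lemma scale_mult:
  assumes "a \<in> carrier A" "b \<in> carrier A" "xs \<in> formal_tensors M N n"
  shows "scale_left (a \<otimes>\<^bsub>A\<^esub> b) xs = scale_left a (scale_left b xs)"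
  using assms(3)
proof (induction xs)
  case (Cons z xs)
  obtain i x y where z: "z = (i, x, y)" by (cases z)
  interpret module A "M i" by (rule pieces_module)
  show ?case using Cons assms z by (simp add: smult_assoc1)
qed simp

lemma tensor_eq_commute3:
  assumes "xs \<in> formal_tensors M N n" "ys \<in> formal_tensors M N n" "z \<in> formal_tensors M N n"
    "w \<in> formal_tensors M N n"
  shows "tensor_eq A M N n (z @ w @ xs @ ys) ((z @ xs) @ (w @ ys))"
proof -
  have "tensor_eq A M N n (w @ xs) (xs @ w)"
    using assms tensor_eq.commute by blast
  then have "tensor_eq A M N n (z @ (w @ xs) @ ys) (z @ (xs @ w) @ ys)"
    by (intro tensor_eq.append[OF tensor_eq.refl] tensor_eq.append[OF _ tensor_eq.refl] assms)
  then show ?thesis by simp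
qed

lemma scale_add:
  assumes "a \<in> carrier A" "b \<in> carrier A" "xs \<in> formal_tensors M N n"
  shows "tensor_eq A M N n (scale_left (a \<oplus>\<^bsub>A\<^esub> b) xs) (scale_left a xs @ scale_left b xs)"
  using assms(3)
proof (induction xs)
  case Nil
  then show ?case by (simp add: tensor_eq.refl)
next
  case (Cons t xs)
  obtain i x y where t: "t = (i, x, y)" by (cases t)
  interpret module A "M i" by (rule pieces_module)
  have xs: "xs \<in> formal_tensors M N n" and xy: "x \<in> carrier (M i)" "y \<in> carrier (N (n - i))"
    using Cons.prems t by auto
  let ?z = "[(i, a \<odot>\<^bsub>M i\<^esub> x, y)]" and ?w = "[(i, b \<odot>\<^bsub>M i\<^esub> x, y)]"
  have "tensor_eq A M N n ([(i, (a \<oplus>\<^bsub>A\<^esub> b) \<odot>\<^bsub>M i\<^esub> x, y)] @ scale_left (a \<oplus>\<^bsub>A\<^esub> b) xs)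
      ((?z @ ?w) @ (scale_left a xs @ scale_left b xs))"
    using xy assms(1,2) Cons.IH[OF xs]
    by (intro tensor_eq.append) (simp_all add: smult_l_distr tensor_eq.add_left)
  moreover have "tensor_eq A M N n (?z @ ?w @ scale_left a xs @ scale_left b xs)
      ((?z @ scale_left a xs) @ (?w @ scale_left b xs))"
    using xs xy assms by (intro tensor_eq_commute3 scale_formal) auto
  ultimately show ?case using t tensor_eq.trans by fastforce
qed

lemma scale_zero:
  assumes "xs \<in> formal_tensors M N n"
  shows "tensor_eq A M N n (scale_left \<zero>\<^bsub>A\<^esub> xs) []"
  using assms
proof (induction xs)
  case Nil
  then show ?case by (simp add: tensor_eq.refl)
next
  case (Cons t xs)
  obtain i x y where t: "t = (i, x, y)" by (cases t)
  interpret module A "M i" by (rule pieces_module)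
  have "tensor_eq A M N n ([(i, \<zero>\<^bsub>M i\<^esub>, y)] @ scale_left \<zero>\<^bsub>A\<^esub> xs) ([] @ [])"
    using Cons t by (intro tensor_eq.append tensor_eq.zero_left) auto
  then show ?case using Cons.prems t by simp
qed

lemma tensor_graded_module: "graded_module A (tensor A M N)"
  unfolding graded_module_def
proof
  fix n
  interpret M: module A "M 0" by (rule pieces_module)
  let ?T = "tensor A M N n" and ?c = "tensor_class A M N n" and ?F = "formal_tensors M N n"
  have car: "carrier ?T = ?c ` ?F" and zero: "\<zero>\<^bsub>?T\<^esub> = ?c []"
    by (simp_all add: tensor_def)
  show "module A ?T"
  proof (rule moduleI)
    show "cring A" by (rule M.is_cring)
    show "abelian_group ?T"
    proof (rule abelian_groupI)
      fix X assume "X \<in> carrier ?T"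
      then obtain xs where xs: "xs \<in> ?F" "X = ?c xs" by (auto simp: car)
      let ?ys = "scale_left (\<ominus>\<^bsub>A\<^esub> \<one>\<^bsub>A\<^esub>) xs"
      have "tensor_eq A M N n (scale_left (\<ominus>\<^bsub>A\<^esub> \<one>\<^bsub>A\<^esub> \<oplus>\<^bsub>A\<^esub> \<one>\<^bsub>A\<^esub>) xs) (?ys @ scale_left \<one>\<^bsub>A\<^esub> xs)"
        by (rule scale_add) (use xs in auto)
      then have "tensor_eq A M N n (scale_left \<zero>\<^bsub>A\<^esub> xs) (?ys @ xs)"
        using scale_one[OF xs(1)] by (simp add: M.R.l_neg)
      then have "tensor_eq A M N n (?ys @ xs) []"
        by (rule tensor_eq.trans[OF tensor_eq.sym scale_zero[OF xs(1)]])
      then have "?c (?ys @ xs) = ?c []"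
        by (rule tensor_class_eqI)
      then have "?c ?ys \<oplus>\<^bsub>?T\<^esub> X = \<zero>\<^bsub>?T\<^esub>"
        using xs by (simp add: tensor_add_class scale_formal zero)
      then show "\<exists>Y\<in>carrier ?T. Y \<oplus>\<^bsub>?T\<^esub> X = \<zero>\<^bsub>?T\<^esub>"
        using xs by (auto simp: car scale_formal)
    next
      fix X Y assume "X \<in> carrier ?T" "Y \<in> carrier ?T"
      then obtain xs ys where "xs \<in> ?F" "X = ?c xs" "ys \<in> ?F" "Y = ?c ys"
        by (auto simp: car)
      then show "X \<oplus>\<^bsub>?T\<^esub> Y = Y \<oplus>\<^bsub>?T\<^esub> X"
        using tensor_class_eqI[OF tensor_eq.commute] by (simp add: tensor_add_class)
    qed (auto simp: car zero tensor_add_class)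
  next
    fix a b X assume "a \<in> carrier A" "b \<in> carrier A" "X \<in> carrier ?T"
    then show "(a \<oplus>\<^bsub>A\<^esub> b) \<odot>\<^bsub>?T\<^esub> X = a \<odot>\<^bsub>?T\<^esub> X \<oplus>\<^bsub>?T\<^esub> b \<odot>\<^bsub>?T\<^esub> X"
      using tensor_class_eqI[OF scale_add]
      by (auto simp: car tensor_add_class tensor_smult_class scale_formal)
  next
    fix a b X assume "a \<in> carrier A" "b \<in> carrier A" "X \<in> carrier ?T"
    then show "(a \<otimes>\<^bsub>A\<^esub> b) \<odot>\<^bsub>?T\<^esub> X = a \<odot>\<^bsub>?T\<^esub> (b \<odot>\<^bsub>?T\<^esub> X)"
      by (auto simp: car tensor_smult_class scale_formal scale_mult simp del: map_map)
  next
    fix a X Y assume "a \<in> carrier A" "X \<in> carrier ?T" "Y \<in> carrier ?T"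
    then show "a \<odot>\<^bsub>?T\<^esub> (X \<oplus>\<^bsub>?T\<^esub> Y) = a \<odot>\<^bsub>?T\<^esub> X \<oplus>\<^bsub>?T\<^esub> a \<odot>\<^bsub>?T\<^esub> Y"
      by (auto simp: car tensor_smult_class tensor_add_class scale_formal)
  next
    fix X assume "X \<in> carrier ?T"
    then show "\<one>\<^bsub>A\<^esub> \<odot>\<^bsub>?T\<^esub> X = X"
      by (auto simp: car tensor_smult_class scale_one)
  qed (auto simp: car tensor_smult_class scale_formal)
qed

context
  fixes n :: int and P :: "('a, 'p) module" and \<beta> :: "int \<Rightarrow> 'm \<Rightarrow> 'n \<Rightarrow> 'p"
  assumes P: "module A P" and \<beta>: "bilinear_maps A M N n P \<beta>"
begin

interpretation P: module A P by (rule P)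

lemma bilinear_maps_closed:
  "x \<in> carrier (M i) \<Longrightarrow> y \<in> carrier (N (n - i)) \<Longrightarrow> \<beta> i x y \<in> carrier P"
  using \<beta> by (auto simp: bilinear_maps_def module_hom_def Pi_iff)

lemma bilinear_maps_rules:
  assumes "x \<in> carrier (M i)" "y \<in> carrier (N (n - i))"
  shows "x' \<in> carrier (M i) \<Longrightarrow> \<beta> i (x \<oplus>\<^bsub>M i\<^esub> x') y = \<beta> i x y \<oplus>\<^bsub>P\<^esub> \<beta> i x' y"
    and "y' \<in> carrier (N (n - i)) \<Longrightarrow> \<beta> i x (y \<oplus>\<^bsub>N (n - i)\<^esub> y') = \<beta> i x y \<oplus>\<^bsub>P\<^esub> \<beta> i x y'"
    and "a \<in> carrier A \<Longrightarrow> \<beta> i (a \<odot>\<^bsub>M i\<^esub> x) y = a \<odot>\<^bsub>P\<^esub> \<beta> i x y"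
    and "a \<in> carrier A \<Longrightarrow> \<beta> i x (a \<odot>\<^bsub>N (n - i)\<^esub> y) = a \<odot>\<^bsub>P\<^esub> \<beta> i x y"
  using \<beta> assms by (auto simp: bilinear_maps_def module_hom_def Pi_iff)

lemma formal_eval_closed: "xs \<in> formal_tensors M N n \<Longrightarrow> formal_eval P \<beta> xs \<in> carrier P"
proof (induction xs)
  case (Cons t xs)
  then show ?case by (cases t) (simp add: formal_eval_def bilinear_maps_closed)
qed (simp add: formal_eval_def)

lemma formal_eval_append:
  "xs \<in> formal_tensors M N n \<Longrightarrow> ys \<in> formal_tensors M N n \<Longrightarrow>
    formal_eval P \<beta> (xs @ ys) = formal_eval P \<beta> xs \<oplus>\<^bsub>P\<^esub> formal_eval P \<beta> ys"
proof (induction xs)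
  case Nil
  then show ?case using formal_eval_closed[of ys] by (simp add: formal_eval_def)
next
  case (Cons t xs)
  obtain i x y where t: "t = (i, x, y)" by (cases t)
  have "formal_eval P \<beta> (t # zs) = \<beta> i x y \<oplus>\<^bsub>P\<^esub> formal_eval P \<beta> zs" for zs
    by (simp add: formal_eval_def t)
  then show ?case using Cons t
    by (simp add: formal_eval_closed bilinear_maps_closed P.M.a_assoc)
qed

lemma formal_eval_scale:
  assumes "a \<in> carrier A"
  shows "xs \<in> formal_tensors M N n \<Longrightarrow> formal_eval P \<beta> (scale_left a xs) = a \<odot>\<^bsub>P\<^esub> formal_eval P \<beta> xs"
proof (induction xs)
  case Nil
  then show ?case using assms by (simp add: formal_eval_def)
next
  case (Cons t xs)
  obtain i x y where t: "t = (i, x, y)" by (cases t)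
  have "formal_eval P \<beta> ((i, u, y) # zs) = \<beta> i u y \<oplus>\<^bsub>P\<^esub> formal_eval P \<beta> zs" for u zs
    by (simp add: formal_eval_def)
  then show ?case using Cons t assms
    by (simp add: formal_eval_closed bilinear_maps_closed bilinear_maps_rules P.smult_r_distr)
qed

lemma formal_eval_cong:
  "tensor_eq A M N n xs ys \<Longrightarrow> formal_eval P \<beta> xs = formal_eval P \<beta> ys"
proof (induction rule: tensor_eq.induct)
  case (append xs xs' ys ys')
  then show ?case using tensor_eq_formal by (metis formal_eval_append)
next
  case (commute xs ys)
  then show ?case by (simp add: formal_eval_append formal_eval_closed P.M.a_comm)
next
  case (add_left x i x' y)
  then show ?case
    by (simp add: formal_eval_def bilinear_maps_closed bilinear_maps_rules P.M.a_assoc)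
next
  case (add_right x i y y')
  then show ?case
    by (simp add: formal_eval_def bilinear_maps_closed bilinear_maps_rules P.M.a_assoc)
next
  case (zero_left y i)
  interpret Mi: module A "M i" by (rule pieces_module)
  have "\<beta> i \<zero>\<^bsub>M i\<^esub> y = \<beta> i (\<zero>\<^bsub>A\<^esub> \<odot>\<^bsub>M i\<^esub> \<zero>\<^bsub>M i\<^esub>) y"
    by simp
  also have "\<dots> = \<zero>\<^bsub>A\<^esub> \<odot>\<^bsub>P\<^esub> \<beta> i \<zero>\<^bsub>M i\<^esub> y"
    using zero_left by (intro bilinear_maps_rules(3)) auto
  also have "\<dots> = \<zero>\<^bsub>P\<^esub>"
    using zero_left by (simp add: bilinear_maps_closed)
  finally show ?case by (simp add: formal_eval_def)
next
  case (balanced a x i y)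
  then show ?case by (simp add: formal_eval_def bilinear_maps_rules)
qed auto

lemma tensor_lift_class:
  "xs \<in> formal_tensors M N n \<Longrightarrow>
    tensor_lift P \<beta> (tensor_class A M N n xs) = formal_eval P \<beta> xs"
  using representative_eq formal_eval_cong by (fastforce simp: tensor_lift_def)

lemma tensor_lift_pure:
  "x \<in> carrier (M i) \<Longrightarrow> y \<in> carrier (N (n - i)) \<Longrightarrow>
    tensor_lift P \<beta> (pure_tensor A M N n i x y) = \<beta> i x y"
  by (simp add: pure_tensor_def tensor_lift_class formal_eval_def bilinear_maps_closed)

lemma tensor_lift_hom: "tensor_lift P \<beta> \<in> module_hom A (tensor A M N n) P"
  unfolding module_hom_def
  by (auto simp: tensor_def[of A M N n, THEN arg_cong[of _ _ carrier]] tensor_lift_class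
      formal_eval_closed tensor_add_class formal_eval_append tensor_smult_class
      formal_eval_scale scale_formal)

end

end


section \<open>Graded coalgebras and right comodules\<close>

record ('a, 'c) gcoalgebra =
  pieces :: "('a, 'c) gmod"
  comult :: "int \<Rightarrow> 'c \<Rightarrow> (int \<times> 'c \<times> 'c) list set"
  counit :: "int \<Rightarrow> 'c \<Rightarrow> 'a"

definition graded_coalgebra :: "('a, 'r) ring_scheme \<Rightarrow> ('a, 'c) gcoalgebra \<Rightarrow> bool"
  where "graded_coalgebra A C \<longleftrightarrow>
    (let \<Gamma> = pieces C; \<Delta> = comult C; \<epsilon> = counit C in
      graded_module A \<Gamma> \<and>
      graded_hom A \<Gamma> (tensor A \<Gamma> \<Gamma>) \<Delta> \<and>
      graded_hom A \<Gamma> (ground A) \<epsilon> \<and>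
      (\<forall>n. \<forall>c\<in>carrier (\<Gamma> n).
        tensor_assoc A \<Gamma> \<Gamma> \<Gamma> n (tensor_map A (tensor A \<Gamma> \<Gamma>) \<Gamma> \<Delta> (\<lambda>_ x. x) n (\<Delta> n c)) =
        tensor_map A \<Gamma> (tensor A \<Gamma> \<Gamma>) (\<lambda>_ x. x) \<Delta> n (\<Delta> n c)) \<and>
      (\<forall>n. \<forall>c\<in>carrier (\<Gamma> n).
        left_unit \<Gamma> n (tensor_map A (ground A) \<Gamma> \<epsilon> (\<lambda>_ x. x) n (\<Delta> n c)) = c \<and>
        right_unit \<Gamma> n (tensor_map A \<Gamma> (ground A) (\<lambda>_ x. x) \<epsilon> n (\<Delta> n c)) = c))"

record ('a, 'c, 'm) gcomodule =
  comod :: "('a, 'm) gmod"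
  coact :: "int \<Rightarrow> 'm \<Rightarrow> (int \<times> 'm \<times> 'c) list set"

definition graded_comodule ::
    "('a, 'r) ring_scheme \<Rightarrow> ('a, 'c) gcoalgebra \<Rightarrow> ('a, 'c, 'm) gcomodule \<Rightarrow> bool"
  where "graded_comodule A C K \<longleftrightarrow>
    (let \<Gamma> = pieces C; M = comod K; \<psi> = coact K in
      graded_module A M \<and>
      graded_hom A M (tensor A M \<Gamma>) \<psi> \<and>
      (\<forall>n. \<forall>x\<in>carrier (M n).
        tensor_assoc A M \<Gamma> \<Gamma> n (tensor_map A (tensor A M \<Gamma>) \<Gamma> \<psi> (\<lambda>_ c. c) n (\<psi> n x)) =
        tensor_map A M (tensor A \<Gamma> \<Gamma>) (\<lambda>_ x. x) (comult C) n (\<psi> n x)) \<and>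
      (\<forall>n. \<forall>x\<in>carrier (M n).
        right_unit M n (tensor_map A M (ground A) (\<lambda>_ x. x) (counit C) n (\<psi> n x)) = x))"


section \<open>Graded algebras, left modules, and the dual algebra\<close>

record ('a, 'b) galgebra =
  apieces :: "('a, 'b) gmod"
  amult :: "int \<Rightarrow> int \<Rightarrow> 'b \<Rightarrow> 'b \<Rightarrow> 'b"
  aone :: "'b"

record ('a, 'b, 'm) gmodule =
  mpieces :: "('a, 'm) gmod"
  act :: "int \<Rightarrow> int \<Rightarrow> 'b \<Rightarrow> 'm \<Rightarrow> 'm"

definition graded_left_module ::
    "('a, 'r) ring_scheme \<Rightarrow> ('a, 'b) galgebra \<Rightarrow> ('a, 'b, 'm) gmodule \<Rightarrow> bool"
  where "graded_left_module A R M \<longleftrightarrow>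
    graded_module A (mpieces M) \<and>
    (\<forall>m n. \<forall>f\<in>carrier (apieces R m).
      act M m n f \<in> module_hom A (mpieces M n) (mpieces M (m + n))) \<and>
    (\<forall>m n. \<forall>x\<in>carrier (mpieces M n).
      (\<lambda>f. act M m n f x) \<in> module_hom A (apieces R m) (mpieces M (m + n))) \<and>
    (\<forall>n. \<forall>x\<in>carrier (mpieces M n). act M 0 n (aone R) x = x) \<and>
    (\<forall>l m n. \<forall>f\<in>carrier (apieces R l). \<forall>g\<in>carrier (apieces R m). \<forall>x\<in>carrier (mpieces M n).
      act M (l + m) n (amult R l m f g) x = act M l (m + n) f (act M m n g x))"

definition gmodule_hom ::
    "('a, 'r) ring_scheme \<Rightarrow> ('a, 'b) galgebra \<Rightarrow> ('a, 'b, 'm) gmodule \<Rightarrow> ('a, 'b, 'n) gmodule \<Rightarrow>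
      (int \<Rightarrow> 'm \<Rightarrow> 'n) \<Rightarrow> bool"
  where "gmodule_hom A R M N \<phi> \<longleftrightarrow>
    graded_hom A (mpieces M) (mpieces N) \<phi> \<and>
    (\<forall>m n. \<forall>f\<in>carrier (apieces R m). \<forall>x\<in>carrier (mpieces M n).
      \<phi> (m + n) (act M m n f x) = act N m n f (\<phi> n x))"

definition gmodule_iso ::
    "('a, 'r) ring_scheme \<Rightarrow> ('a, 'b) galgebra \<Rightarrow> ('a, 'b, 'm) gmodule \<Rightarrow> ('a, 'b, 'n) gmodule \<Rightarrow> bool"
  where "gmodule_iso A R M N \<longleftrightarrow>
    (\<exists>\<phi>. gmodule_hom A R M N \<phi> \<and>
      (\<forall>n. bij_betw (\<phi> n) (carrier (mpieces M n)) (carrier (mpieces N n))))"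

text \<open>Linear forms are extensional functions, so that equality in the dual is equality on the
  carrier. No Koszul signs are used: \<open>(f * g)(c) = \<Sum> f(c\<^sub>1) g(c\<^sub>2)\<close> and
  \<open>f \<cdot> x = \<Sum> x\<^sub>0 f(x\<^sub>1)\<close>. With the signs \<open>(-1)^(\<bar>g\<bar>\<bar>c\<^sub>1\<bar>)\<close> and
  \<open>(-1)^(\<bar>f\<bar>\<bar>x\<^sub>0\<bar>)\<close> one obtains an isomorphic algebra and isomorphic adjoint modules, by
  rescaling degree \<open>n\<close> of the algebra by \<open>(-1)^(n(n-1)/2)\<close> and of the modules by
  \<open>(-1)^(n(n+1)/2)\<close>.\<close>

definition dual_space :: "('a, 'r) ring_scheme \<Rightarrow> ('a, 'c) module \<Rightarrow> ('a, 'c \<Rightarrow> 'a) module"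
  where "dual_space A V = (ring.func_space A (carrier V))
    \<lparr>carrier := module_hom A V (ground A 0) \<inter> extensional (carrier V)\<rparr>"

definition dual_algebra :: "('a, 'r) ring_scheme \<Rightarrow> ('a, 'c) gcoalgebra \<Rightarrow> ('a, 'c \<Rightarrow> 'a) galgebra"
  where "dual_algebra A C =
    \<lparr>apieces = (\<lambda>n. dual_space A (pieces C (- n))),
     amult = (\<lambda>m n f g. \<lambda>c\<in>carrier (pieces C (- (m + n))).
       tensor_lift A (\<lambda>i x y. if i = - m then f x \<otimes>\<^bsub>A\<^esub> g y else \<zero>\<^bsub>A\<^esub>) (comult C (- (m + n)) c)),
     aone = (\<lambda>c\<in>carrier (pieces C 0). counit C 0 c)\<rparr>"

definition finite_type_connected :: "('a, 'r) ring_scheme \<Rightarrow> ('a, 'b) galgebra \<Rightarrow> bool"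
  where "finite_type_connected A R \<longleftrightarrow>
    (\<forall>n. vectorspace.fin_dim A (apieces R n)) \<and>
    vectorspace.dim A (apieces R 0) = 1 \<and>
    (\<forall>n<0. carrier (apieces R n) = {\<zero>\<^bsub>apieces R n\<^esub>})"

definition adjoint_module ::
    "('a, 'c) gcoalgebra \<Rightarrow> ('a, 'c, 'm) gcomodule \<Rightarrow> ('a, 'c \<Rightarrow> 'a, 'm) gmodule"
  where \<comment> \<open>the functor \<open>\<iota>\<close>; a form of degree \<open>m\<close> is extended by zero outside degree \<open>- m\<close> of the coalgebra\<close>
    "adjoint_module C K =
    \<lparr>mpieces = comod K,
     act = (\<lambda>m n f x. tensor_lift (comod K (m + n))
       (\<lambda>i y c. if i = m + n then f c \<odot>\<^bsub>comod K (m + n)\<^esub> y else \<zero>\<^bsub>comod K (m + n)\<^esub>)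
       (coact K n x))\<rparr>"

definition rational ::
    "('a, 'r) ring_scheme \<Rightarrow> ('a, 'c) gcoalgebra \<Rightarrow> ('a, 'c \<Rightarrow> 'a, 'm) gmodule \<Rightarrow> bool"
  where \<comment> \<open>using the element type of \<open>M\<close> for the comodule is no restriction: its structure can be
      transported along the isomorphism\<close>
    "rational A C M \<longleftrightarrow> graded_left_module A (dual_algebra A C) M \<and>
    (\<exists>K :: ('a, 'c, 'm) gcomodule. graded_comodule A C K \<and>
      gmodule_iso A (dual_algebra A C) M (adjoint_module C K))"


section \<open>Inverse sequences and their limits\<close>

definition inverse_sequence ::
    "('a, 'r) ring_scheme \<Rightarrow> ('a, 'b) galgebra \<Rightarrow> (nat \<Rightarrow> ('a, 'b, 'm) gmodule) \<Rightarrow>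
      (nat \<Rightarrow> int \<Rightarrow> 'm \<Rightarrow> 'm) \<Rightarrow> bool"
  where "inverse_sequence A R N \<rho> \<longleftrightarrow>
    (\<forall>k. graded_left_module A R (N k)) \<and> (\<forall>k. gmodule_hom A R (N (Suc k)) (N k) (\<rho> k))"

fun transition :: "(nat \<Rightarrow> int \<Rightarrow> 'm \<Rightarrow> 'm) \<Rightarrow> nat \<Rightarrow> nat \<Rightarrow> int \<Rightarrow> 'm \<Rightarrow> 'm"
  where \<comment> \<open>the composite \<open>N (k + d) \<rightarrow> N k\<close>\<close>
    "transition \<rho> k 0 n x = x"
  | "transition \<rho> k (Suc d) n x = transition \<rho> k d n (\<rho> (k + d) n x)"

definition mittag_leffler ::
    "(nat \<Rightarrow> ('a, 'b, 'm) gmodule) \<Rightarrow> (nat \<Rightarrow> int \<Rightarrow> 'm \<Rightarrow> 'm) \<Rightarrow> bool"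
  where "mittag_leffler N \<rho> \<longleftrightarrow>
    (\<forall>n k. \<exists>d0. \<forall>d\<ge>d0.
      transition \<rho> k d n ` carrier (mpieces (N (k + d)) n) =
      transition \<rho> k d0 n ` carrier (mpieces (N (k + d0)) n))"

definition cone ::
    "('a, 'r) ring_scheme \<Rightarrow> ('a, 'b) galgebra \<Rightarrow> (nat \<Rightarrow> ('a, 'b, 'm) gmodule) \<Rightarrow>
      (nat \<Rightarrow> int \<Rightarrow> 'm \<Rightarrow> 'm) \<Rightarrow> ('a, 'b, 't) gmodule \<Rightarrow> (nat \<Rightarrow> int \<Rightarrow> 't \<Rightarrow> 'm) \<Rightarrow> bool"
  where "cone A R N \<rho> T q \<longleftrightarrow>
    graded_left_module A R T \<and>
    (\<forall>k. gmodule_hom A R T (N k) (q k)) \<and>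
    (\<forall>k n. \<forall>t\<in>carrier (mpieces T n). \<rho> k n (q (Suc k) n t) = q k n t)"

definition factors_uniquely ::
    "('a, 'r) ring_scheme \<Rightarrow> ('a, 'b) galgebra \<Rightarrow> ('a, 'b, 'm) gmodule \<Rightarrow>
      (nat \<Rightarrow> int \<Rightarrow> 'm \<Rightarrow> 'm) \<Rightarrow> ('a, 'b, 't) gmodule \<Rightarrow> (nat \<Rightarrow> int \<Rightarrow> 't \<Rightarrow> 'm) \<Rightarrow> bool"
  where "factors_uniquely A R M p T q \<longleftrightarrow>
    (let mediates = (\<lambda>\<phi>. gmodule_hom A R T M \<phi> \<and>
        (\<forall>k n. \<forall>t\<in>carrier (mpieces T n). p k n (\<phi> n t) = q k n t))
     in (\<exists>\<phi>. mediates \<phi>) \<and>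
        (\<forall>\<phi> \<phi>'. mediates \<phi> \<longrightarrow> mediates \<phi>' \<longrightarrow>
          (\<forall>n. \<forall>t\<in>carrier (mpieces T n). \<phi> n t = \<phi>' n t)))"

text \<open>A definition in HOL cannot quantify over the element types of all cones. Cones with elements
  in \<open>nat \<Rightarrow> 'm\<close> suffice, since both \<open>M\<close> and the module of compatible sequences have copies there:
  \<open>is_limit_factors_uniquely\<close> below shows that cones with elements of any type then factor
  uniquely.\<close>

definition is_limit ::
    "('a, 'r) ring_scheme \<Rightarrow> ('a, 'b) galgebra \<Rightarrow> (nat \<Rightarrow> ('a, 'b, 'm) gmodule) \<Rightarrow>
      (nat \<Rightarrow> int \<Rightarrow> 'm \<Rightarrow> 'm) \<Rightarrow> ('a, 'b, 'm) gmodule \<Rightarrow> (nat \<Rightarrow> int \<Rightarrow> 'm \<Rightarrow> 'm) \<Rightarrow> bool"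
  where "is_limit A R N \<rho> M p \<longleftrightarrow>
    cone A R N \<rho> M p \<and>
    (\<forall>(T :: ('a, 'b, nat \<Rightarrow> 'm) gmodule) q. cone A R N \<rho> T q \<longrightarrow> factors_uniquely A R M p T q)"

subsection \<open>Limits and cones with elements of arbitrary type\<close>

context
  fixes A :: "('a, 'r) ring_scheme" and R :: "('a, 'b) galgebra"
begin

lemma gmodule_homD:
  assumes "gmodule_hom A R M N \<phi>"
  shows "x \<in> carrier (mpieces M n) \<Longrightarrow> \<phi> n x \<in> carrier (mpieces N n)"
    and "x \<in> carrier (mpieces M n) \<Longrightarrow> y \<in> carrier (mpieces M n) \<Longrightarrow>
      \<phi> n (x \<oplus>\<^bsub>mpieces M n\<^esub> y) = \<phi> n x \<oplus>\<^bsub>mpieces N n\<^esub> \<phi> n y"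
    and "a \<in> carrier A \<Longrightarrow> x \<in> carrier (mpieces M n) \<Longrightarrow>
      \<phi> n (a \<odot>\<^bsub>mpieces M n\<^esub> x) = a \<odot>\<^bsub>mpieces N n\<^esub> \<phi> n x"
    and "f \<in> carrier (apieces R m) \<Longrightarrow> x \<in> carrier (mpieces M n) \<Longrightarrow>
      \<phi> (m + n) (act M m n f x) = act N m n f (\<phi> n x)"
  using assms by (auto simp: gmodule_hom_def graded_hom_def module_hom_def Pi_iff)

lemma gmodule_homI:
  assumes "\<And>n x. x \<in> carrier (mpieces M n) \<Longrightarrow> \<phi> n x \<in> carrier (mpieces N n)"
    and "\<And>n x y. x \<in> carrier (mpieces M n) \<Longrightarrow> y \<in> carrier (mpieces M n) \<Longrightarrow>
      \<phi> n (x \<oplus>\<^bsub>mpieces M n\<^esub> y) = \<phi> n x \<oplus>\<^bsub>mpieces N n\<^esub> \<phi> n y"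
    and "\<And>n a x. a \<in> carrier A \<Longrightarrow> x \<in> carrier (mpieces M n) \<Longrightarrow>
      \<phi> n (a \<odot>\<^bsub>mpieces M n\<^esub> x) = a \<odot>\<^bsub>mpieces N n\<^esub> \<phi> n x"
    and "\<And>m n f x. f \<in> carrier (apieces R m) \<Longrightarrow> x \<in> carrier (mpieces M n) \<Longrightarrow>
      \<phi> (m + n) (act M m n f x) = act N m n f (\<phi> n x)"
  shows "gmodule_hom A R M N \<phi>"
  using assms by (auto simp: gmodule_hom_def graded_hom_def module_hom_def Pi_iff)

lemma gmodule_hom_comp:
  assumes "gmodule_hom A R L M \<phi>" "gmodule_hom A R M N \<psi>"
  shows "gmodule_hom A R L N (\<lambda>n x. \<psi> n (\<phi> n x))"
  by (rule gmodule_homI) (simp_all add: gmodule_homD[OF assms(1)] gmodule_homD[OF assms(2)])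

lemma graded_left_moduleD:
  assumes "graded_left_module A R M"
  shows "module A (mpieces M n)"
    and "f \<in> carrier (apieces R m) \<Longrightarrow> x \<in> carrier (mpieces M n) \<Longrightarrow>
      act M m n f x \<in> carrier (mpieces M (m + n))"
    and "f \<in> carrier (apieces R m) \<Longrightarrow> x \<in> carrier (mpieces M n) \<Longrightarrow> y \<in> carrier (mpieces M n) \<Longrightarrow>
      act M m n f (x \<oplus>\<^bsub>mpieces M n\<^esub> y) = act M m n f x \<oplus>\<^bsub>mpieces M (m + n)\<^esub> act M m n f y"
    and "f \<in> carrier (apieces R m) \<Longrightarrow> a \<in> carrier A \<Longrightarrow> x \<in> carrier (mpieces M n) \<Longrightarrow>
      act M m n f (a \<odot>\<^bsub>mpieces M n\<^esub> x) = a \<odot>\<^bsub>mpieces M (m + n)\<^esub> act M m n f x"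
    and "f \<in> carrier (apieces R m) \<Longrightarrow> g \<in> carrier (apieces R m) \<Longrightarrow> x \<in> carrier (mpieces M n) \<Longrightarrow>
      act M m n (f \<oplus>\<^bsub>apieces R m\<^esub> g) x = act M m n f x \<oplus>\<^bsub>mpieces M (m + n)\<^esub> act M m n g x"
    and "a \<in> carrier A \<Longrightarrow> f \<in> carrier (apieces R m) \<Longrightarrow> x \<in> carrier (mpieces M n) \<Longrightarrow>
      act M m n (a \<odot>\<^bsub>apieces R m\<^esub> f) x = a \<odot>\<^bsub>mpieces M (m + n)\<^esub> act M m n f x"
    and "x \<in> carrier (mpieces M n) \<Longrightarrow> act M 0 n (aone R) x = x"
    and "l' \<in> carrier (apieces R l) \<Longrightarrow> g \<in> carrier (apieces R m) \<Longrightarrow> x \<in> carrier (mpieces M n) \<Longrightarrow>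
      act M (l + m) n (amult R l m l' g) x = act M l (m + n) l' (act M m n g x)"
  using assms by (auto simp: graded_left_module_def graded_module_def module_hom_def Pi_iff)

definition subproduct :: "(nat \<Rightarrow> ('a, 'b, 'm) gmodule) \<Rightarrow> (int \<Rightarrow> (nat \<Rightarrow> 'm) set) \<Rightarrow>
    ('a, 'b, nat \<Rightarrow> 'm) gmodule"
  where "subproduct N S =
    \<lparr>mpieces = (\<lambda>n. \<lparr>carrier = S n, mult = undefined, one = undefined,
       zero = (\<lambda>k. \<zero>\<^bsub>mpieces (N k) n\<^esub>),
       add = (\<lambda>x y k. x k \<oplus>\<^bsub>mpieces (N k) n\<^esub> y k),
       smult = (\<lambda>a x k. a \<odot>\<^bsub>mpieces (N k) n\<^esub> x k)\<rparr>),
     act = (\<lambda>m n f x k. act (N k) m n f (x k))\<rparr>"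

lemma subproduct_simps [simp]:
  "carrier (mpieces (subproduct N S) n) = S n"
  "\<zero>\<^bsub>mpieces (subproduct N S) n\<^esub> = (\<lambda>k. \<zero>\<^bsub>mpieces (N k) n\<^esub>)"
  "x \<oplus>\<^bsub>mpieces (subproduct N S) n\<^esub> y = (\<lambda>k. x k \<oplus>\<^bsub>mpieces (N k) n\<^esub> y k)"
  "a \<odot>\<^bsub>mpieces (subproduct N S) n\<^esub> x = (\<lambda>k. a \<odot>\<^bsub>mpieces (N k) n\<^esub> x k)"
  "act (subproduct N S) m n f x = (\<lambda>k. act (N k) m n f (x k))"
  by (simp_all add: subproduct_def)

lemma subproduct_module:
  assumes N: "\<And>k. graded_left_module A R (N k)"
    and S: "\<And>n x k. x \<in> S n \<Longrightarrow> x k \<in> carrier (mpieces (N k) n)"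
    and zero: "\<And>n. (\<lambda>k. \<zero>\<^bsub>mpieces (N k) n\<^esub>) \<in> S n"
    and add: "\<And>n x y. x \<in> S n \<Longrightarrow> y \<in> S n \<Longrightarrow> (\<lambda>k. x k \<oplus>\<^bsub>mpieces (N k) n\<^esub> y k) \<in> S n"
    and smult: "\<And>n a x. a \<in> carrier A \<Longrightarrow> x \<in> S n \<Longrightarrow> (\<lambda>k. a \<odot>\<^bsub>mpieces (N k) n\<^esub> x k) \<in> S n"
    and act: "\<And>m n f x. f \<in> carrier (apieces R m) \<Longrightarrow> x \<in> S n \<Longrightarrow>
      (\<lambda>k. act (N k) m n f (x k)) \<in> S (m + n)"
  shows "graded_left_module A R (subproduct N S)"
proof -
  have "module A (mpieces (subproduct N S) n)" for n
  proof -
    interpret N: module A "mpieces (N k) n" for k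
      by (rule graded_left_moduleD(1)[OF N])
    show ?thesis
    proof (rule moduleI)
      show "cring A" by (rule N.is_cring)
      show "abelian_group (mpieces (subproduct N S) n)"
      proof (rule abelian_groupI)
        fix x assume x: "x \<in> carrier (mpieces (subproduct N S) n)"
        let ?y = "\<lambda>k. (\<ominus>\<^bsub>A\<^esub> \<one>\<^bsub>A\<^esub>) \<odot>\<^bsub>mpieces (N k) n\<^esub> x k"
        have "?y \<in> S n" using x by (intro smult) auto
        moreover have "?y k \<oplus>\<^bsub>mpieces (N k) n\<^esub> x k = \<zero>\<^bsub>mpieces (N k) n\<^esub>" for k
          using x S[of x n k] by (simp add: N.smult_l_minus N.M.l_neg)
        ultimately show "\<exists>y\<in>carrier (mpieces (subproduct N S) n).
            y \<oplus>\<^bsub>mpieces (subproduct N S) n\<^esub> x = \<zero>\<^bsub>mpieces (subproduct N S) n\<^esub>"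
          by (intro bexI[of _ ?y]) auto
      qed (auto simp: S zero add N.M.a_ac intro!: ext)
    qed (auto simp: S smult N.smult_l_distr N.smult_r_distr N.smult_assoc1 intro!: ext)
  qed
  then show ?thesis
    unfolding graded_left_module_def graded_module_def module_hom_def
    by (auto simp: act S graded_left_moduleD[OF N] intro!: ext)
qed

lemma is_limit_factors_uniquely:
  fixes N :: "nat \<Rightarrow> ('a, 'b, 'm) gmodule" and T :: "('a, 'b, 't) gmodule"
  assumes N: "inverse_sequence A R N \<rho>" and lim: "is_limit A R N \<rho> M p" and T: "cone A R N \<rho> T q"
  shows "factors_uniquely A R M p T q"
proof -
  have Nk: "graded_left_module A R (N k)" and \<rho>: "gmodule_hom A R (N (Suc k)) (N k) (\<rho> k)" for k
    using N by (auto simp: inverse_sequence_def)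
  have M: "graded_left_module A R M" and p: "gmodule_hom A R M (N k) (p k)"
    and p\<rho>: "x \<in> carrier (mpieces M n) \<Longrightarrow> \<rho> k n (p (Suc k) n x) = p k n x" for k n x
    using lim by (auto simp: is_limit_def cone_def)
  have q: "gmodule_hom A R T (N k) (q k)"
    and q\<rho>: "t \<in> carrier (mpieces T n) \<Longrightarrow> \<rho> k n (q (Suc k) n t) = q k n t" for k n t
    using T by (auto simp: cone_def)
  have \<rho>0: "\<rho> k n \<zero>\<^bsub>mpieces (N (Suc k)) n\<^esub> = \<zero>\<^bsub>mpieces (N k) n\<^esub>" for k n
  proof -
    interpret N1: module A "mpieces (N (Suc k)) n" by (rule graded_left_moduleD(1)[OF Nk])
    interpret N0: module A "mpieces (N k) n" by (rule graded_left_moduleD(1)[OF Nk])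
    have "\<rho> k n (\<zero>\<^bsub>A\<^esub> \<odot>\<^bsub>mpieces (N (Suc k)) n\<^esub> \<zero>\<^bsub>mpieces (N (Suc k)) n\<^esub>) =
        \<zero>\<^bsub>A\<^esub> \<odot>\<^bsub>mpieces (N k) n\<^esub> \<rho> k n \<zero>\<^bsub>mpieces (N (Suc k)) n\<^esub>"
      by (intro gmodule_homD(3)[OF \<rho>]) auto
    then show ?thesis
      using gmodule_homD(1)[OF \<rho>[of k], of "\<zero>\<^bsub>mpieces (N (Suc k)) n\<^esub>" n] by simp
  qed
  define L where "L = subproduct N (\<lambda>n.
    {x. \<forall>k. x k \<in> carrier (mpieces (N k) n) \<and> \<rho> k n (x (Suc k)) = x k})"
  have Lmod: "graded_left_module A R L"
    unfolding L_def
  proof (rule subproduct_module[OF Nk])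
    show "(\<lambda>k. \<zero>\<^bsub>mpieces (N k) n\<^esub>) \<in>
        {x. \<forall>k. x k \<in> carrier (mpieces (N k) n) \<and> \<rho> k n (x (Suc k)) = x k}" for n
    proof -
      interpret N: module A "mpieces (N k) n" for k by (rule graded_left_moduleD(1)[OF Nk])
      show ?thesis by (simp add: \<rho>0)
    qed
  next
    fix n x y
    interpret N: module A "mpieces (N k) n" for k by (rule graded_left_moduleD(1)[OF Nk])
    assume "x \<in> {x. \<forall>k. x k \<in> carrier (mpieces (N k) n) \<and> \<rho> k n (x (Suc k)) = x k}"
      and "y \<in> {x. \<forall>k. x k \<in> carrier (mpieces (N k) n) \<and> \<rho> k n (x (Suc k)) = x k}"
    then show "(\<lambda>k. x k \<oplus>\<^bsub>mpieces (N k) n\<^esub> y k) \<in>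
        {x. \<forall>k. x k \<in> carrier (mpieces (N k) n) \<and> \<rho> k n (x (Suc k)) = x k}"
      by (simp add: gmodule_homD(2)[OF \<rho>])
  next
    fix n a x
    interpret N: module A "mpieces (N k) n" for k by (rule graded_left_moduleD(1)[OF Nk])
    assume "a \<in> carrier A"
      and "x \<in> {x. \<forall>k. x k \<in> carrier (mpieces (N k) n) \<and> \<rho> k n (x (Suc k)) = x k}"
    then show "(\<lambda>k. a \<odot>\<^bsub>mpieces (N k) n\<^esub> x k) \<in>
        {x. \<forall>k. x k \<in> carrier (mpieces (N k) n) \<and> \<rho> k n (x (Suc k)) = x k}"
      by (simp add: gmodule_homD(3)[OF \<rho>])
  qed (auto simp: graded_left_moduleD(2)[OF Nk] gmodule_homD(4)[OF \<rho>])
  have Lcone: "cone A R N \<rho> L (\<lambda>k n x. x k)"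
    unfolding cone_def using Lmod by (auto simp: L_def intro!: gmodule_homI)
  from lim Lcone have "factors_uniquely A R M p L (\<lambda>k n x. x k)"
    unfolding is_limit_def by simp
  then obtain \<phi> where \<phi>: "gmodule_hom A R L M \<phi>"
    and "\<forall>k n. \<forall>x\<in>carrier (mpieces L n). p k n (\<phi> n x) = x k"
    unfolding factors_uniquely_def Let_def by (elim conjE exE)
  then have p\<phi>: "x \<in> carrier (mpieces L n) \<Longrightarrow> p k n (\<phi> n x) = x k" for k n x
    by blast
  have to_L: "gmodule_hom A R X L (\<lambda>n x k. r k n x)"
    if "\<And>k. gmodule_hom A R X (N k) (r k)"
      "\<And>k n x. x \<in> carrier (mpieces X n) \<Longrightarrow> \<rho> k n (r (Suc k) n x) = r k n x"
    for X :: "('a, 'b, 'x) gmodule" and r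
    by (rule gmodule_homI) (use that in \<open>auto simp: L_def gmodule_homD[OF that(1)]\<close>)
  \<comment> \<open>a copy of \<open>M\<close> with elements in \<open>nat \<Rightarrow> 'm\<close>\<close>
  define E where "E = subproduct (\<lambda>_. M) (\<lambda>n. (\<lambda>x _. x) ` carrier (mpieces M n))"
  have Emod: "graded_left_module A R E"
    unfolding E_def
  proof (rule subproduct_module[OF M])
    show "(\<lambda>k::nat. \<zero>\<^bsub>mpieces M n\<^esub>) \<in> (\<lambda>x _. x) ` carrier (mpieces M n)" for n
    proof -
      interpret module A "mpieces M n" by (rule graded_left_moduleD(1)[OF M])
      show ?thesis by blast
    qed
  next
    fix n and x y :: "nat \<Rightarrow> 'm"
    interpret module A "mpieces M n" by (rule graded_left_moduleD(1)[OF M])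
    assume "x \<in> (\<lambda>x _. x) ` carrier (mpieces M n)" "y \<in> (\<lambda>x _. x) ` carrier (mpieces M n)"
    then show "(\<lambda>k. x k \<oplus>\<^bsub>mpieces M n\<^esub> y k) \<in> (\<lambda>x _. x) ` carrier (mpieces M n)"
      by auto
  next
    fix n a and x :: "nat \<Rightarrow> 'm"
    interpret module A "mpieces M n" by (rule graded_left_moduleD(1)[OF M])
    assume "a \<in> carrier A" "x \<in> (\<lambda>x _. x) ` carrier (mpieces M n)"
    then show "(\<lambda>k. a \<odot>\<^bsub>mpieces M n\<^esub> x k) \<in> (\<lambda>x _. x) ` carrier (mpieces M n)"
      by auto
  qed (auto simp: graded_left_moduleD(2)[OF M])
  have E_M: "gmodule_hom A R E M (\<lambda>n x. x 0)"
    by (rule gmodule_homI) (auto simp: E_def)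
  have Econe: "cone A R N \<rho> E (\<lambda>k n x. p k n (x 0))"
    unfolding cone_def using Emod gmodule_hom_comp[OF E_M p] by (auto simp: E_def p\<rho>)
  from lim Econe have "factors_uniquely A R M p E (\<lambda>k n x. p k n (x 0))"
    unfolding is_limit_def by simp
  then have Euniq: "\<psi> n x = \<psi>' n x"
    if "gmodule_hom A R E M \<psi>" "gmodule_hom A R E M \<psi>'" "x \<in> carrier (mpieces E n)"
      "\<And>k n x. x \<in> carrier (mpieces E n) \<Longrightarrow> p k n (\<psi> n x) = p k n (x 0)"
      "\<And>k n x. x \<in> carrier (mpieces E n) \<Longrightarrow> p k n (\<psi>' n x) = p k n (x 0)" for \<psi> \<psi>' n x
    using that unfolding factors_uniquely_def Let_def by simp
  have M_L: "gmodule_hom A R M L (\<lambda>n x k. p k n x)"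
    by (rule to_L[OF p p\<rho>])
  have from_L: "\<phi> n (\<lambda>k. p k n x) = x" if x: "x \<in> carrier (mpieces M n)" for n x
  proof -
    have "(\<lambda>_. x) \<in> carrier (mpieces E n)" using x by (auto simp: E_def)
    moreover have "p k n (\<phi> n (\<lambda>k. p k n (y 0))) = p k n (y 0)"
      if "y \<in> carrier (mpieces E n)" for k n y
      using p\<phi> gmodule_homD(1)[OF M_L gmodule_homD(1)[OF E_M that]] by simp
    ultimately show ?thesis
      using Euniq[OF gmodule_hom_comp[OF gmodule_hom_comp[OF E_M M_L] \<phi>] E_M, of "\<lambda>_. x" n]
      by simp
  qed
  have T_L: "gmodule_hom A R T L (\<lambda>n t k. q k n t)"
    by (rule to_L[OF q q\<rho>])
  show ?thesis
    unfolding factors_uniquely_def Let_def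
  proof (intro conjI exI allI impI ballI)
    show "gmodule_hom A R T M (\<lambda>n t. \<phi> n (\<lambda>k. q k n t))"
      by (rule gmodule_hom_comp[OF T_L \<phi>])
    show "p k n (\<phi> n (\<lambda>k. q k n t)) = q k n t" if "t \<in> carrier (mpieces T n)" for k n t
      using p\<phi> gmodule_homD(1)[OF T_L that] by simp
  next
    fix \<psi> \<psi>' n t
    assume \<psi>: "gmodule_hom A R T M \<psi> \<and>
        (\<forall>k n. \<forall>t\<in>carrier (mpieces T n). p k n (\<psi> n t) = q k n t)"
      and \<psi>': "gmodule_hom A R T M \<psi>' \<and>
        (\<forall>k n. \<forall>t\<in>carrier (mpieces T n). p k n (\<psi>' n t) = q k n t)"
      and t: "t \<in> carrier (mpieces T n)"
    have "\<psi> n t \<in> carrier (mpieces M n)" "\<psi>' n t \<in> carrier (mpieces M n)"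
      using \<psi> \<psi>' gmodule_homD(1)[OF _ t] by auto
    then have "\<phi> n (\<lambda>k. p k n (\<psi> n t)) = \<psi> n t" "\<phi> n (\<lambda>k. p k n (\<psi>' n t)) = \<psi>' n t"
      by (simp_all only: from_L)
    then show "\<psi> n t = \<psi>' n t" using \<psi> \<psi>' t by simp
  qed
qed

end

end

theory Submission
  imports Defs
begin

text \<open>
  Let \<open>R\<close> be the dual algebra. It vanishes in negative degrees, so it can only raise the degree of
  an element of \<open>M\<close>, and the elements of degree greater than \<open>k\<close> form a submodule. The quotients
  of \<open>M\<close> by these submodules, its truncations, form a sequence with surjective transition maps
  that is constant in degree \<open>n\<close> from the stage \<open>k = n\<close> on. It is therefore Mittag-Leffler, and
  its limit is \<open>M\<close>.

  The substance is that a graded \<open>R\<close>-module \<open>X\<close> that is bounded above is rational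
  (\<open>is_rational\<close>). A vector space with finite-dimensional dual is itself finite-dimensional, so
  every piece of the coalgebra \<open>\<Gamma>\<close> has a finite family of vectors \<open>e\<close> and functionals \<open>\<phi>\<close> with
  \<open>c = \<Sum> \<phi>(c) e\<close> (\<open>dual_system_exists\<close>). The only possible coaction on \<open>X\<close> is then
  \<open>x \<mapsto> \<Sum> \<phi> x \<otimes> e\<close>, summed over these families in all degrees of \<open>\<Gamma>\<close>. The sum is finite: the
  dual of \<open>\<Gamma>\<close> vanishes in negative degrees, and \<open>\<phi> x = 0\<close> once the degree of \<open>\<phi>\<close> is large.

  The comodule axioms are not checked by computing with tensors. A form \<open>f\<close> on a piece of \<open>\<Gamma>\<close>
  induces a map \<open>id \<otimes> f\<close> out of \<open>X \<otimes> \<Gamma>\<close>, here called a slice. The slices separate the elements of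
  \<open>X \<otimes> \<Gamma>\<close> (\<open>tensor_eqI_slices\<close>), and the slice by \<open>f\<close> takes the coaction of \<open>x\<close> to \<open>f x\<close>
  (\<open>slice_coaction\<close>). Slicing translates the counit axiom into \<open>1 x = x\<close> and coassociativity into
  \<open>(f g) x = f (g x)\<close>. Coassociativity is an equation in \<open>X \<otimes> (\<Gamma> \<otimes> \<Gamma>)\<close>; it is moved along the
  inverse associator to \<open>(X \<otimes> \<Gamma>) \<otimes> \<Gamma>\<close>, where slicing twice separates elements.
\<close>


section \<open>Linear maps and finite sums\<close>

lemma module_homI:
  assumes "\<And>x. x \<in> carrier M \<Longrightarrow> F x \<in> carrier N"
    and "\<And>x y. x \<in> carrier M \<Longrightarrow> y \<in> carrier M \<Longrightarrow> F (x \<oplus>\<^bsub>M\<^esub> y) = F x \<oplus>\<^bsub>N\<^esub> F y"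
    and "\<And>a x. a \<in> carrier A \<Longrightarrow> x \<in> carrier M \<Longrightarrow> F (a \<odot>\<^bsub>M\<^esub> x) = a \<odot>\<^bsub>N\<^esub> F x"
  shows "F \<in> module_hom A M N"
  using assms by (auto simp: module_hom_def)

lemma module_homD:
  assumes "F \<in> module_hom A M N"
  shows "x \<in> carrier M \<Longrightarrow> F x \<in> carrier N"
    and "x \<in> carrier M \<Longrightarrow> y \<in> carrier M \<Longrightarrow> F (x \<oplus>\<^bsub>M\<^esub> y) = F x \<oplus>\<^bsub>N\<^esub> F y"
    and "a \<in> carrier A \<Longrightarrow> x \<in> carrier M \<Longrightarrow> F (a \<odot>\<^bsub>M\<^esub> x) = a \<odot>\<^bsub>N\<^esub> F x"
  using assms by (auto simp: module_hom_def)

lemma module_hom_zero: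
  assumes "module A M" "module A N" "F \<in> module_hom A M N"
  shows "F \<zero>\<^bsub>M\<^esub> = \<zero>\<^bsub>N\<^esub>"
proof -
  interpret M: module A M by fact
  interpret N: module A N by fact
  have "F (\<zero>\<^bsub>A\<^esub> \<odot>\<^bsub>M\<^esub> \<zero>\<^bsub>M\<^esub>) = \<zero>\<^bsub>A\<^esub> \<odot>\<^bsub>N\<^esub> F \<zero>\<^bsub>M\<^esub>"
    by (intro module_homD(3)[OF assms(3)]) auto
  then show ?thesis using module_homD(1)[OF assms(3), of "\<zero>\<^bsub>M\<^esub>"] by simp
qed

lemma module_hom_comp:
  assumes "F \<in> module_hom A L M" "G \<in> module_hom A M N"
  shows "(\<lambda>x. G (F x)) \<in> module_hom A L N"
  by (rule module_homI) (simp_all add: module_homD[OF assms(1)] module_homD[OF assms(2)])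

lemma module_hom_id: "(\<lambda>x. x) \<in> module_hom A M M"
  by (rule module_homI) simp_all

lemma module_hom_const_zero:
  assumes "module A N"
  shows "(\<lambda>x. \<zero>\<^bsub>N\<^esub>) \<in> module_hom A M N"
proof -
  interpret N: module A N by fact
  show ?thesis by (rule module_homI) auto
qed

lemma module_hom_add:
  assumes "module A N" "F \<in> module_hom A M N" "G \<in> module_hom A M N"
  shows "(\<lambda>x. F x \<oplus>\<^bsub>N\<^esub> G x) \<in> module_hom A M N"
proof -
  interpret N: module A N by fact
  show ?thesis
    by (rule module_homI)
      (simp_all add: module_homD[OF assms(2)] module_homD[OF assms(3)] N.M.a_ac N.smult_r_distr)
qed

lemma module_hom_smult:
  assumes "module A N" "F \<in> module_hom A M N" "a \<in> carrier A"
  shows "(\<lambda>x. a \<odot>\<^bsub>N\<^esub> F x) \<in> module_hom A M N"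
proof -
  interpret N: module A N by fact
  show ?thesis
    by (rule module_homI)
      (simp_all add: module_homD[OF assms(2)] assms(3) N.smult_r_distr
        N.smult_assoc1[symmetric] N.R.m_comm)
qed

lemma module_hom_cong:
  assumes "module A M" "F \<in> module_hom A M N" "\<And>x. x \<in> carrier M \<Longrightarrow> F x = G x"
  shows "G \<in> module_hom A M N"
proof -
  interpret M: module A M by fact
  show ?thesis
    by (rule module_homI) (simp_all add: module_homD[OF assms(2)] assms(3)[symmetric])
qed

lemma module_hom_smult_left:
  assumes "module A N" "F \<in> module_hom A M (ground A 0)" "x \<in> carrier N"
  shows "(\<lambda>c. F c \<odot>\<^bsub>N\<^esub> x) \<in> module_hom A M N"
proof -
  interpret N: module A N by fact
  show ?thesis
    by (rule module_homI)
      (use module_homD[OF assms(2)] assms(3) in \<open>auto simp: ground_def N.smult_l_distr N.smult_assoc1\<close>)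
qed

text \<open>Sums run over lists, because the formal sums that represent tensors are lists.\<close>

definition list_sum :: "('p, 'z) ring_scheme \<Rightarrow> ('x \<Rightarrow> 'p) \<Rightarrow> 'x list \<Rightarrow> 'p"
  where "list_sum P h zs = foldr (\<lambda>z s. h z \<oplus>\<^bsub>P\<^esub> s) zs \<zero>\<^bsub>P\<^esub>"

lemma list_sum_simps [simp]:
  "list_sum P h [] = \<zero>\<^bsub>P\<^esub>"
  "list_sum P h (z # zs) = h z \<oplus>\<^bsub>P\<^esub> list_sum P h zs"
  by (simp_all add: list_sum_def)

lemma list_sum_cong:
  "(\<And>z. z \<in> set zs \<Longrightarrow> h z = h' z) \<Longrightarrow> list_sum P h zs = list_sum P h' zs"
  by (induction zs) auto

lemma list_sum_closed:
  assumes "module A P" and "\<And>z. z \<in> set zs \<Longrightarrow> h z \<in> carrier P"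
  shows "list_sum P h zs \<in> carrier P"
proof -
  interpret P: module A P by fact
  show ?thesis using assms(2) by (induction zs) auto
qed

lemma list_sum_zero:
  assumes "module A P"
  shows "list_sum P (\<lambda>z. \<zero>\<^bsub>P\<^esub>) zs = \<zero>\<^bsub>P\<^esub>"
proof -
  interpret P: module A P by fact
  show ?thesis by (induction zs) auto
qed

lemma list_sum_delta:
  assumes "module A P" "v \<in> carrier P" "distinct zs"
  shows "list_sum P (\<lambda>z. if z = k then v else \<zero>\<^bsub>P\<^esub>) zs = (if k \<in> set zs then v else \<zero>\<^bsub>P\<^esub>)"
proof -
  interpret P: module A P by fact
  show ?thesis using assms(2,3) by (induction zs) auto
qed

lemma module_hom_list_sum:
  assumes "module A M" "module A N" "F \<in> module_hom A M N"
  shows "(\<And>z. z \<in> set zs \<Longrightarrow> h z \<in> carrier M) \<Longrightarrow>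
    F (list_sum M h zs) = list_sum N (\<lambda>z. F (h z)) zs"
  by (induction zs)
    (simp_all add: module_hom_zero[OF assms] module_homD[OF assms(3)] list_sum_closed[OF assms(1)])

lemma list_sum_module_hom:
  assumes "module A N"
  shows "(\<And>z. z \<in> set zs \<Longrightarrow> (\<lambda>x. h x z) \<in> module_hom A M N) \<Longrightarrow>
    (\<lambda>x. list_sum N (h x) zs) \<in> module_hom A M N"
  by (induction zs) (simp_all add: module_hom_const_zero[OF assms] module_hom_add[OF assms])


section \<open>Vector spaces with finite-dimensional dual\<close>

lemma ground_module:
  assumes "cring A"
  shows "module A (ground A n)"
proof -
  interpret cring A by fact
  show ?thesis
  proof (rule moduleI)
    show "abelian_group (ground A n)"
    proof (rule abelian_groupI)
      fix x assume "x \<in> carrier (ground A n)"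
      then show "\<exists>y\<in>carrier (ground A n). y \<oplus>\<^bsub>ground A n\<^esub> x = \<zero>\<^bsub>ground A n\<^esub>"
        by (intro bexI[of _ "\<ominus>\<^bsub>A\<^esub> x"]) (auto simp: ground_def l_neg split: if_splits)
    qed (auto simp: ground_def a_ac split: if_splits)
  qed (auto simp: ground_def is_cring m_assoc l_distr r_distr split: if_splits)
qed

lemma dual_space_simps:
  assumes "ring A"
  shows "carrier (dual_space A V) = module_hom A V (ground A 0) \<inter> extensional (carrier V)"
    and "\<zero>\<^bsub>dual_space A V\<^esub> = (\<lambda>c\<in>carrier V. \<zero>\<^bsub>A\<^esub>)"
    and "f \<oplus>\<^bsub>dual_space A V\<^esub> g = (\<lambda>c\<in>carrier V. f c \<oplus>\<^bsub>A\<^esub> g c)"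
    and "a \<odot>\<^bsub>dual_space A V\<^esub> f = (\<lambda>c\<in>carrier V. a \<otimes>\<^bsub>A\<^esub> f c)"
  by (simp_all add: dual_space_def ring.func_space_def[OF assms])

lemma restrict_mem_dual_space:
  assumes "module A V" "F \<in> module_hom A V (ground A 0)"
  shows "restrict F (carrier V) \<in> carrier (dual_space A V)"
proof -
  interpret V: module A V by fact
  show ?thesis
    using module_hom_cong[OF assms, of "restrict F (carrier V)"]
    by (simp add: dual_space_simps[OF V.R.ring_axioms])
qed

lemma dual_space_module:
  assumes "module A V"
  shows "module A (dual_space A V)"
proof -
  interpret V: module A V by fact
  interpret F: module A "V.R.func_space (carrier V)" by (rule V.R.func_space_is_module)
  have g: "module A (ground A 0)" by (rule ground_module[OF V.is_cring])
  note fs = V.R.func_space_def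
  have "LinearCombinations.submodule A (module_hom A V (ground A 0) \<inter> extensional (carrier V))
      (V.R.func_space (carrier V))"
  proof
    show "module_hom A V (ground A 0) \<inter> extensional (carrier V) \<subseteq>
        carrier (V.R.func_space (carrier V))"
      by (auto simp: fs module_hom_def ground_def PiE_def)
  next
    fix f g assume "f \<in> module_hom A V (ground A 0) \<inter> extensional (carrier V)"
      and "g \<in> module_hom A V (ground A 0) \<inter> extensional (carrier V)"
    then show "f \<oplus>\<^bsub>V.R.func_space (carrier V)\<^esub> g \<in>
        module_hom A V (ground A 0) \<inter> extensional (carrier V)"
      using restrict_mem_dual_space[OF assms module_hom_add[OF g]]
      by (auto simp: fs dual_space_simps[OF V.R.ring_axioms] ground_def)
  next
    show "\<zero>\<^bsub>V.R.func_space (carrier V)\<^esub> \<in> module_hom A V (ground A 0) \<inter> extensional (carrier V)"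
      using restrict_mem_dual_space[OF assms module_hom_const_zero[OF g]]
      by (auto simp: fs dual_space_simps[OF V.R.ring_axioms] ground_def)
  next
    fix a f assume "a \<in> carrier A" "f \<in> module_hom A V (ground A 0) \<inter> extensional (carrier V)"
    then show "a \<odot>\<^bsub>V.R.func_space (carrier V)\<^esub> f \<in>
        module_hom A V (ground A 0) \<inter> extensional (carrier V)"
      using restrict_mem_dual_space[OF assms module_hom_smult[OF g]]
      by (auto simp: fs dual_space_simps[OF V.R.ring_axioms] ground_def)
  qed
  from F.submodule_is_module[OF this] show ?thesis by (simp add: dual_space_def)
qed

text \<open>By Zorn's lemma there is a subspace \<open>W\<close> that is maximal among those not containing \<open>v\<close>. By
  maximality, \<open>W\<close> and \<open>v\<close> span the space, so every vector is \<open>a v + w\<close> for a unique scalar \<open>a\<close>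
  and some \<open>w\<close> in \<open>W\<close>, and taking the coordinate \<open>a\<close> is a functional with value 1 at \<open>v\<close>.\<close>

lemma functional_nonzero_at:
  fixes V :: "('a, 'v) module"
  assumes "field A" "module A V" and v: "v \<in> carrier V" "v \<noteq> \<zero>\<^bsub>V\<^esub>"
  shows "\<exists>F\<in>module_hom A V (ground A 0). F v \<noteq> \<zero>\<^bsub>A\<^esub>"
proof -
  interpret field A by fact
  interpret V: module A V by fact
  define S where "S = {W. LinearCombinations.submodule A W V \<and> v \<notin> W}"
  note sub_def = LinearCombinations.submodule_def
  have "{\<zero>\<^bsub>V\<^esub>} \<in> S"
    using v by (simp add: S_def sub_def V.module_axioms)
  moreover have "\<Union>C \<in> S" if "C \<noteq> {}" "subset.chain S C" for C
  proof -
    have C: "LinearCombinations.submodule A W V" "v \<notin> W" if "W \<in> C" for W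
      using \<open>subset.chain S C\<close> that by (auto simp: S_def subset.chain_def)
    have "x \<oplus>\<^bsub>V\<^esub> y \<in> \<Union>C" if xy: "x \<in> \<Union>C" "y \<in> \<Union>C" for x y
    proof -
      obtain X Y where XY: "X \<in> C" "x \<in> X" "Y \<in> C" "y \<in> Y" using xy by auto
      then have "X \<subseteq> Y \<or> Y \<subseteq> X"
        using \<open>subset.chain S C\<close> by (auto simp: subset_chain_def)
      then obtain Z where "Z \<in> C" "x \<in> Z" "y \<in> Z" using XY by blast
      then have "x \<oplus>\<^bsub>V\<^esub> y \<in> Z" using C(1)[of Z] by (simp add: sub_def)
      with \<open>Z \<in> C\<close> show ?thesis by blast
    qed
    moreover have "\<zero>\<^bsub>V\<^esub> \<in> \<Union>C" using C \<open>C \<noteq> {}\<close> unfolding sub_def by blast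
    moreover have "\<Union>C \<subseteq> carrier V" using C unfolding sub_def by blast
    moreover have "a \<odot>\<^bsub>V\<^esub> x \<in> \<Union>C" if "a \<in> carrier A" "x \<in> \<Union>C" for a x
      using C that unfolding sub_def by blast
    ultimately show ?thesis using C by (auto simp: S_def sub_def V.module_axioms)
  qed
  ultimately obtain W where W: "W \<in> S" and max: "\<And>U. U \<in> S \<Longrightarrow> W \<subseteq> U \<Longrightarrow> U = W"
    using subset_Zorn_nonempty[of S] by blast
  have vW: "v \<notin> W" and WV: "\<And>w. w \<in> W \<Longrightarrow> w \<in> carrier V" and W0: "\<zero>\<^bsub>V\<^esub> \<in> W"
    and Wadd: "\<And>x y. x \<in> W \<Longrightarrow> y \<in> W \<Longrightarrow> x \<oplus>\<^bsub>V\<^esub> y \<in> W"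
    and Wsm: "\<And>a x. a \<in> carrier A \<Longrightarrow> x \<in> W \<Longrightarrow> a \<odot>\<^bsub>V\<^esub> x \<in> W"
    using W by (auto simp: S_def sub_def)
  have Wneg: "\<ominus>\<^bsub>V\<^esub> w \<in> W" if "w \<in> W" for w
    using Wsm[of "\<ominus>\<^bsub>A\<^esub> \<one>\<^bsub>A\<^esub>" w] WV[OF that] that by (simp add: V.smult_l_minus)
  define coord where "coord c a \<longleftrightarrow> a \<in> carrier A \<and> (\<exists>w\<in>W. c = a \<odot>\<^bsub>V\<^esub> v \<oplus>\<^bsub>V\<^esub> w)" for c a
  have ex: "\<exists>a. coord c a" if c: "c \<in> carrier V" for c
  proof (cases "c \<in> W")
    case True
    then have "coord c \<zero>\<^bsub>A\<^esub>" using v c by (auto simp: coord_def intro!: bexI[of _ c])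
    then show ?thesis ..
  next
    case False
    \<comment> \<open>\<open>W + A c\<close> is strictly larger than \<open>W\<close>, so it contains \<open>v\<close>; solve for \<open>c\<close>\<close>
    define U where "U = {w \<oplus>\<^bsub>V\<^esub> a \<odot>\<^bsub>V\<^esub> c |w a. w \<in> W \<and> a \<in> carrier A}"
    have U: "w \<oplus>\<^bsub>V\<^esub> a \<odot>\<^bsub>V\<^esub> c \<in> U" if "w \<in> W" "a \<in> carrier A" for w a
      using that by (auto simp: U_def)
    have "W \<subseteq> U"
    proof
      fix w assume "w \<in> W"
      then show "w \<in> U" using U[of w "\<zero>\<^bsub>A\<^esub>"] c WV by simp
    qed
    moreover have "c \<in> U" using U[OF W0, of "\<one>\<^bsub>A\<^esub>"] c by simp
    ultimately have "U \<notin> S" using max[of U] False by auto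
    moreover have "LinearCombinations.submodule A U V"
      unfolding sub_def
    proof (intro conjI allI impI)
      show "module A V" by fact
      show "U \<subseteq> carrier V" using WV c by (auto simp: U_def)
      show "\<zero>\<^bsub>V\<^esub> \<in> U" using U[OF W0, of "\<zero>\<^bsub>A\<^esub>"] c by simp
    next
      fix x y assume "x \<in> U" "y \<in> U"
      then obtain w a w' a' where xy: "x = w \<oplus>\<^bsub>V\<^esub> a \<odot>\<^bsub>V\<^esub> c" "y = w' \<oplus>\<^bsub>V\<^esub> a' \<odot>\<^bsub>V\<^esub> c"
        "w \<in> W" "w' \<in> W" "a \<in> carrier A" "a' \<in> carrier A" by (auto simp: U_def)
      then have "x \<oplus>\<^bsub>V\<^esub> y = (w \<oplus>\<^bsub>V\<^esub> w') \<oplus>\<^bsub>V\<^esub> (a \<oplus>\<^bsub>A\<^esub> a') \<odot>\<^bsub>V\<^esub> c"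
        using WV c by (simp add: V.smult_l_distr V.M.a_ac)
      then show "x \<oplus>\<^bsub>V\<^esub> y \<in> U" using U[of "w \<oplus>\<^bsub>V\<^esub> w'" "a \<oplus>\<^bsub>A\<^esub> a'"] xy Wadd by auto
    next
      fix b x assume b: "b \<in> carrier A" and "x \<in> U"
      then obtain w a where x: "x = w \<oplus>\<^bsub>V\<^esub> a \<odot>\<^bsub>V\<^esub> c" "w \<in> W" "a \<in> carrier A"
        by (auto simp: U_def)
      then have "b \<odot>\<^bsub>V\<^esub> x = b \<odot>\<^bsub>V\<^esub> w \<oplus>\<^bsub>V\<^esub> (b \<otimes>\<^bsub>A\<^esub> a) \<odot>\<^bsub>V\<^esub> c"
        using WV c b by (simp add: V.smult_r_distr V.smult_assoc1)
      then show "b \<odot>\<^bsub>V\<^esub> x \<in> U" using U[of "b \<odot>\<^bsub>V\<^esub> w" "b \<otimes>\<^bsub>A\<^esub> a"] x Wsm b by auto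
    qed
    ultimately obtain w a where wa: "v = w \<oplus>\<^bsub>V\<^esub> a \<odot>\<^bsub>V\<^esub> c" "w \<in> W" "a \<in> carrier A"
      by (auto simp: S_def U_def)
    have "a \<noteq> \<zero>\<^bsub>A\<^esub>" using wa vW c WV by auto
    then have a: "inv\<^bsub>A\<^esub> a \<in> carrier A" "inv\<^bsub>A\<^esub> a \<otimes>\<^bsub>A\<^esub> a = \<one>\<^bsub>A\<^esub>"
      using wa(3) field_Units by auto
    have "inv\<^bsub>A\<^esub> a \<odot>\<^bsub>V\<^esub> v = inv\<^bsub>A\<^esub> a \<odot>\<^bsub>V\<^esub> w \<oplus>\<^bsub>V\<^esub> c"
      using wa a c WV by (simp add: V.smult_r_distr V.smult_assoc1[symmetric])
    moreover have "(u \<oplus>\<^bsub>V\<^esub> c) \<oplus>\<^bsub>V\<^esub> \<ominus>\<^bsub>V\<^esub> u = c" if "u \<in> carrier V" for u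
      using that c by (simp add: V.M.a_comm[of u c] V.M.a_assoc V.M.r_neg)
    ultimately have "c = inv\<^bsub>A\<^esub> a \<odot>\<^bsub>V\<^esub> v \<oplus>\<^bsub>V\<^esub> \<ominus>\<^bsub>V\<^esub> (inv\<^bsub>A\<^esub> a \<odot>\<^bsub>V\<^esub> w)"
      using wa(2) a(1) WV by simp
    then have "coord c (inv\<^bsub>A\<^esub> a)"
      using a wa Wneg[OF Wsm] by (auto simp: coord_def)
    then show ?thesis ..
  qed
  have uniq: "a = b" if ab: "coord c a" "coord c b" for c a b
  proof (rule ccontr)
    assume "a \<noteq> b"
    obtain w w' where *: "a \<in> carrier A" "b \<in> carrier A" "w \<in> W" "w' \<in> W"
      "a \<odot>\<^bsub>V\<^esub> v \<oplus>\<^bsub>V\<^esub> w = b \<odot>\<^bsub>V\<^esub> v \<oplus>\<^bsub>V\<^esub> w'"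
      using ab by (metis coord_def)
    have d: "a \<ominus>\<^bsub>A\<^esub> b \<noteq> \<zero>\<^bsub>A\<^esub>" using \<open>a \<noteq> b\<close> * by simp
    have cancel: "(x \<oplus>\<^bsub>V\<^esub> w) \<oplus>\<^bsub>V\<^esub> \<ominus>\<^bsub>V\<^esub> w = x" if "x \<in> carrier V" for x
      using that WV[OF *(3)] by (simp add: V.M.a_assoc V.M.r_neg)
    have "(a \<ominus>\<^bsub>A\<^esub> b) \<odot>\<^bsub>V\<^esub> v = \<ominus>\<^bsub>V\<^esub> (b \<odot>\<^bsub>V\<^esub> v) \<oplus>\<^bsub>V\<^esub> a \<odot>\<^bsub>V\<^esub> v"
      using * v by (simp add: a_minus_def V.smult_l_distr V.smult_l_minus V.M.a_comm)
    also have "a \<odot>\<^bsub>V\<^esub> v = (b \<odot>\<^bsub>V\<^esub> v \<oplus>\<^bsub>V\<^esub> w') \<oplus>\<^bsub>V\<^esub> \<ominus>\<^bsub>V\<^esub> w"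
      using cancel[of "a \<odot>\<^bsub>V\<^esub> v"] * v by simp
    also have "\<ominus>\<^bsub>V\<^esub> (b \<odot>\<^bsub>V\<^esub> v) \<oplus>\<^bsub>V\<^esub> ((b \<odot>\<^bsub>V\<^esub> v \<oplus>\<^bsub>V\<^esub> w') \<oplus>\<^bsub>V\<^esub> \<ominus>\<^bsub>V\<^esub> w) = w' \<oplus>\<^bsub>V\<^esub> \<ominus>\<^bsub>V\<^esub> w"
      using *(2-4) v(1) WV by (simp add: V.M.a_assoc V.M.r_neg1)
    also have "\<dots> \<in> W" using * Wadd Wneg by blast
    finally have dv: "(a \<ominus>\<^bsub>A\<^esub> b) \<odot>\<^bsub>V\<^esub> v \<in> W" .
    have i: "inv\<^bsub>A\<^esub> (a \<ominus>\<^bsub>A\<^esub> b) \<in> carrier A"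
      "inv\<^bsub>A\<^esub> (a \<ominus>\<^bsub>A\<^esub> b) \<otimes>\<^bsub>A\<^esub> (a \<ominus>\<^bsub>A\<^esub> b) = \<one>\<^bsub>A\<^esub>"
      using d * field_Units by auto
    then have "inv\<^bsub>A\<^esub> (a \<ominus>\<^bsub>A\<^esub> b) \<odot>\<^bsub>V\<^esub> ((a \<ominus>\<^bsub>A\<^esub> b) \<odot>\<^bsub>V\<^esub> v) = v"
      using * v by (simp add: V.smult_assoc1[symmetric])
    then show False using Wsm[OF i(1) dv] vW by simp
  qed
  define F where "F c = (SOME a. coord c a)" for c
  have F: "coord c (F c)" if "c \<in> carrier V" for c
    unfolding F_def by (rule someI_ex[OF ex[OF that]])
  have FI: "F c = a" if "c \<in> carrier V" "coord c a" for c a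
    using uniq F that by blast
  have "F \<in> module_hom A V (ground A 0)"
  proof (rule module_homI)
    show "F c \<in> carrier (ground A 0)" if "c \<in> carrier V" for c
      using F[OF that] by (simp add: coord_def ground_def)
  next
    fix x y assume xy: "x \<in> carrier V" "y \<in> carrier V"
    obtain w w' where *: "F x \<in> carrier A" "F y \<in> carrier A" "w \<in> W" "w' \<in> W"
      "x = F x \<odot>\<^bsub>V\<^esub> v \<oplus>\<^bsub>V\<^esub> w" "y = F y \<odot>\<^bsub>V\<^esub> v \<oplus>\<^bsub>V\<^esub> w'"
      using F[OF xy(1)] F[OF xy(2)] by (auto simp: coord_def)
    have "(F x \<odot>\<^bsub>V\<^esub> v \<oplus>\<^bsub>V\<^esub> w) \<oplus>\<^bsub>V\<^esub> (F y \<odot>\<^bsub>V\<^esub> v \<oplus>\<^bsub>V\<^esub> w') =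
        (F x \<oplus>\<^bsub>A\<^esub> F y) \<odot>\<^bsub>V\<^esub> v \<oplus>\<^bsub>V\<^esub> (w \<oplus>\<^bsub>V\<^esub> w')"
      using *(1-4) v WV by (simp add: V.smult_l_distr V.M.a_ac)
    then have "coord (x \<oplus>\<^bsub>V\<^esub> y) (F x \<oplus>\<^bsub>A\<^esub> F y)"
      unfolding coord_def *(5,6)[symmetric] using *(1-4) Wadd by blast
    then show "F (x \<oplus>\<^bsub>V\<^esub> y) = F x \<oplus>\<^bsub>ground A 0\<^esub> F y"
      using FI xy by (simp add: ground_def)
  next
    fix a x assume a: "a \<in> carrier A" and x: "x \<in> carrier V"
    obtain w where *: "F x \<in> carrier A" "w \<in> W" "x = F x \<odot>\<^bsub>V\<^esub> v \<oplus>\<^bsub>V\<^esub> w"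
      using F[OF x] by (auto simp: coord_def)
    have "a \<odot>\<^bsub>V\<^esub> (F x \<odot>\<^bsub>V\<^esub> v \<oplus>\<^bsub>V\<^esub> w) = (a \<otimes>\<^bsub>A\<^esub> F x) \<odot>\<^bsub>V\<^esub> v \<oplus>\<^bsub>V\<^esub> a \<odot>\<^bsub>V\<^esub> w"
      using *(1,2) a v WV by (simp add: V.smult_r_distr V.smult_assoc1)
    then have "coord (a \<odot>\<^bsub>V\<^esub> x) (a \<otimes>\<^bsub>A\<^esub> F x)"
      unfolding coord_def *(3)[symmetric] using *(1,2) a Wsm by blast
    then show "F (a \<odot>\<^bsub>V\<^esub> x) = a \<odot>\<^bsub>ground A 0\<^esub> F x"
      using FI a x by (simp add: ground_def)
  qed
  moreover have "coord v \<one>\<^bsub>A\<^esub>" using v W0 by (auto simp: coord_def intro!: bexI[of _ "\<zero>\<^bsub>V\<^esub>"])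
  then have "F v \<noteq> \<zero>\<^bsub>A\<^esub>" using FI v by simp
  ultimately show ?thesis by blast
qed

text \<open>A factorisation of the identity through a finite free module, as given by a finite basis and
  its dual basis. In this form it can be applied inside tensor products without a choice of basis
  there.\<close>

definition dual_system :: "('a, 'r) ring_scheme \<Rightarrow> ('a, 'v) module \<Rightarrow> ('v \<times> ('v \<Rightarrow> 'a)) list \<Rightarrow> bool"
  where "dual_system A V D \<longleftrightarrow> set D \<subseteq> carrier V \<times> carrier (dual_space A V) \<and>
    (\<forall>c\<in>carrier V. list_sum V (\<lambda>d. snd d c \<odot>\<^bsub>V\<^esub> fst d) D = c)"

lemma mem_dual_spaceD:
  assumes "ring A" "F \<in> carrier (dual_space A V)"
  shows "F \<in> module_hom A V (ground A 0)"
    and "c \<in> carrier V \<Longrightarrow> F c \<in> carrier A"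
  using assms module_homD(1)[of F A V "ground A 0" c] by (auto simp: dual_space_simps ground_def)

text \<open>Finitely many functionals are killed by subtracting a suitable map of finite rank. If \<open>\<pi>\<close> is
  a map into the common kernel obtained so far, and the next functional \<open>F\<close> takes a nonzero value
  at some \<open>\<pi> v\<close>, then \<open>\<pi>\<close> is corrected by a multiple of \<open>\<pi> v\<close> normalised to \<open>F\<close>-value 1. This
  multiple lies in the previous common kernel, so the earlier functionals still vanish.\<close>

lemma projection_to_common_kernel:
  fixes V :: "('a, 'v) module"
  assumes "field A" "module A V" and "set Fs \<subseteq> carrier (dual_space A V)"
  shows "\<exists>D. set D \<subseteq> carrier V \<times> carrier (dual_space A V) \<and>
    (\<forall>c\<in>carrier V. \<forall>F\<in>set Fs.
      F (c \<ominus>\<^bsub>V\<^esub> list_sum V (\<lambda>d. snd d c \<odot>\<^bsub>V\<^esub> fst d) D) = \<zero>\<^bsub>A\<^esub>)"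
  using assms(3)
proof (induction Fs)
  case Nil
  show ?case by (rule exI[of _ "[]"]) simp
next
  interpret field A by fact
  interpret V: module A V by fact
  have g: "module A (ground A 0)" by (rule ground_module[OF is_cring])
  case (Cons F Fs)
  then obtain D where D: "set D \<subseteq> carrier V \<times> carrier (dual_space A V)"
    and ker: "\<And>c G. c \<in> carrier V \<Longrightarrow> G \<in> set Fs \<Longrightarrow>
      G (c \<ominus>\<^bsub>V\<^esub> list_sum V (\<lambda>d. snd d c \<odot>\<^bsub>V\<^esub> fst d) D) = \<zero>\<^bsub>A\<^esub>"
    by auto
  let ?S = "\<lambda>D c. list_sum V (\<lambda>d. snd d c \<odot>\<^bsub>V\<^esub> fst d) D"
  define \<pi> where "\<pi> c = c \<ominus>\<^bsub>V\<^esub> ?S D c" for c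
  have FD: "G \<in> module_hom A V (ground A 0)" if "G \<in> set (F # Fs)" for G
    using Cons.prems that mem_dual_spaceD(1)[OF ring_axioms] by blast
  have S: "?S D \<in> module_hom A V V"
    by (rule list_sum_module_hom[OF assms(2)])
      (use D in \<open>auto intro!: module_hom_smult_left[OF assms(2)] mem_dual_spaceD(1)[OF ring_axioms]\<close>)
  have "(\<lambda>c. c \<oplus>\<^bsub>V\<^esub> (\<ominus>\<^bsub>A\<^esub> \<one>\<^bsub>A\<^esub>) \<odot>\<^bsub>V\<^esub> ?S D c) \<in> module_hom A V V"
    by (intro module_hom_add module_hom_id module_hom_smult S assms(2)) simp
  then have \<pi>: "\<pi> \<in> module_hom A V V"
    by (rule module_hom_cong[OF assms(2)])
      (simp add: \<pi>_def a_minus_def V.smult_l_minus module_homD(1)[OF S])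
  have \<pi>c: "\<pi> c \<in> carrier V" if "c \<in> carrier V" for c
    using module_homD(1)[OF \<pi> that] .
  have F\<pi>: "(\<lambda>c. F (\<pi> c)) \<in> module_hom A V (ground A 0)"
    by (rule module_hom_comp[OF \<pi> FD]) simp
  have F\<pi>c: "F (\<pi> c) \<in> carrier A" if "c \<in> carrier V" for c
    using module_homD(1)[OF F\<pi> that] by (simp add: ground_def)
  show ?case
  proof (cases "\<forall>c\<in>carrier V. F (\<pi> c) = \<zero>\<^bsub>A\<^esub>")
    case True
    then show ?thesis using D ker by (intro exI[of _ D]) (auto simp: \<pi>_def)
  next
    case False
    then obtain v where v: "v \<in> carrier V" "F (\<pi> v) \<noteq> \<zero>\<^bsub>A\<^esub>" by blast
    define a where "a = inv\<^bsub>A\<^esub> (F (\<pi> v))"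
    have a: "a \<in> carrier A" "a \<otimes>\<^bsub>A\<^esub> F (\<pi> v) = \<one>\<^bsub>A\<^esub>"
      using v F\<pi>c[OF v(1)] field_Units by (auto simp: a_def)
    define e where "e = a \<odot>\<^bsub>V\<^esub> \<pi> v"
    have e: "e \<in> carrier V" using a \<pi>c[OF v(1)] by (simp add: e_def)
    define D' where "D' = (e, \<lambda>c\<in>carrier V. F (\<pi> c)) # D"
    have "c \<ominus>\<^bsub>V\<^esub> ?S D' c = \<pi> c \<oplus>\<^bsub>V\<^esub> (\<ominus>\<^bsub>A\<^esub> F (\<pi> c)) \<odot>\<^bsub>V\<^esub> e" if c: "c \<in> carrier V" for c
    proof -
      have "x \<ominus>\<^bsub>V\<^esub> (y \<oplus>\<^bsub>V\<^esub> z) = (x \<ominus>\<^bsub>V\<^esub> z) \<oplus>\<^bsub>V\<^esub> \<ominus>\<^bsub>V\<^esub> y"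
        if "x \<in> carrier V" "y \<in> carrier V" "z \<in> carrier V" for x y z
        using that by (simp add: a_minus_def V.M.minus_add V.M.a_ac)
      then show ?thesis
        using c e F\<pi>c[OF c] module_homD(1)[OF S c]
        by (simp add: D'_def \<pi>_def[of c, symmetric] V.smult_l_minus)
    qed
    moreover have "G (\<pi> c \<oplus>\<^bsub>V\<^esub> (\<ominus>\<^bsub>A\<^esub> F (\<pi> c)) \<odot>\<^bsub>V\<^esub> e) =
        G (\<pi> c) \<oplus>\<^bsub>A\<^esub> \<ominus>\<^bsub>A\<^esub> F (\<pi> c) \<otimes>\<^bsub>A\<^esub> (a \<otimes>\<^bsub>A\<^esub> G (\<pi> v))"
      if "c \<in> carrier V" "G \<in> set (F # Fs)" for c G
      using that e v a F\<pi>c \<pi>c module_homD(2,3)[OF FD[OF that(2)]] by (simp add: ground_def e_def)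
    moreover have "G (\<pi> c) \<oplus>\<^bsub>A\<^esub> \<ominus>\<^bsub>A\<^esub> F (\<pi> c) \<otimes>\<^bsub>A\<^esub> (a \<otimes>\<^bsub>A\<^esub> G (\<pi> v)) = \<zero>\<^bsub>A\<^esub>"
      if "c \<in> carrier V" "G \<in> set (F # Fs)" for c G
    proof (cases "G = F")
      case True
      then show ?thesis using a F\<pi>c[OF that(1)] by (simp add: r_neg)
    next
      case False
      then have "G (\<pi> c) = \<zero>\<^bsub>A\<^esub>" "G (\<pi> v) = \<zero>\<^bsub>A\<^esub>"
        using ker[of c G] ker[of v G] that v(1) by (simp_all add: \<pi>_def)
      then show ?thesis using a F\<pi>c[OF that(1)] by simp
    qed
    moreover have "set D' \<subseteq> carrier V \<times> carrier (dual_space A V)"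
      using D e restrict_mem_dual_space[OF assms(2) F\<pi>] by (simp add: D'_def)
    ultimately show ?thesis by (intro exI[of _ D']) simp
  qed
qed

text \<open>Take the projection to the common kernel of a finite spanning set of the dual. The remainder
  of a vector is annihilated by every functional, hence zero.\<close>

lemma dual_system_exists:
  fixes V :: "('a, 'v) module"
  assumes "field A" "module A V" "vectorspace.fin_dim A (dual_space A V)"
  shows "\<exists>D. dual_system A V D"
proof -
  interpret field A by fact
  interpret V: module A V by fact
  interpret V': vectorspace A "dual_space A V"
    by (intro vectorspace.intro dual_space_module assms)
  obtain B where B: "finite B" "B \<subseteq> carrier (dual_space A V)" "V'.span B = carrier (dual_space A V)"
    using assms(3) V'.fin_dim_def by auto
  obtain Fs where Fs: "set Fs = B" using B(1) finite_list by blast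
  obtain D where D: "set D \<subseteq> carrier V \<times> carrier (dual_space A V)"
    and ker: "\<And>c F. c \<in> carrier V \<Longrightarrow> F \<in> B \<Longrightarrow>
      F (c \<ominus>\<^bsub>V\<^esub> list_sum V (\<lambda>d. snd d c \<odot>\<^bsub>V\<^esub> fst d) D) = \<zero>\<^bsub>A\<^esub>"
    using projection_to_common_kernel[OF assms(1,2), of Fs] B(2) Fs by auto
  have "list_sum V (\<lambda>d. snd d c \<odot>\<^bsub>V\<^esub> fst d) D = c" if c: "c \<in> carrier V" for c
  proof -
    let ?s = "list_sum V (\<lambda>d. snd d c \<odot>\<^bsub>V\<^esub> fst d) D"
    have "snd d c \<odot>\<^bsub>V\<^esub> fst d \<in> carrier V" if "d \<in> set D" for d
      using D that mem_dual_spaceD(2)[OF ring_axioms _ c, of "snd d"] by auto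
    then have s: "?s \<in> carrier V"
      by (rule list_sum_closed[OF assms(2)])
    let ?r = "c \<ominus>\<^bsub>V\<^esub> ?s"
    have r: "?r \<in> carrier V" using c s by simp
    let ?N = "{F \<in> carrier (dual_space A V). F ?r = \<zero>\<^bsub>A\<^esub>}"
    have "LinearCombinations.submodule A ?N (dual_space A V)"
      unfolding LinearCombinations.submodule_def
      using V'.module_axioms r V'.M.add.m_closed V'.M.zero_closed V'.smult_closed
      by (auto simp: dual_space_simps(2-4)[OF ring_axioms])
    moreover have "B \<subseteq> ?N" using B(2) ker[OF c] by blast
    ultimately have all: "carrier (dual_space A V) \<subseteq> ?N"
      unfolding B(3)[symmetric] by (intro V'.span_is_subset)
    have "?r = \<zero>\<^bsub>V\<^esub>"
    proof (rule ccontr)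
      assume "?r \<noteq> \<zero>\<^bsub>V\<^esub>"
      then obtain F where F: "F \<in> module_hom A V (ground A 0)" "F ?r \<noteq> \<zero>\<^bsub>A\<^esub>"
        using functional_nonzero_at[OF assms(1,2) r] by blast
      then show False
        using all restrict_mem_dual_space[OF assms(2) F(1)] r by auto
    qed
    then show ?thesis using c s by simp
  qed
  then show ?thesis using D by (auto simp: dual_system_def)
qed

text \<open>The transpose of \<open>c = \<Sum> \<phi>(c) e\<close>: applying \<open>f\<close> gives \<open>f = \<Sum> f(e) \<phi>\<close>.\<close>

lemma dual_system_expand_functional:
  assumes "module A V" "dual_system A V D" and f: "f \<in> carrier (dual_space A V)"
  shows "list_sum (dual_space A V) (\<lambda>d. f (fst d) \<odot>\<^bsub>dual_space A V\<^esub> snd d) D = f"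
proof -
  interpret V: module A V by fact
  interpret V': module A "dual_space A V" by (rule dual_space_module[OF assms(1)])
  have g: "module A (ground A 0)" by (rule ground_module[OF V.is_cring])
  note dsD = mem_dual_spaceD[OF V.R.ring_axioms] and dss = dual_space_simps[OF V.R.ring_axioms]
  have D: "fst d \<in> carrier V" "snd d \<in> carrier (dual_space A V)" if "d \<in> set D" for d
    using assms(2) that by (auto simp: dual_system_def)
  let ?g = "list_sum (dual_space A V) (\<lambda>d. f (fst d) \<odot>\<^bsub>dual_space A V\<^esub> snd d) D"
  have closed: "f (fst d) \<odot>\<^bsub>dual_space A V\<^esub> snd d \<in> carrier (dual_space A V)" if "d \<in> set D" for d
    using D[OF that] dsD(2)[OF f] by simp
  have "?g c = f c" if c: "c \<in> carrier V" for c
  proof -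
    have ev: "(\<lambda>h. h c) \<in> module_hom A (dual_space A V) (ground A 0)"
    proof (rule module_homI)
      show "h c \<in> carrier (ground A 0)" if "h \<in> carrier (dual_space A V)" for h
        using dsD(2)[OF that c] by (simp add: ground_def)
    qed (use c in \<open>auto simp: dss(2-4) ground_def\<close>)
    have "?g c = list_sum (ground A 0) (\<lambda>d. (f (fst d) \<odot>\<^bsub>dual_space A V\<^esub> snd d) c) D"
      by (rule module_hom_list_sum[OF V'.module_axioms g ev closed])
    also have "\<dots> = list_sum (ground A 0) (\<lambda>d. f (snd d c \<odot>\<^bsub>V\<^esub> fst d)) D"
    proof (rule list_sum_cong)
      fix d assume d: "d \<in> set D"
      show "(f (fst d) \<odot>\<^bsub>dual_space A V\<^esub> snd d) c = f (snd d c \<odot>\<^bsub>V\<^esub> fst d)"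
        using c D[OF d] dsD(2)[OF f] dsD(2)[OF D(2)[OF d] c] module_homD(3)[OF dsD(1)[OF f]]
        by (simp add: dss(4) ground_def V.R.m_comm)
    qed
    also have "\<dots> = f (list_sum V (\<lambda>d. snd d c \<odot>\<^bsub>V\<^esub> fst d) D)"
      by (rule module_hom_list_sum[OF assms(1) g dsD(1)[OF f], symmetric])
        (simp add: D dsD(2)[OF D(2) c])
    finally show ?thesis using assms(2) c by (simp add: dual_system_def)
  qed
  moreover have "?g \<in> carrier (dual_space A V)"
    by (rule list_sum_closed[OF V'.module_axioms]) (rule closed)
  ultimately show ?thesis
    using f by (auto simp: dss(1) intro!: extensionalityI)
qed


section \<open>Linear maps out of tensor products\<close>

lemma graded_moduleD: "graded_module A M \<Longrightarrow> module A (M n)"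
  by (simp add: graded_module_def)

lemma graded_homD: "graded_hom A M N \<phi> \<Longrightarrow> \<phi> n \<in> module_hom A (M n) (N n)"
  by (simp add: graded_hom_def)

lemma tensor_module: "graded_module A M \<Longrightarrow> graded_module A N \<Longrightarrow> module A (tensor A M N n)"
  by (rule graded_moduleD[OF tensor_graded_module])

text \<open>In the next lemmas the degree of the second factor is a variable \<open>k\<close> with \<open>k = n - i\<close>, so that
  they apply whatever form the difference takes.\<close>

lemma pure_tensor_closed:
  "x \<in> carrier (M i) \<Longrightarrow> y \<in> carrier (N k) \<Longrightarrow> k = n - i \<Longrightarrow>
    pure_tensor A M N n i x y \<in> carrier (tensor A M N n)"
  by (auto simp: tensor_def pure_tensor_def)

lemma pure_tensor_hom_left:
  assumes gm: "graded_module A M" "graded_module A N" and y: "y \<in> carrier (N k)" "k = n - i"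
  shows "(\<lambda>x. pure_tensor A M N n i x y) \<in> module_hom A (M i) (tensor A M N n)"
proof -
  interpret Mi: module A "M i" by (rule graded_moduleD[OF gm(1)])
  note y' = y(1)[unfolded y(2)]
  show ?thesis
  proof (rule module_homI)
    fix x x' assume x: "x \<in> carrier (M i)" "x' \<in> carrier (M i)"
    then show "pure_tensor A M N n i (x \<oplus>\<^bsub>M i\<^esub> x') y =
        pure_tensor A M N n i x y \<oplus>\<^bsub>tensor A M N n\<^esub> pure_tensor A M N n i x' y"
      using y' tensor_class_eqI[OF gm tensor_eq.add_left[where M = M and N = N, OF x y']]
      by (simp add: pure_tensor_def tensor_add_class[OF gm])
  next
    fix a x assume "a \<in> carrier A" "x \<in> carrier (M i)"
    then show "pure_tensor A M N n i (a \<odot>\<^bsub>M i\<^esub> x) y = a \<odot>\<^bsub>tensor A M N n\<^esub> pure_tensor A M N n i x y"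
      using y' by (simp add: pure_tensor_def tensor_smult_class[OF gm])
  qed (simp add: pure_tensor_closed[where M = M and N = N, OF _ y])
qed

lemma pure_tensor_hom_right:
  assumes gm: "graded_module A M" "graded_module A N" and x: "x \<in> carrier (M i)" and k: "k = n - i"
  shows "(\<lambda>y. pure_tensor A M N n i x y) \<in> module_hom A (N k) (tensor A M N n)"
proof -
  interpret Nk: module A "N k" by (rule graded_moduleD[OF gm(2)])
  show ?thesis
  proof (rule module_homI)
    fix y y' assume "y \<in> carrier (N k)" "y' \<in> carrier (N k)"
    then show "pure_tensor A M N n i x (y \<oplus>\<^bsub>N k\<^esub> y') =
        pure_tensor A M N n i x y \<oplus>\<^bsub>tensor A M N n\<^esub> pure_tensor A M N n i x y'"
      using x k tensor_class_eqI[OF gm tensor_eq.add_right[where M = M and N = N and i = i, OF x]]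
      by (simp add: pure_tensor_def tensor_add_class[OF gm])
  next
    fix a y assume "a \<in> carrier A" "y \<in> carrier (N k)"
    then show "pure_tensor A M N n i x (a \<odot>\<^bsub>N k\<^esub> y) = a \<odot>\<^bsub>tensor A M N n\<^esub> pure_tensor A M N n i x y"
      using x k tensor_class_eqI[OF gm tensor_eq.balanced[of a A x M i y N n]]
      by (simp add: pure_tensor_def tensor_smult_class[OF gm])
  qed (simp add: pure_tensor_closed[where M = M and N = N, OF x _ k])
qed

lemma bilinear_mapsI:
  assumes "\<And>i x. x \<in> carrier (M i) \<Longrightarrow> (\<lambda>y. \<beta> i x y) \<in> module_hom A (N (n - i)) P"
    and "\<And>i y. y \<in> carrier (N (n - i)) \<Longrightarrow> (\<lambda>x. \<beta> i x y) \<in> module_hom A (M i) P"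
  shows "bilinear_maps A M N n P \<beta>"
  using assms by (simp add: bilinear_maps_def)

text \<open>The uniqueness half of the universal property, since every tensor is a sum of pure ones. It
  replaces explicit computation in all identities between maps out of tensor products below.\<close>

lemma tensor_hom_eqI:
  assumes gm: "graded_module A M" "graded_module A N" and P: "module A P"
    and FG: "F \<in> module_hom A (tensor A M N n) P" "G \<in> module_hom A (tensor A M N n) P"
    and pure: "\<And>i x y. x \<in> carrier (M i) \<Longrightarrow> y \<in> carrier (N (n - i)) \<Longrightarrow>
      F (pure_tensor A M N n i x y) = G (pure_tensor A M N n i x y)"
    and t: "t \<in> carrier (tensor A M N n)"
  shows "F t = G t"
proof -
  note T = tensor_module[OF gm]
  have "F (tensor_class A M N n xs) = G (tensor_class A M N n xs)"
    if "xs \<in> formal_tensors M N n" for xs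
    using that
  proof (induction xs)
    case Nil
    have "tensor_class A M N n [] = \<zero>\<^bsub>tensor A M N n\<^esub>" by (simp add: tensor_def)
    then show ?case using module_hom_zero[OF T P] FG by metis
  next
    case (Cons z xs)
    obtain i x y where z: "z = (i, x, y)" by (cases z)
    have xs: "xs \<in> formal_tensors M N n" and xy: "x \<in> carrier (M i)" "y \<in> carrier (N (n - i))"
      using Cons.prems z by auto
    have "tensor_class A M N n (z # xs) =
        pure_tensor A M N n i x y \<oplus>\<^bsub>tensor A M N n\<^esub> tensor_class A M N n xs"
      using tensor_add_class[OF gm, of "[z]" n xs] Cons.prems z xs by (simp add: pure_tensor_def)
    moreover have c: "tensor_class A M N n xs \<in> carrier (tensor A M N n)"
      using xs by (simp add: tensor_def)
    moreover have p: "pure_tensor A M N n i x y \<in> carrier (tensor A M N n)"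
      by (rule pure_tensor_closed[where M = M and N = N, OF xy HOL.refl])
    ultimately show ?case
      using pure[OF xy] Cons.IH[OF xs]
      by (simp add: module_homD(2)[OF FG(1) p c] module_homD(2)[OF FG(2) p c])
  qed
  then show ?thesis using t by (auto simp: tensor_def)
qed

text \<open>If the bilinear maps depend linearly on a parameter \<open>w\<close>, so does their lift, because the
  two sides of each linearity rule are linear maps that agree on pure tensors. This makes nested lifts, which
  define maps out of threefold tensor products, well-defined.\<close>

lemma tensor_lift_param_hom:
  assumes gm: "graded_module A M" "graded_module A N" and P: "module A P" and W: "module A W"
    and bil: "\<And>w. w \<in> carrier W \<Longrightarrow> bilinear_maps A M N n P (\<beta> w)"
    and lin: "\<And>i x y. x \<in> carrier (M i) \<Longrightarrow> y \<in> carrier (N (n - i)) \<Longrightarrow>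
      (\<lambda>w. \<beta> w i x y) \<in> module_hom A W P"
    and t: "t \<in> carrier (tensor A M N n)"
  shows "(\<lambda>w. tensor_lift P (\<beta> w) t) \<in> module_hom A W P"
proof -
  interpret W: module A W by fact
  note hom = tensor_lift_hom[OF gm P bil] and pure = tensor_lift_pure[OF gm P bil]
  show ?thesis
  proof (rule module_homI)
    fix w assume w: "w \<in> carrier W"
    show "tensor_lift P (\<beta> w) t \<in> carrier P" using module_homD(1)[OF hom[OF w] t] .
  next
    fix v w assume vw: "v \<in> carrier W" "w \<in> carrier W"
    then have s: "v \<oplus>\<^bsub>W\<^esub> w \<in> carrier W" by simp
    show "tensor_lift P (\<beta> (v \<oplus>\<^bsub>W\<^esub> w)) t = tensor_lift P (\<beta> v) t \<oplus>\<^bsub>P\<^esub> tensor_lift P (\<beta> w) t"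
      by (rule tensor_hom_eqI[OF gm P hom[OF s] module_hom_add[OF P hom[OF vw(1)] hom[OF vw(2)]] _ t])
        (simp add: pure[OF s] pure[OF vw(1)] pure[OF vw(2)] module_homD(2)[OF lin] vw)
  next
    fix a w assume a: "a \<in> carrier A" and w: "w \<in> carrier W"
    then have s: "a \<odot>\<^bsub>W\<^esub> w \<in> carrier W" by simp
    show "tensor_lift P (\<beta> (a \<odot>\<^bsub>W\<^esub> w)) t = a \<odot>\<^bsub>P\<^esub> tensor_lift P (\<beta> w) t"
      by (rule tensor_hom_eqI[OF gm P hom[OF s] module_hom_smult[OF P hom[OF w] a] _ t])
        (simp add: pure[OF s] pure[OF w] module_homD(3)[OF lin] a w)
  qed
qed

lemma bilinear_maps_pure_comp:
  assumes gm: "graded_module A M'" "graded_module A N'"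
    and \<phi>: "graded_hom A M M' \<phi>" and \<psi>: "graded_hom A N N' \<psi>"
  shows "bilinear_maps A M N n (tensor A M' N' n)
    (\<lambda>i x y. pure_tensor A M' N' n i (\<phi> i x) (\<psi> (n - i) y))"
proof (rule bilinear_mapsI)
  fix i x assume "x \<in> carrier (M i)"
  then have "\<phi> i x \<in> carrier (M' i)" by (rule module_homD(1)[OF graded_homD[OF \<phi>]])
  from module_hom_comp[OF graded_homD[OF \<psi>] pure_tensor_hom_right[where M = M' and N = N', OF gm this HOL.refl]]
  show "(\<lambda>y. pure_tensor A M' N' n i (\<phi> i x) (\<psi> (n - i) y)) \<in>
      module_hom A (N (n - i)) (tensor A M' N' n)" .
next
  fix i y assume "y \<in> carrier (N (n - i))"
  then have "\<psi> (n - i) y \<in> carrier (N' (n - i))" by (rule module_homD(1)[OF graded_homD[OF \<psi>]])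
  from module_hom_comp[OF graded_homD[OF \<phi>] pure_tensor_hom_left[where M = M' and N = N', OF gm this HOL.refl]]
  show "(\<lambda>x. pure_tensor A M' N' n i (\<phi> i x) (\<psi> (n - i) y)) \<in>
      module_hom A (M i) (tensor A M' N' n)" .
qed

lemma tensor_map_hom:
  assumes "graded_module A M" "graded_module A N" "graded_module A M'" "graded_module A N'"
    and "graded_hom A M M' \<phi>" "graded_hom A N N' \<psi>"
  shows "tensor_map A M' N' \<phi> \<psi> n \<in> module_hom A (tensor A M N n) (tensor A M' N' n)"
  unfolding tensor_map_def
  by (intro tensor_lift_hom bilinear_maps_pure_comp tensor_module assms)

lemma tensor_map_pure:
  assumes "graded_module A M" "graded_module A N" "graded_module A M'" "graded_module A N'"
    and "graded_hom A M M' \<phi>" "graded_hom A N N' \<psi>"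
    and "x \<in> carrier (M i)" "y \<in> carrier (N (n - i))"
  shows "tensor_map A M' N' \<phi> \<psi> n (pure_tensor A M N n i x y) =
    pure_tensor A M' N' n i (\<phi> i x) (\<psi> (n - i) y)"
  unfolding tensor_map_def
  by (intro tensor_lift_pure bilinear_maps_pure_comp tensor_module assms)

lemma graded_hom_id: "graded_hom A M M (\<lambda>_ x. x)"
  by (simp add: graded_hom_def module_hom_id)


section \<open>The associator and its inverse\<close>

lemma bilinear_maps_nested_left:
  assumes gm: "graded_module A M" "graded_module A N" "graded_module A P" and Q: "module A Q"
    and "\<And>i z. z \<in> carrier (P (n - i)) \<Longrightarrow> bilinear_maps A M N i Q (\<lambda>j x y. \<tau> i j x y z)"
    and "\<And>i j x y. x \<in> carrier (M j) \<Longrightarrow> y \<in> carrier (N (i - j)) \<Longrightarrow>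
      (\<lambda>z. \<tau> i j x y z) \<in> module_hom A (P (n - i)) Q"
  shows "bilinear_maps A (tensor A M N) P n Q (\<lambda>i u z. tensor_lift Q (\<lambda>j x y. \<tau> i j x y z) u)"
proof (rule bilinear_mapsI)
  fix i u assume u: "u \<in> carrier (tensor A M N i)"
  show "(\<lambda>z. tensor_lift Q (\<lambda>j x y. \<tau> i j x y z) u) \<in> module_hom A (P (n - i)) Q"
    by (rule tensor_lift_param_hom[where \<beta> = "\<lambda>z j x y. \<tau> i j x y z",
          OF gm(1,2) Q graded_moduleD[OF gm(3)] _ _ u]) (simp_all add: assms)
next
  fix i z assume "z \<in> carrier (P (n - i))"
  then show "tensor_lift Q (\<lambda>j x y. \<tau> i j x y z) \<in> module_hom A (tensor A M N i) Q"
    by (rule tensor_lift_hom[OF gm(1,2) Q assms(5)])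
qed

lemma bilinear_maps_nested_right:
  assumes gm: "graded_module A M" "graded_module A N" "graded_module A P" and Q: "module A Q"
    and "\<And>i x. x \<in> carrier (M i) \<Longrightarrow> bilinear_maps A N P (n - i) Q (\<lambda>j y z. \<tau> i j x y z)"
    and "\<And>i j y z. y \<in> carrier (N j) \<Longrightarrow> z \<in> carrier (P (n - i - j)) \<Longrightarrow>
      (\<lambda>x. \<tau> i j x y z) \<in> module_hom A (M i) Q"
  shows "bilinear_maps A M (tensor A N P) n Q (\<lambda>i x u. tensor_lift Q (\<lambda>j y z. \<tau> i j x y z) u)"
proof (rule bilinear_mapsI)
  fix i x assume "x \<in> carrier (M i)"
  then show "tensor_lift Q (\<lambda>j y z. \<tau> i j x y z) \<in> module_hom A (tensor A N P (n - i)) Q"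
    by (rule tensor_lift_hom[OF gm(2,3) Q assms(5)])
next
  fix i u assume u: "u \<in> carrier (tensor A N P (n - i))"
  show "(\<lambda>x. tensor_lift Q (\<lambda>j y z. \<tau> i j x y z) u) \<in> module_hom A (M i) Q"
    by (rule tensor_lift_param_hom[where \<beta> = "\<lambda>x j y z. \<tau> i j x y z",
          OF gm(2,3) Q graded_moduleD[OF gm(1)] _ _ u]) (simp_all add: assms)
qed

context
  fixes A :: "('a, 'r) ring_scheme"
    and M :: "('a, 'm) gmod" and N :: "('a, 'n) gmod" and P :: "('a, 'p) gmod"
  assumes gm: "graded_module A M" "graded_module A N" "graded_module A P"
begin

lemma assoc_inner_bilinear:
  assumes z: "z \<in> carrier (P (n - i))"
  shows "bilinear_maps A M N i (tensor A M (tensor A N P) n)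
    (\<lambda>j x y. pure_tensor A M (tensor A N P) n j x (pure_tensor A N P (n - j) (i - j) y z))"
proof (rule bilinear_mapsI)
  fix j x assume x: "x \<in> carrier (M j)"
  show "(\<lambda>y. pure_tensor A M (tensor A N P) n j x (pure_tensor A N P (n - j) (i - j) y z)) \<in>
      module_hom A (N (i - j)) (tensor A M (tensor A N P) n)"
    by (rule module_hom_comp[OF pure_tensor_hom_left[OF gm(2,3) z]
          pure_tensor_hom_right[OF gm(1) tensor_graded_module[OF gm(2,3)] x]]) auto
next
  fix j y assume y: "y \<in> carrier (N (i - j))"
  show "(\<lambda>x. pure_tensor A M (tensor A N P) n j x (pure_tensor A N P (n - j) (i - j) y z)) \<in>
      module_hom A (M j) (tensor A M (tensor A N P) n)"
    by (rule pure_tensor_hom_left[OF gm(1) tensor_graded_module[OF gm(2,3)]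
          pure_tensor_closed[where M = N and N = P, OF y z]]) auto
qed

lemma assoc_bilinear:
  "bilinear_maps A (tensor A M N) P n (tensor A M (tensor A N P) n)
    (\<lambda>i u z. tensor_lift (tensor A M (tensor A N P) n)
      (\<lambda>j x y. pure_tensor A M (tensor A N P) n j x (pure_tensor A N P (n - j) (i - j) y z)) u)"
proof (rule bilinear_maps_nested_left[OF gm tensor_module[OF gm(1) tensor_graded_module[OF gm(2,3)]]
      assoc_inner_bilinear])
  fix i j x y assume x: "x \<in> carrier (M j)" and y: "y \<in> carrier (N (i - j))"
  show "(\<lambda>z. pure_tensor A M (tensor A N P) n j x (pure_tensor A N P (n - j) (i - j) y z)) \<in>
      module_hom A (P (n - i)) (tensor A M (tensor A N P) n)"
    by (rule module_hom_comp[OF pure_tensor_hom_right[OF gm(2,3) y]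
          pure_tensor_hom_right[OF gm(1) tensor_graded_module[OF gm(2,3)] x]]) auto
qed

lemma tensor_assoc_hom:
  "tensor_assoc A M N P n \<in>
    module_hom A (tensor A (tensor A M N) P n) (tensor A M (tensor A N P) n)"
  unfolding tensor_assoc_def
  by (intro tensor_lift_hom assoc_bilinear tensor_module tensor_graded_module gm)

lemma tensor_assoc_pure:
  assumes "x \<in> carrier (M j)" "y \<in> carrier (N (i - j))" "z \<in> carrier (P (n - i))"
  shows "tensor_assoc A M N P n (pure_tensor A (tensor A M N) P n i (pure_tensor A M N i j x y) z) =
    pure_tensor A M (tensor A N P) n j x (pure_tensor A N P (n - j) (i - j) y z)"
proof -
  note Q = tensor_module[OF gm(1) tensor_graded_module[OF gm(2,3)]]
  have "tensor_assoc A M N P n (pure_tensor A (tensor A M N) P n i (pure_tensor A M N i j x y) z) =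
    tensor_lift (tensor A M (tensor A N P) n)
      (\<lambda>j x y. pure_tensor A M (tensor A N P) n j x (pure_tensor A N P (n - j) (i - j) y z))
      (pure_tensor A M N i j x y)"
    unfolding tensor_assoc_def
    by (rule tensor_lift_pure[OF tensor_graded_module[OF gm(1,2)] gm(3) Q assoc_bilinear
          pure_tensor_closed[where M = M and N = N, OF assms(1,2) HOL.refl] assms(3)])
  also have "\<dots> = pure_tensor A M (tensor A N P) n j x (pure_tensor A N P (n - j) (i - j) y z)"
    by (rule tensor_lift_pure[OF gm(1,2) Q assoc_inner_bilinear[OF assms(3)] assms(1,2)])
  finally show ?thesis .
qed

text \<open>The map \<open>x \<otimes> (y \<otimes> z) \<mapsto> (x \<otimes> y) \<otimes> z\<close>. If \<open>x\<close> and \<open>y\<close> have degrees \<open>i\<close> and \<open>j\<close>, then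
  \<open>x \<otimes> y\<close> has degree \<open>i + j\<close>.\<close>

definition tensor_unassoc :: "int \<Rightarrow> (int \<times> 'm \<times> (int \<times> 'n \<times> 'p) list set) list set \<Rightarrow>
    (int \<times> (int \<times> 'm \<times> 'n) list set \<times> 'p) list set"
  where "tensor_unassoc n =
    tensor_lift (tensor A (tensor A M N) P n) (\<lambda>i x u.
      tensor_lift (tensor A (tensor A M N) P n) (\<lambda>j y z.
        pure_tensor A (tensor A M N) P n (i + j) (pure_tensor A M N (i + j) i x y) z) u)"

lemma unassoc_inner_bilinear:
  assumes x: "x \<in> carrier (M i)"
  shows "bilinear_maps A N P (n - i) (tensor A (tensor A M N) P n)
    (\<lambda>j y z. pure_tensor A (tensor A M N) P n (i + j) (pure_tensor A M N (i + j) i x y) z)"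
proof (rule bilinear_mapsI)
  fix j y assume y: "y \<in> carrier (N j)"
  show "(\<lambda>z. pure_tensor A (tensor A M N) P n (i + j) (pure_tensor A M N (i + j) i x y) z) \<in>
      module_hom A (P (n - i - j)) (tensor A (tensor A M N) P n)"
    by (rule pure_tensor_hom_right[OF tensor_graded_module[OF gm(1,2)] gm(3)
          pure_tensor_closed[where M = M and N = N, OF x y]]) auto
next
  fix j z assume z: "z \<in> carrier (P (n - i - j))"
  show "(\<lambda>y. pure_tensor A (tensor A M N) P n (i + j) (pure_tensor A M N (i + j) i x y) z) \<in>
      module_hom A (N j) (tensor A (tensor A M N) P n)"
    by (rule module_hom_comp[OF pure_tensor_hom_right[OF gm(1,2) x]
          pure_tensor_hom_left[OF tensor_graded_module[OF gm(1,2)] gm(3) z]]) auto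
qed

lemma unassoc_bilinear:
  "bilinear_maps A M (tensor A N P) n (tensor A (tensor A M N) P n)
    (\<lambda>i x u. tensor_lift (tensor A (tensor A M N) P n)
      (\<lambda>j y z. pure_tensor A (tensor A M N) P n (i + j) (pure_tensor A M N (i + j) i x y) z) u)"
proof (rule bilinear_maps_nested_right[OF gm tensor_module[OF tensor_graded_module[OF gm(1,2)] gm(3)]
      unassoc_inner_bilinear])
  fix i j y z assume y: "y \<in> carrier (N j)" and z: "z \<in> carrier (P (n - i - j))"
  show "(\<lambda>x. pure_tensor A (tensor A M N) P n (i + j) (pure_tensor A M N (i + j) i x y) z) \<in>
      module_hom A (M i) (tensor A (tensor A M N) P n)"
    by (rule module_hom_comp[OF pure_tensor_hom_left[OF gm(1,2) y]
          pure_tensor_hom_left[OF tensor_graded_module[OF gm(1,2)] gm(3) z]]) auto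
qed

lemma tensor_unassoc_hom:
  "tensor_unassoc n \<in>
    module_hom A (tensor A M (tensor A N P) n) (tensor A (tensor A M N) P n)"
  unfolding tensor_unassoc_def
  by (intro tensor_lift_hom unassoc_bilinear tensor_module tensor_graded_module gm)

lemma tensor_unassoc_pure_hom:
  assumes x: "x \<in> carrier (M i)"
  shows "(\<lambda>u. tensor_unassoc n (pure_tensor A M (tensor A N P) n i x u)) \<in>
    module_hom A (tensor A N P (n - i)) (tensor A (tensor A M N) P n)"
  by (rule module_hom_comp[OF pure_tensor_hom_right[OF gm(1) tensor_graded_module[OF gm(2,3)] x HOL.refl]
        tensor_unassoc_hom])

lemma tensor_unassoc_pure:
  assumes "x \<in> carrier (M i)" "y \<in> carrier (N j)" "z \<in> carrier (P (n - i - j))"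
  shows "tensor_unassoc n (pure_tensor A M (tensor A N P) n i x (pure_tensor A N P (n - i) j y z)) =
    pure_tensor A (tensor A M N) P n (i + j) (pure_tensor A M N (i + j) i x y) z"
proof -
  note Q = tensor_module[OF tensor_graded_module[OF gm(1,2)] gm(3)]
  have "tensor_unassoc n (pure_tensor A M (tensor A N P) n i x (pure_tensor A N P (n - i) j y z)) =
    tensor_lift (tensor A (tensor A M N) P n)
      (\<lambda>j y z. pure_tensor A (tensor A M N) P n (i + j) (pure_tensor A M N (i + j) i x y) z)
      (pure_tensor A N P (n - i) j y z)"
    unfolding tensor_unassoc_def
    by (rule tensor_lift_pure[OF gm(1) tensor_graded_module[OF gm(2,3)] Q unassoc_bilinear
          assms(1) pure_tensor_closed[where M = N and N = P, OF assms(2,3) HOL.refl]])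
  also have "\<dots> = pure_tensor A (tensor A M N) P n (i + j) (pure_tensor A M N (i + j) i x y) z"
    by (rule tensor_lift_pure[OF gm(2,3) Q unassoc_inner_bilinear[OF assms(1)] assms(2,3)])
  finally show ?thesis .
qed

lemma tensor_assoc_unassoc:
  assumes t: "t \<in> carrier (tensor A M (tensor A N P) n)"
  shows "tensor_assoc A M N P n (tensor_unassoc n t) = t"
proof (rule tensor_hom_eqI[OF gm(1) tensor_graded_module[OF gm(2,3)]
      tensor_module[OF gm(1) tensor_graded_module[OF gm(2,3)]]
      module_hom_comp[OF tensor_unassoc_hom tensor_assoc_hom] module_hom_id _ t])
  fix i x u assume x: "x \<in> carrier (M i)" and u: "u \<in> carrier (tensor A N P (n - i))"
  show "tensor_assoc A M N P n (tensor_unassoc n (pure_tensor A M (tensor A N P) n i x u)) =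
      pure_tensor A M (tensor A N P) n i x u"
  proof (rule tensor_hom_eqI[OF gm(2,3) tensor_module[OF gm(1) tensor_graded_module[OF gm(2,3)]]
      module_hom_comp[OF tensor_unassoc_pure_hom[OF x] tensor_assoc_hom]
      pure_tensor_hom_right[OF gm(1) tensor_graded_module[OF gm(2,3)] x HOL.refl] _ u])
    fix j y z assume y: "y \<in> carrier (N j)" and z: "z \<in> carrier (P (n - i - j))"
    show "tensor_assoc A M N P n (tensor_unassoc n
        (pure_tensor A M (tensor A N P) n i x (pure_tensor A N P (n - i) j y z))) =
      pure_tensor A M (tensor A N P) n i x (pure_tensor A N P (n - i) j y z)"
      using tensor_assoc_pure[of x i y "i + j" z n] x y z
      by (simp add: tensor_unassoc_pure diff_diff_eq)
  qed
qed

end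


section \<open>Slices of tensors\<close>

text \<open>The map \<open>id \<otimes> f\<close> on the degree \<open>n\<close> piece of \<open>M \<otimes> N\<close>, for a form \<open>f\<close> on \<open>N (- m)\<close> extended by
  zero to the other degrees. Such a form has degree \<open>m\<close> in the dual, so the result has degree
  \<open>m + n\<close>. The adjoint action of \<open>f\<close> is the coaction followed by this slice.\<close>

definition slice ::
    "('a, 'm) gmod \<Rightarrow> int \<Rightarrow> int \<Rightarrow> ('n \<Rightarrow> 'a) \<Rightarrow> (int \<times> 'm \<times> 'n) list set \<Rightarrow> 'm"
  where "slice M m n f = tensor_lift (M (m + n))
    (\<lambda>i y c. if i = m + n then f c \<odot>\<^bsub>M (m + n)\<^esub> y else \<zero>\<^bsub>M (m + n)\<^esub>)"

context
  fixes A :: "('a, 'r) ring_scheme" and M :: "('a, 'm) gmod" and N :: "('a, 'n) gmod"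
  assumes gm: "graded_module A M" "graded_module A N"
begin

lemma slice_bilinear:
  assumes f: "f \<in> module_hom A (N (- m)) (ground A 0)"
  shows "bilinear_maps A M N n (M (m + n))
    (\<lambda>i y c. if i = m + n then f c \<odot>\<^bsub>M (m + n)\<^esub> y else \<zero>\<^bsub>M (m + n)\<^esub>)"
proof (rule bilinear_mapsI)
  note Mk = graded_moduleD[OF gm(1)]
  fix i y assume y: "y \<in> carrier (M i)"
  show "(\<lambda>c. if i = m + n then f c \<odot>\<^bsub>M (m + n)\<^esub> y else \<zero>\<^bsub>M (m + n)\<^esub>) \<in>
      module_hom A (N (n - i)) (M (m + n))"
  proof (cases "i = m + n")
    case True
    then have "n - i = - m" by simp
    then show ?thesis
      using module_hom_smult_left[OF Mk f, of y] y True by simp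
  next
    case False
    then show ?thesis by (simp add: module_hom_const_zero[OF Mk])
  qed
next
  note Mk = graded_moduleD[OF gm(1)]
  fix i c assume c: "c \<in> carrier (N (n - i))"
  show "(\<lambda>y. if i = m + n then f c \<odot>\<^bsub>M (m + n)\<^esub> y else \<zero>\<^bsub>M (m + n)\<^esub>) \<in>
      module_hom A (M i) (M (m + n))"
  proof (cases "i = m + n")
    case True
    then have "n - i = - m" by simp
    with c have "f c \<in> carrier A" using module_homD(1)[OF f] by (simp add: ground_def)
    with True show ?thesis by (simp add: module_hom_smult[OF Mk module_hom_id])
  next
    case False
    then show ?thesis by (simp add: module_hom_const_zero[OF Mk])
  qed
qed

lemma slice_hom:
  "f \<in> module_hom A (N (- m)) (ground A 0) \<Longrightarrow>
    slice M m n f \<in> module_hom A (tensor A M N n) (M (m + n))"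
  unfolding slice_def by (intro tensor_lift_hom slice_bilinear gm graded_moduleD)

lemma slice_pure:
  "f \<in> module_hom A (N (- m)) (ground A 0) \<Longrightarrow> y \<in> carrier (M i) \<Longrightarrow> c \<in> carrier (N (n - i)) \<Longrightarrow>
    slice M m n f (pure_tensor A M N n i y c) =
      (if i = m + n then f c \<odot>\<^bsub>M (m + n)\<^esub> y else \<zero>\<^bsub>M (m + n)\<^esub>)"
  unfolding slice_def by (intro tensor_lift_pure slice_bilinear gm graded_moduleD)

lemma slice_restrict:
  assumes f: "f \<in> module_hom A (N (- m)) (ground A 0)" and t: "t \<in> carrier (tensor A M N n)"
  shows "slice M m n (restrict f (carrier (N (- m)))) t = slice M m n f t"
proof -
  have f': "restrict f (carrier (N (- m))) \<in> module_hom A (N (- m)) (ground A 0)"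
    by (rule module_hom_cong[OF graded_moduleD[OF gm(2)] f]) simp
  show ?thesis
  proof (rule tensor_hom_eqI[OF gm graded_moduleD[OF gm(1)] slice_hom[OF f'] slice_hom[OF f] _ t])
    fix i y c assume yc: "y \<in> carrier (M i)" "c \<in> carrier (N (n - i))"
    have "c \<in> carrier (N (- m))" if "i = m + n"
    proof -
      have "n - i = - m" using that by simp
      with yc(2) show ?thesis by simp
    qed
    with yc show "slice M m n (restrict f (carrier (N (- m)))) (pure_tensor A M N n i y c) =
        slice M m n f (pure_tensor A M N n i y c)"
      by (simp add: slice_pure[OF f'] slice_pure[OF f])
  qed
qed

lemma pure_tensor_move_scalar:
  assumes "a \<in> carrier A" "x \<in> carrier (M i)" "y \<in> carrier (N k)" "k = n - i"
  shows "pure_tensor A M N n i (a \<odot>\<^bsub>M i\<^esub> x) y = pure_tensor A M N n i x (a \<odot>\<^bsub>N k\<^esub> y)"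
  using module_homD(3)[OF pure_tensor_hom_left[OF gm assms(3,4)] assms(1,2)]
    module_homD(3)[OF pure_tensor_hom_right[OF gm assms(2,4)] assms(1,3)] by simp

text \<open>Applying \<open>c = \<Sum> \<phi>(c) e\<close> to the second factor turns a tensor \<open>t\<close> into the sum of the
  \<open>(id \<otimes> \<phi>)(t) \<otimes> e\<close>. The part of this sum in one degree of the second factor is built from slices
  of \<open>t\<close> only. It is the projection of \<open>t\<close> to that degree, and a tensor is the sum of its
  projections to the degrees that it involves.\<close>

definition dual_component :: "(int \<Rightarrow> ('n \<times> ('n \<Rightarrow> 'a)) list) \<Rightarrow> int \<Rightarrow> int \<Rightarrow>
    (int \<times> 'm \<times> 'n) list set \<Rightarrow> (int \<times> 'm \<times> 'n) list set"
  where "dual_component D m n t = list_sum (tensor A M N n)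
    (\<lambda>d. pure_tensor A M N n (m + n) (slice M m n (snd d) t) (fst d)) (D (- m))"

context
  fixes D :: "int \<Rightarrow> ('n \<times> ('n \<Rightarrow> 'a)) list"
  assumes D: "\<And>j. dual_system A (N j) (D j)"
begin

interpretation M0: module A "M 0" by (rule graded_moduleD[OF gm(1)])

lemma dual_systemsD:
  assumes "d \<in> set (D j)"
  shows "fst d \<in> carrier (N j)" "snd d \<in> module_hom A (N j) (ground A 0)"
    "c \<in> carrier (N j) \<Longrightarrow> snd d c \<in> carrier A"
  using D[of j] assms mem_dual_spaceD[OF M0.R.ring_axioms, of "snd d" "N j"]
  by (auto simp: dual_system_def)

lemma dual_component_hom:
  "dual_component D m n \<in> module_hom A (tensor A M N n) (tensor A M N n)"
  unfolding dual_component_def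
proof (rule list_sum_module_hom[OF tensor_module[OF gm]])
  fix d assume d: "d \<in> set (D (- m))"
  show "(\<lambda>t. pure_tensor A M N n (m + n) (slice M m n (snd d) t) (fst d)) \<in>
      module_hom A (tensor A M N n) (tensor A M N n)"
    by (rule module_hom_comp[OF slice_hom[OF dual_systemsD(2)[OF d]]
          pure_tensor_hom_left[OF gm dual_systemsD(1)[OF d]]]) simp
qed

lemma dual_component_pure:
  assumes y: "y \<in> carrier (M i)" and c: "c \<in> carrier (N (n - i))"
  shows "dual_component D m n (pure_tensor A M N n i y c) =
    (if m = i - n then pure_tensor A M N n i y c else \<zero>\<^bsub>tensor A M N n\<^esub>)"
proof (cases "m = i - n")
  case True
  then have m: "i = m + n" "n - i = - m" by auto
  interpret N: module A "N (- m)" by (rule graded_moduleD[OF gm(2)])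
  have "dual_component D m n (pure_tensor A M N n i y c) =
      list_sum (tensor A M N n) (\<lambda>d. pure_tensor A M N n i y (snd d c \<odot>\<^bsub>N (- m)\<^esub> fst d)) (D (- m))"
    unfolding dual_component_def
  proof (rule list_sum_cong)
    fix d assume d: "d \<in> set (D (- m))"
    have "slice M m n (snd d) (pure_tensor A M N n i y c) = snd d c \<odot>\<^bsub>M i\<^esub> y"
      using slice_pure[OF dual_systemsD(2)[OF d] y c] m(1) by simp
    moreover have "pure_tensor A M N n i (snd d c \<odot>\<^bsub>M i\<^esub> y) (fst d) =
        pure_tensor A M N n i y (snd d c \<odot>\<^bsub>N (- m)\<^esub> fst d)"
      by (rule pure_tensor_move_scalar[OF dual_systemsD(3)[OF d] y dual_systemsD(1)[OF d]])
        (use c m(2) in simp_all)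
    ultimately show "pure_tensor A M N n (m + n) (slice M m n (snd d) (pure_tensor A M N n i y c)) (fst d) =
        pure_tensor A M N n i y (snd d c \<odot>\<^bsub>N (- m)\<^esub> fst d)"
      using m(1) by simp
  qed
  also have "\<dots> = pure_tensor A M N n i y (list_sum (N (- m)) (\<lambda>d. snd d c \<odot>\<^bsub>N (- m)\<^esub> fst d) (D (- m)))"
  proof (rule module_hom_list_sum[symmetric, OF N.module_axioms tensor_module[OF gm]
        pure_tensor_hom_right[OF gm y]])
    show "- m = n - i" using m by simp
    show "snd d c \<odot>\<^bsub>N (- m)\<^esub> fst d \<in> carrier (N (- m))" if "d \<in> set (D (- m))" for d
      using dual_systemsD(1,3)[OF that] c m by simp
  qed
  also have "\<dots> = pure_tensor A M N n i y c"
    using D[of "- m"] c m by (simp add: dual_system_def)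
  finally show ?thesis using True by simp
next
  case False
  then have "i \<noteq> m + n" by auto
  have "dual_component D m n (pure_tensor A M N n i y c) =
      list_sum (tensor A M N n) (\<lambda>d. \<zero>\<^bsub>tensor A M N n\<^esub>) (D (- m))"
    unfolding dual_component_def
  proof (rule list_sum_cong)
    fix d assume d: "d \<in> set (D (- m))"
    have "pure_tensor A M N n (m + n) \<zero>\<^bsub>M (m + n)\<^esub> (fst d) = \<zero>\<^bsub>tensor A M N n\<^esub>"
      by (rule module_hom_zero[OF graded_moduleD[OF gm(1)] tensor_module[OF gm]
            pure_tensor_hom_left[OF gm dual_systemsD(1)[OF d]]]) simp
    then show "pure_tensor A M N n (m + n) (slice M m n (snd d) (pure_tensor A M N n i y c)) (fst d) =
        \<zero>\<^bsub>tensor A M N n\<^esub>"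
      using slice_pure[OF dual_systemsD(2)[OF d] y c] \<open>i \<noteq> m + n\<close> by simp
  qed
  then show ?thesis using False list_sum_zero[OF tensor_module[OF gm]] by simp
qed

lemma sum_dual_components:
  assumes "xs \<in> formal_tensors M N n" "distinct ms" "(\<lambda>z. fst z - n) ` set xs \<subseteq> set ms"
  shows "list_sum (tensor A M N n) (\<lambda>m. dual_component D m n (tensor_class A M N n xs)) ms =
    tensor_class A M N n xs"
proof -
  note T = tensor_module[OF gm]
  have sum: "(\<lambda>t. list_sum (tensor A M N n) (\<lambda>m. dual_component D m n t) ms) \<in>
      module_hom A (tensor A M N n) (tensor A M N n)"
    by (rule list_sum_module_hom[OF T dual_component_hom])
  show ?thesis
    using assms(1,3)
  proof (induction xs)
    case Nil
    have "tensor_class A M N n [] = \<zero>\<^bsub>tensor A M N n\<^esub>" by (simp add: tensor_def)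
    then show ?case using module_hom_zero[OF T T sum] by simp
  next
    case (Cons z xs)
    obtain i y c where z: "z = (i, y, c)" by (cases z)
    have xs: "xs \<in> formal_tensors M N n" and yc: "y \<in> carrier (M i)" "c \<in> carrier (N (n - i))"
      using Cons.prems z by auto
    have split: "tensor_class A M N n (z # xs) =
        pure_tensor A M N n i y c \<oplus>\<^bsub>tensor A M N n\<^esub> tensor_class A M N n xs"
      using tensor_add_class[OF gm, of "[z]" n xs] Cons.prems z xs by (simp add: pure_tensor_def)
    have p: "pure_tensor A M N n i y c \<in> carrier (tensor A M N n)"
      by (rule pure_tensor_closed[where M = M and N = N, OF yc HOL.refl])
    have "tensor_class A M N n xs \<in> carrier (tensor A M N n)"
      using xs by (simp add: tensor_def)
    moreover have "list_sum (tensor A M N n) (\<lambda>m. dual_component D m n (pure_tensor A M N n i y c)) ms =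
        pure_tensor A M N n i y c"
      using list_sum_delta[OF T p assms(2), of "i - n"] Cons.prems(2) z
      by (simp add: dual_component_pure[OF yc])
    ultimately show ?case
      using module_homD(2)[OF sum p] Cons.IH xs Cons.prems(2) unfolding split by simp
  qed
qed

text \<open>Both tensors are recovered from their slices, over a common finite list of degrees.\<close>

lemma tensor_eqI_slices:
  assumes s: "s \<in> carrier (tensor A M N n)" and t: "t \<in> carrier (tensor A M N n)"
    and eq: "\<And>m f. f \<in> carrier (dual_space A (N (- m))) \<Longrightarrow> slice M m n f s = slice M m n f t"
  shows "s = t"
proof -
  obtain xs ys where xs: "xs \<in> formal_tensors M N n" "s = tensor_class A M N n xs"
    and ys: "ys \<in> formal_tensors M N n" "t = tensor_class A M N n ys"
    using s t by (auto simp: tensor_def)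
  define ms where "ms = remdups (map (\<lambda>z. fst z - n) (xs @ ys))"
  have "dual_component D m n s = dual_component D m n t" for m
    unfolding dual_component_def
  proof (rule list_sum_cong)
    fix d assume "d \<in> set (D (- m))"
    then have "snd d \<in> carrier (dual_space A (N (- m)))"
      using D[of "- m"] by (auto simp: dual_system_def)
    from eq[OF this] show "pure_tensor A M N n (m + n) (slice M m n (snd d) s) (fst d) =
        pure_tensor A M N n (m + n) (slice M m n (snd d) t) (fst d)" by simp
  qed
  then have "list_sum (tensor A M N n) (\<lambda>m. dual_component D m n s) ms =
      list_sum (tensor A M N n) (\<lambda>m. dual_component D m n t) ms"
    by (intro list_sum_cong)
  moreover have "list_sum (tensor A M N n) (\<lambda>m. dual_component D m n s) ms = s"
    unfolding xs(2) by (rule sum_dual_components[OF xs(1)]) (auto simp: ms_def)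
  moreover have "list_sum (tensor A M N n) (\<lambda>m. dual_component D m n t) ms = t"
    unfolding ys(2) by (rule sum_dual_components[OF ys(1)]) (auto simp: ms_def)
  ultimately show ?thesis by (simp only:)
qed

end

end

text \<open>Naturality: a slice acts on the second factor only, so it commutes with a map on the first
  factor and absorbs a map on the second one into the form.\<close>

lemma slice_tensor_map_left:
  assumes gm: "graded_module A M" "graded_module A M'" "graded_module A N"
    and \<psi>: "graded_hom A M M' \<psi>" and f: "f \<in> module_hom A (N (- m)) (ground A 0)"
    and t: "t \<in> carrier (tensor A M N n)"
  shows "slice M' m n f (tensor_map A M' N \<psi> (\<lambda>_ c. c) n t) = \<psi> (m + n) (slice M m n f t)"
proof -
  note map = gm(1,3,2,3) \<psi> graded_hom_id[of A N]
  show ?thesis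
  proof (rule tensor_hom_eqI[OF gm(1,3) graded_moduleD[OF gm(2)]
        module_hom_comp[OF tensor_map_hom[OF map] slice_hom[OF gm(2,3) f]]
        module_hom_comp[OF slice_hom[OF gm(1,3) f] graded_homD[OF \<psi>]] _ t])
    fix i y c assume y: "y \<in> carrier (M i)" and c: "c \<in> carrier (N (n - i))"
    have "\<psi> (m + n) (f c \<odot>\<^bsub>M (m + n)\<^esub> y) = f c \<odot>\<^bsub>M' (m + n)\<^esub> \<psi> (m + n) y" if i: "i = m + n"
    proof (rule module_homD(3)[OF graded_homD[OF \<psi>]])
      show "f c \<in> carrier A" using module_homD(1)[OF f, of c] c i by (simp add: ground_def)
      show "y \<in> carrier (M (m + n))" using y i by simp
    qed
    then show "slice M' m n f (tensor_map A M' N \<psi> (\<lambda>_ c. c) n (pure_tensor A M N n i y c)) =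
        \<psi> (m + n) (slice M m n f (pure_tensor A M N n i y c))"
      using y c module_homD(1)[OF graded_homD[OF \<psi>] y]
        module_hom_zero[OF graded_moduleD[OF gm(1)] graded_moduleD[OF gm(2)] graded_homD[OF \<psi>]]
      by (simp add: tensor_map_pure[OF map y c] slice_pure[OF gm(1,3) f] slice_pure[OF gm(2,3) f])
  qed
qed

lemma slice_tensor_map_right:
  assumes gm: "graded_module A M" "graded_module A N" "graded_module A N'"
    and \<psi>: "graded_hom A N N' \<psi>" and f: "f \<in> module_hom A (N' (- m)) (ground A 0)"
    and t: "t \<in> carrier (tensor A M N n)"
  shows "slice M m n f (tensor_map A M N' (\<lambda>_ x. x) \<psi> n t) = slice M m n (\<lambda>c. f (\<psi> (- m) c)) t"
proof -
  note map = gm(1,2,1,3) graded_hom_id[of A M] \<psi>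
  note f\<psi> = module_hom_comp[OF graded_homD[OF \<psi>] f]
  show ?thesis
  proof (rule tensor_hom_eqI[OF gm(1,2) graded_moduleD[OF gm(1)]
        module_hom_comp[OF tensor_map_hom[OF map] slice_hom[OF gm(1,3) f]] slice_hom[OF gm(1,2) f\<psi>] _ t])
    fix i y c assume y: "y \<in> carrier (M i)" and c: "c \<in> carrier (N (n - i))"
    then show "slice M m n f (tensor_map A M N' (\<lambda>_ x. x) \<psi> n (pure_tensor A M N n i y c)) =
        slice M m n (\<lambda>c. f (\<psi> (- m) c)) (pure_tensor A M N n i y c)"
      using module_homD(1)[OF graded_homD[OF \<psi>] c]
      by (simp add: tensor_map_pure[OF map y c] slice_pure[OF gm(1,3) f] slice_pure[OF gm(1,2) f\<psi>])
  qed
qed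

text \<open>The identification \<open>M \<otimes> A \<cong> M\<close> is the slice by the identity form on \<open>A\<close>.\<close>

lemma right_unit_tensor_map:
  assumes gm: "graded_module A M" "graded_module A N" and \<epsilon>: "graded_hom A N (ground A) \<epsilon>"
    and t: "t \<in> carrier (tensor A M N n)"
  shows "right_unit M n (tensor_map A M (ground A) (\<lambda>_ x. x) \<epsilon> n t) = slice M 0 n (\<epsilon> 0) t"
proof -
  interpret M0: module A "M 0" by (rule graded_moduleD[OF gm(1)])
  have g: "graded_module A (ground A)"
    by (simp add: graded_module_def ground_module[OF M0.is_cring])
  have unit: "(\<lambda>x. x) \<in> module_hom A (ground A (- 0)) (ground A 0)" by (simp add: module_hom_id)
  have ru: "right_unit M n = slice M 0 n (\<lambda>x. x)"
    by (simp add: right_unit_def slice_def cong: if_cong)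
  have "slice M 0 n (\<lambda>x. x) (tensor_map A M (ground A) (\<lambda>_ x. x) \<epsilon> n t) = slice M 0 n (\<epsilon> 0) t"
    using slice_tensor_map_right[OF gm g \<epsilon> unit t] by simp
  then show ?thesis by (simp add: ru)
qed

text \<open>The form \<open>f \<otimes> g\<close> on a piece of \<open>N \<otimes> P\<close>, with \<open>f\<close> on \<open>N (- l)\<close>. Composed with the
  comultiplication it is the convolution product.\<close>

definition product_functional ::
    "('a, 'r) ring_scheme \<Rightarrow> int \<Rightarrow> ('m \<Rightarrow> 'a) \<Rightarrow> ('n \<Rightarrow> 'a) \<Rightarrow> (int \<times> 'm \<times> 'n) list set \<Rightarrow> 'a"
  where "product_functional A l f g =
    tensor_lift A (\<lambda>i x y. if i = - l then f x \<otimes>\<^bsub>A\<^esub> g y else \<zero>\<^bsub>A\<^esub>)"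

lemma product_functional_lift:
  "product_functional A l f g = tensor_lift (ground A 0) (\<lambda>i x y. if i = - l then f x \<otimes>\<^bsub>A\<^esub> g y else \<zero>\<^bsub>A\<^esub>)"
  by (simp add: product_functional_def tensor_lift_def formal_eval_def ground_def fun_eq_iff)

context
  fixes A :: "('a, 'r) ring_scheme" and N :: "('a, 'n) gmod" and P :: "('a, 'p) gmod"
    and l m :: int and f g
  assumes gm: "graded_module A N" "graded_module A P"
    and f: "f \<in> module_hom A (N (- l)) (ground A 0)" and g: "g \<in> module_hom A (P (- m)) (ground A 0)"
begin

lemma product_functional_bilinear:
  "bilinear_maps A N P (- (l + m)) (ground A 0) (\<lambda>i x y. if i = - l then f x \<otimes>\<^bsub>A\<^esub> g y else \<zero>\<^bsub>A\<^esub>)"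
proof -
  interpret N0: module A "N 0" by (rule graded_moduleD[OF gm(1)])
  note G = ground_module[OF N0.is_cring, of 0]
  have z: "(\<lambda>x. \<zero>\<^bsub>A\<^esub>) \<in> module_hom A V (ground A 0)" for V :: "('a, 'v) module"
    using module_hom_const_zero[OF G, of V] by (simp add: ground_def)
  show ?thesis
  proof (rule bilinear_mapsI)
    fix i x assume x: "x \<in> carrier (N i)"
    show "(\<lambda>y. if i = - l then f x \<otimes>\<^bsub>A\<^esub> g y else \<zero>\<^bsub>A\<^esub>) \<in>
        module_hom A (P (- (l + m) - i)) (ground A 0)"
    proof (cases "i = - l")
      case True
      then have "- (l + m) - i = - m" "f x \<in> carrier A"
        using module_homD(1)[OF f, of x] x by (auto simp: ground_def)
      then show ?thesis using True module_hom_smult[OF G g, of "f x"] by (simp add: ground_def)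
    qed (simp add: z)
  next
    fix i y assume y: "y \<in> carrier (P (- (l + m) - i))"
    show "(\<lambda>x. if i = - l then f x \<otimes>\<^bsub>A\<^esub> g y else \<zero>\<^bsub>A\<^esub>) \<in> module_hom A (N i) (ground A 0)"
    proof (cases "i = - l")
      case True
      then have "- (l + m) - i = - m" by simp
      then have "g y \<in> carrier (ground A 0)" using module_homD(1)[OF g, of y] y by simp
      then show ?thesis using True module_hom_smult_left[OF G f, of "g y"] by (simp add: ground_def)
    qed (simp add: z)
  qed
qed

lemma product_functional_hom:
  "product_functional A l f g \<in> module_hom A (tensor A N P (- (l + m))) (ground A 0)"
proof -
  interpret N0: module A "N 0" by (rule graded_moduleD[OF gm(1)])
  show ?thesis unfolding product_functional_lift
    by (rule tensor_lift_hom[OF gm ground_module[OF N0.is_cring] product_functional_bilinear])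
qed

lemma product_functional_pure:
  assumes "x \<in> carrier (N j)" "y \<in> carrier (P (- (l + m) - j))"
  shows "product_functional A l f g (pure_tensor A N P (- (l + m)) j x y) =
    (if j = - l then f x \<otimes>\<^bsub>A\<^esub> g y else \<zero>\<^bsub>A\<^esub>)"
proof -
  interpret N0: module A "N 0" by (rule graded_moduleD[OF gm(1)])
  show ?thesis unfolding product_functional_lift
    by (rule tensor_lift_pure[OF gm ground_module[OF N0.is_cring] product_functional_bilinear assms])
qed

text \<open>Both sides send \<open>y \<otimes> (c \<otimes> d)\<close> to \<open>f(c) g(d) y\<close> when \<open>c\<close> and \<open>d\<close> have the degrees on which
  \<open>f\<close> and \<open>g\<close> live, and to zero otherwise. On \<open>(M \<otimes> N) \<otimes> P\<close> the outer factor is sliced first.\<close>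

lemma slice_slice_unassoc:
  fixes M :: "('a, 'm) gmod"
  assumes M: "graded_module A M" and t: "t \<in> carrier (tensor A M (tensor A N P) n)"
  shows "slice M l (m + n) f (slice (tensor A M N) m n g (tensor_unassoc A M N P n t)) =
    slice M (l + m) n (product_functional A l f g) t"
proof -
  note NP = tensor_graded_module[OF gm] and MN = tensor_graded_module[OF M gm(1)]
  have eq: "l + m + n = l + (m + n)" by simp
  note h = product_functional_hom
  note sg = slice_hom[OF MN gm(2) g] and sf = slice_hom[OF M gm(1) f]
  note sh = slice_hom[OF M NP h, of n, unfolded eq]
  show ?thesis
  proof (rule tensor_hom_eqI[OF M NP graded_moduleD[OF M]
        module_hom_comp[OF module_hom_comp[OF tensor_unassoc_hom[OF M gm] sg] sf] sh _ t])
    fix i y u assume y: "y \<in> carrier (M i)" and u: "u \<in> carrier (tensor A N P (n - i))"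
    interpret Mi: module A "M i" by (rule graded_moduleD[OF M])
    interpret T: module A "tensor A M N (m + n)" by (rule tensor_module[OF M gm(1)])
    note pu = pure_tensor_hom_right[OF M NP y HOL.refl]
    show "slice M l (m + n) f (slice (tensor A M N) m n g
          (tensor_unassoc A M N P n (pure_tensor A M (tensor A N P) n i y u))) =
        slice M (l + m) n (product_functional A l f g) (pure_tensor A M (tensor A N P) n i y u)"
    proof (rule tensor_hom_eqI[OF gm graded_moduleD[OF M]
          module_hom_comp[OF module_hom_comp[OF tensor_unassoc_pure_hom[OF M gm y] sg] sf]
          module_hom_comp[OF pu sh] _ u])
      fix j c d assume c: "c \<in> carrier (N j)" and d: "d \<in> carrier (P (n - i - j))"
      have yc: "pure_tensor A M N (i + j) i y c \<in> carrier (tensor A M N (i + j))"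
        by (rule pure_tensor_closed[where M = M and N = N, OF y c]) simp
      have cd: "pure_tensor A N P (n - i) j c d \<in> carrier (tensor A N P (n - i))"
        by (rule pure_tensor_closed[where M = N and N = P, OF c d]) simp
      have d': "d \<in> carrier (P (n - (i + j)))" using d by (simp add: diff_diff_eq)
      have L: "slice (tensor A M N) m n g
          (tensor_unassoc A M N P n (pure_tensor A M (tensor A N P) n i y (pure_tensor A N P (n - i) j c d))) =
        (if i + j = m + n then g d \<odot>\<^bsub>tensor A M N (m + n)\<^esub> pure_tensor A M N (m + n) i y c
         else \<zero>\<^bsub>tensor A M N (m + n)\<^esub>)"
        using slice_pure[OF MN gm(2) g yc d'] by (simp add: tensor_unassoc_pure[OF M gm y c d])
      show "slice M l (m + n) f (slice (tensor A M N) m n g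
          (tensor_unassoc A M N P n (pure_tensor A M (tensor A N P) n i y (pure_tensor A N P (n - i) j c d)))) =
        slice M (l + m) n (product_functional A l f g)
          (pure_tensor A M (tensor A N P) n i y (pure_tensor A N P (n - i) j c d))"
      proof (cases "i = l + m + n")
        case True
        interpret Mk: module A "M (l + (m + n))" by (rule graded_moduleD[OF M])
        have i: "n - i = - (l + m)" "i = l + (m + n)" using True by auto
        have R: "slice M (l + m) n (product_functional A l f g)
            (pure_tensor A M (tensor A N P) n i y (pure_tensor A N P (n - i) j c d)) =
          (if j = - l then f c \<otimes>\<^bsub>A\<^esub> g d else \<zero>\<^bsub>A\<^esub>) \<odot>\<^bsub>M (l + (m + n))\<^esub> y"
          using slice_pure[OF M NP h y cd] product_functional_pure[of c j d] c d True
          by (simp add: i eq)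
        show ?thesis
        proof (cases "j = - l")
          case j: True
          have fc: "f c \<in> carrier A" and gd: "g d \<in> carrier A"
            using module_homD(1)[OF f, of c] module_homD(1)[OF g, of d] c d j i
            by (simp_all add: ground_def)
          have "slice M l (m + n) f (pure_tensor A M N (m + n) i y c) = f c \<odot>\<^bsub>M (l + (m + n))\<^esub> y"
            using slice_pure[OF M gm(1) f y, of c "m + n"] c j i by simp
          moreover have "pure_tensor A M N (m + n) i y c \<in> carrier (tensor A M N (m + n))"
            using yc i j by simp
          ultimately show ?thesis
            using R L i j gd fc y module_homD(3)[OF sf gd]
            by (simp add: Mk.smult_assoc1[symmetric] Mi.R.m_comm)
        next
          case j: False
          then show ?thesis
            using R L i y module_hom_zero[OF T.module_axioms graded_moduleD[OF M] sf] by simp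
        qed
      next
        case i: False
        interpret Mk: module A "M (l + (m + n))" by (rule graded_moduleD[OF M])
        have R: "slice M (l + m) n (product_functional A l f g)
            (pure_tensor A M (tensor A N P) n i y (pure_tensor A N P (n - i) j c d)) =
          \<zero>\<^bsub>M (l + (m + n))\<^esub>"
          using slice_pure[OF M NP h y cd] i by (simp add: eq)
        show ?thesis
        proof (cases "i + j = m + n")
          case j: True
          then have "m + n - i = j" by simp
          then have "slice M l (m + n) f (pure_tensor A M N (m + n) i y c) = \<zero>\<^bsub>M (l + (m + n))\<^esub>"
            using slice_pure[OF M gm(1) f y, of c "m + n"] c i by simp
          moreover have "pure_tensor A M N (m + n) i y c \<in> carrier (tensor A M N (m + n))"
            using yc j by simp
          moreover have "g d \<in> carrier A"
            using module_homD(1)[OF g, of d] d' j by (simp add: ground_def)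
          ultimately show ?thesis
            using R L j module_homD(3)[OF sf] by simp
        next
          case False
          then show ?thesis
            using R L module_hom_zero[OF T.module_axioms graded_moduleD[OF M] sf] by simp
        qed
      qed
    qed
  qed
qed

end


section \<open>Bounded modules are rational\<close>

lemma dual_algebra_simps [simp]:
  "apieces (dual_algebra A C) n = dual_space A (pieces C (- n))"
  "amult (dual_algebra A C) m n f g = restrict (\<lambda>c. product_functional A m f g (comult C (- (m + n)) c))
    (carrier (pieces C (- (m + n))))"
  "aone (dual_algebra A C) = restrict (counit C 0) (carrier (pieces C 0))"
  by (simp_all add: dual_algebra_def product_functional_def restrict_def fun_eq_iff)

locale bounded_dual_module =
  fixes A :: "('a, 'r) ring_scheme" and C :: "('a, 'c) gcoalgebra"
    and X :: "('a, 'c \<Rightarrow> 'a, 'm) gmodule"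
    and D :: "int \<Rightarrow> ('c \<times> ('c \<Rightarrow> 'a)) list" and b :: int
  assumes coalgebra: "graded_coalgebra A C"
    and left_module: "graded_left_module A (dual_algebra A C) X"
    and dual: "\<And>j. dual_system A (pieces C j) (D j)"
    and nonneg: "\<And>n. n < 0 \<Longrightarrow>
      carrier (apieces (dual_algebra A C) n) = {\<zero>\<^bsub>apieces (dual_algebra A C) n\<^esub>}"
    and bounded: "\<And>n. b < n \<Longrightarrow> carrier (mpieces X n) = {\<zero>\<^bsub>mpieces X n\<^esub>}"
begin

abbreviation "\<Gamma> \<equiv> pieces C"
abbreviation "M \<equiv> mpieces X"
abbreviation "M\<Gamma> \<equiv> tensor A M \<Gamma>"

lemma gmods: "graded_module A M" "graded_module A \<Gamma>"
  using coalgebra left_module by (simp_all add: graded_coalgebra_def graded_left_module_def Let_def)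

lemma comult_hom: "graded_hom A \<Gamma> (tensor A \<Gamma> \<Gamma>) (comult C)"
  and counit_hom: "graded_hom A \<Gamma> (ground A) (counit C)"
  using coalgebra by (simp_all add: graded_coalgebra_def Let_def)

sublocale M: module A "M n" for n by (rule graded_moduleD[OF gmods(1)])

lemmas M\<Gamma> = tensor_graded_module[OF gmods]
lemmas functionalD = mem_dual_spaceD[OF M.R.ring_axioms]
lemmas act_closed = graded_left_moduleD(2)[OF left_module, simplified]

lemma act_hom: "f \<in> carrier (dual_space A (\<Gamma> (- m))) \<Longrightarrow> act X m n f \<in> module_hom A (M n) (M (m + n))"
  using left_module by (simp add: graded_left_module_def)

lemma act_hom_left: "x \<in> carrier (M n) \<Longrightarrow>
    (\<lambda>f. act X m n f x) \<in> module_hom A (dual_space A (\<Gamma> (- m))) (M (m + n))"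
  using left_module by (simp add: graded_left_module_def)

text \<open>The degrees \<open>m\<close> of the forms can be restricted to \<open>0, \<dots>, b - n\<close>: there are no nonzero forms
  of negative degree, and a form of degree greater than \<open>b - n\<close> sends \<open>x\<close> above the bound \<open>b\<close>.\<close>

definition coaction :: "int \<Rightarrow> 'm \<Rightarrow> (int \<times> 'm \<times> 'c) list set"
  where "coaction n x = list_sum (M\<Gamma> n) (\<lambda>m. list_sum (M\<Gamma> n)
    (\<lambda>d. pure_tensor A M \<Gamma> n (m + n) (act X m n (snd d) x) (fst d)) (D (- m))) [0..b - n]"

lemma dual_mem:
  assumes "d \<in> set (D j)"
  shows "fst d \<in> carrier (\<Gamma> j)" "snd d \<in> carrier (dual_space A (\<Gamma> j))"
  using dual[of j] assms by (auto simp: dual_system_def)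

lemma coaction_hom: "graded_hom A M M\<Gamma> coaction"
  unfolding graded_hom_def
proof
  fix n
  show "coaction n \<in> module_hom A (M n) (M\<Gamma> n)"
    unfolding coaction_def
  proof (intro list_sum_module_hom[OF tensor_module[OF gmods]])
    fix m d assume "d \<in> set (D (- m))"
    note d = dual_mem[OF this]
    show "(\<lambda>x. pure_tensor A M \<Gamma> n (m + n) (act X m n (snd d) x) (fst d)) \<in> module_hom A (M n) (M\<Gamma> n)"
      by (rule module_hom_comp[OF act_hom[OF d(2)] pure_tensor_hom_left[OF gmods d(1)]]) simp
  qed
qed

lemma coaction_closed: "x \<in> carrier (M n) \<Longrightarrow> coaction n x \<in> carrier (M\<Gamma> n)"
  by (rule module_homD(1)[OF graded_homD[OF coaction_hom]])

text \<open>Since \<open>f = \<Sum> f(e) \<phi>\<close>, also \<open>f x = \<Sum> f(e) (\<phi> x)\<close>.\<close>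

lemma act_expand:
  assumes x: "x \<in> carrier (M n)" and f: "f \<in> carrier (dual_space A (\<Gamma> (- m)))"
  shows "list_sum (M (m + n)) (\<lambda>d. f (fst d) \<odot>\<^bsub>M (m + n)\<^esub> act X m n (snd d) x) (D (- m)) =
    act X m n f x"
proof -
  interpret V: module A "\<Gamma> (- m)" by (rule graded_moduleD[OF gmods(2)])
  interpret V': module A "dual_space A (\<Gamma> (- m))" by (rule dual_space_module[OF V.module_axioms])
  have "act X m n f x = act X m n (list_sum (dual_space A (\<Gamma> (- m)))
      (\<lambda>d. f (fst d) \<odot>\<^bsub>dual_space A (\<Gamma> (- m))\<^esub> snd d) (D (- m))) x"
    by (simp add: dual_system_expand_functional[OF V.module_axioms dual f])
  also have "\<dots> = list_sum (M (m + n))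
      (\<lambda>d. act X m n (f (fst d) \<odot>\<^bsub>dual_space A (\<Gamma> (- m))\<^esub> snd d) x) (D (- m))"
    by (rule module_hom_list_sum[OF V'.module_axioms M.module_axioms act_hom_left[OF x]])
      (simp add: dual_mem functionalD(2)[OF f])
  also have "\<dots> = list_sum (M (m + n)) (\<lambda>d. f (fst d) \<odot>\<^bsub>M (m + n)\<^esub> act X m n (snd d) x) (D (- m))"
    by (rule list_sum_cong)
      (simp add: dual_mem functionalD(2)[OF f] module_homD(3)[OF act_hom_left[OF x]])
  finally show ?thesis by simp
qed

text \<open>The slice by a form of degree \<open>m\<close> kills the summands of the coaction in other degrees and
  turns the one of degree \<open>m\<close> into \<open>\<Sum> f(e) (\<phi> x) = f x\<close>. When \<open>m\<close> lies outside the range of the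
  sum, both sides vanish.\<close>

lemma slice_coaction:
  assumes x: "x \<in> carrier (M n)" and f: "f \<in> carrier (dual_space A (\<Gamma> (- m)))"
  shows "slice M m n f (coaction n x) = act X m n f x"
proof -
  note sl = slice_hom[where M = M and N = \<Gamma>, OF gmods functionalD(1)[OF f]]
  note T = tensor_module[OF gmods]
  let ?p = "\<lambda>k d. pure_tensor A M \<Gamma> n (k + n) (act X k n (snd d) x) (fst d)"
  have p: "?p k d \<in> carrier (M\<Gamma> n)" if "d \<in> set (D (- k))" for k d
    by (rule pure_tensor_closed[where M = M and N = \<Gamma>, OF act_closed[OF dual_mem(2)[OF that] x]
          dual_mem(1)[OF that]]) simp
  have summand: "slice M m n f (list_sum (M\<Gamma> n) (?p k) (D (- k))) =
      (if k = m then act X m n f x else \<zero>\<^bsub>M (m + n)\<^esub>)" for k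
  proof -
    have "slice M m n f (list_sum (M\<Gamma> n) (?p k) (D (- k))) =
        list_sum (M (m + n)) (\<lambda>d. slice M m n f (?p k d)) (D (- k))"
      by (rule module_hom_list_sum[OF T M.module_axioms sl p])
    also have "\<dots> = list_sum (M (m + n)) (\<lambda>d. if k = m
        then f (fst d) \<odot>\<^bsub>M (m + n)\<^esub> act X m n (snd d) x else \<zero>\<^bsub>M (m + n)\<^esub>) (D (- k))"
    proof (rule list_sum_cong)
      fix d assume d: "d \<in> set (D (- k))"
      have "fst d \<in> carrier (\<Gamma> (n - (k + n)))" using dual_mem(1)[OF d] by simp
      from slice_pure[where M = M and N = \<Gamma>, OF gmods functionalD(1)[OF f] act_closed[OF dual_mem(2)[OF d] x] this]
      show "slice M m n f (?p k d) =
          (if k = m then f (fst d) \<odot>\<^bsub>M (m + n)\<^esub> act X m n (snd d) x else \<zero>\<^bsub>M (m + n)\<^esub>)"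
        by auto
    qed
    also have "\<dots> = (if k = m then act X m n f x else \<zero>\<^bsub>M (m + n)\<^esub>)"
      by (simp add: act_expand[OF x f] list_sum_zero[OF M.module_axioms])
    finally show ?thesis .
  qed
  have "slice M m n f (coaction n x) =
      list_sum (M (m + n)) (\<lambda>k. slice M m n f (list_sum (M\<Gamma> n) (?p k) (D (- k)))) [0..b - n]"
    unfolding coaction_def
    by (rule module_hom_list_sum[OF T M.module_axioms sl list_sum_closed[OF T p]])
  also have "\<dots> = (if m \<in> set [0..b - n] then act X m n f x else \<zero>\<^bsub>M (m + n)\<^esub>)"
    unfolding summand by (rule list_sum_delta[OF M.module_axioms act_closed[OF f x]]) simp
  also have "\<dots> = act X m n f x"
  proof (cases "m < 0")
    case True
    then have "f = \<zero>\<^bsub>dual_space A (\<Gamma> (- m))\<^esub>" using nonneg f by simp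
    then have "act X m n f x = \<zero>\<^bsub>M (m + n)\<^esub>"
      using module_hom_zero[OF dual_space_module[OF graded_moduleD[OF gmods(2)]] M.module_axioms
          act_hom_left[OF x]] by simp
    then show ?thesis by simp
  next
    case False
    then show ?thesis using bounded[of "m + n"] act_closed[OF f x] by auto
  qed
  finally show ?thesis .
qed

lemma coaction_counit:
  assumes x: "x \<in> carrier (M n)"
  shows "right_unit M n (tensor_map A M (ground A) (\<lambda>_ x. x) (counit C) n (coaction n x)) = x"
proof -
  have \<epsilon>: "counit C 0 \<in> module_hom A (\<Gamma> (- 0)) (ground A 0)"
    using graded_homD[OF counit_hom, of 0] by simp
  have "right_unit M n (tensor_map A M (ground A) (\<lambda>_ x. x) (counit C) n (coaction n x)) =
      slice M 0 n (counit C 0) (coaction n x)"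
    by (rule right_unit_tensor_map[OF gmods counit_hom coaction_closed[OF x]])
  also have "\<dots> = slice M 0 n (restrict (counit C 0) (carrier (\<Gamma> (- 0)))) (coaction n x)"
    by (rule slice_restrict[OF gmods \<epsilon> coaction_closed[OF x], symmetric])
  also have "\<dots> = act X 0 n (restrict (counit C 0) (carrier (\<Gamma> (- 0)))) x"
    by (rule slice_coaction[OF x restrict_mem_dual_space[OF graded_moduleD[OF gmods(2)] \<epsilon>]])
  also have "\<dots> = x"
    using graded_left_moduleD(7)[OF left_module x] by simp
  finally show ?thesis .
qed

text \<open>The inverse associator moves the claim to \<open>(M \<otimes> \<Gamma>) \<otimes> \<Gamma>\<close>. There, slicing by \<open>g\<close> and then by \<open>f\<close>
  gives \<open>(f g) x\<close> on the comultiplication side, where \<open>f \<otimes> g\<close> meets the comultiplication, and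
  \<open>f (g x)\<close> on the side of the iterated coaction.\<close>

lemma coaction_coassoc:
  assumes x: "x \<in> carrier (M n)"
  shows "tensor_assoc A M \<Gamma> \<Gamma> n (tensor_map A M\<Gamma> \<Gamma> coaction (\<lambda>_ c. c) n (coaction n x)) =
    tensor_map A M (tensor A \<Gamma> \<Gamma>) (\<lambda>_ x. x) (comult C) n (coaction n x)"
proof -
  let ?l = "tensor_map A M\<Gamma> \<Gamma> coaction (\<lambda>_ c. c) n (coaction n x)"
  let ?r = "tensor_map A M (tensor A \<Gamma> \<Gamma>) (\<lambda>_ x. x) (comult C) n (coaction n x)"
  let ?u = "tensor_unassoc A M \<Gamma> \<Gamma> n ?r"
  note \<Gamma>\<Gamma> = tensor_graded_module[OF gmods(2,2)]
  note c = coaction_closed[OF x]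
  have l: "?l \<in> carrier (tensor A M\<Gamma> \<Gamma> n)"
    by (rule module_homD(1)[OF tensor_map_hom[OF gmods M\<Gamma> gmods(2) coaction_hom graded_hom_id] c])
  have r: "?r \<in> carrier (tensor A M (tensor A \<Gamma> \<Gamma>) n)"
    by (rule module_homD(1)[OF tensor_map_hom[OF gmods gmods(1) \<Gamma>\<Gamma> graded_hom_id comult_hom] c])
  have u: "?u \<in> carrier (tensor A M\<Gamma> \<Gamma> n)"
    by (rule module_homD(1)[OF tensor_unassoc_hom[OF gmods gmods(2)] r])
  have "?u = ?l"
  proof (rule tensor_eqI_slices[OF M\<Gamma> gmods(2) dual u l])
    fix m g assume g: "g \<in> carrier (dual_space A (\<Gamma> (- m)))"
    note g' = functionalD(1)[OF g]
    note sg = slice_hom[where M = M\<Gamma> and N = \<Gamma>, OF M\<Gamma> gmods(2) g']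
    show "slice M\<Gamma> m n g ?u = slice M\<Gamma> m n g ?l"
    proof (rule tensor_eqI_slices[OF gmods dual module_homD(1)[OF sg u] module_homD(1)[OF sg l]])
      fix k f assume f: "f \<in> carrier (dual_space A (\<Gamma> (- k)))"
      note f' = functionalD(1)[OF f]
      note fg = product_functional_hom[where N = \<Gamma> and P = \<Gamma>, OF gmods(2,2) f' g']
      note fg\<Delta> = module_hom_comp[OF graded_homD[OF comult_hom] fg]
      have "slice M k (m + n) f (slice M\<Gamma> m n g ?u) = slice M (k + m) n (product_functional A k f g) ?r"
        by (rule slice_slice_unassoc[OF gmods(2,2) f' g' gmods(1) r])
      also have "\<dots> = slice M (k + m) n
          (\<lambda>d. product_functional A k f g (comult C (- (k + m)) d)) (coaction n x)"
        by (rule slice_tensor_map_right[OF gmods \<Gamma>\<Gamma> comult_hom fg c])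
      also have "\<dots> = slice M (k + m) n (amult (dual_algebra A C) k m f g) (coaction n x)"
        unfolding dual_algebra_simps by (rule slice_restrict[OF gmods fg\<Delta> c, symmetric])
      also have "\<dots> = act X (k + m) n (amult (dual_algebra A C) k m f g) x"
        unfolding dual_algebra_simps
        by (rule slice_coaction[OF x restrict_mem_dual_space[OF graded_moduleD[OF gmods(2)] fg\<Delta>]])
      also have "\<dots> = act X k (m + n) f (act X m n g x)"
        by (rule graded_left_moduleD(8)[OF left_module _ _ x]) (simp_all add: f g)
      also have "\<dots> = slice M k (m + n) f (coaction (m + n) (act X m n g x))"
        by (rule slice_coaction[OF act_closed[OF g x] f, symmetric])
      also have "coaction (m + n) (act X m n g x) = slice M\<Gamma> m n g ?l"
        unfolding slice_tensor_map_left[OF gmods(1) M\<Gamma> gmods(2) coaction_hom g' c]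
        by (simp add: slice_coaction[OF x g])
      finally show "slice M k (m + n) f (slice M\<Gamma> m n g ?u) = slice M k (m + n) f (slice M\<Gamma> m n g ?l)" .
    qed
  qed
  then show ?thesis
    using tensor_assoc_unassoc[OF gmods gmods(2) r] by simp
qed

lemma is_rational: "rational A C X"
proof -
  let ?K = "\<lparr>comod = M, coact = coaction\<rparr>"
  have "graded_comodule A C ?K"
    unfolding graded_comodule_def Let_def
    using gmods(1) coaction_hom coaction_coassoc coaction_counit by simp
  moreover have "gmodule_hom A (dual_algebra A C) X (adjoint_module C ?K) (\<lambda>_ x. x)"
    by (rule gmodule_homI) (simp_all add: adjoint_module_def slice_coaction[unfolded slice_def] cong: if_cong)
  then have "gmodule_iso A (dual_algebra A C) X (adjoint_module C ?K)"
    unfolding gmodule_iso_def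
    by (intro exI[of _ "\<lambda>_ x. x"]) (simp add: adjoint_module_def bij_betw_def)
  ultimately show ?thesis
    unfolding rational_def using left_module by blast
qed

end


section \<open>Truncation\<close>

text \<open>The quotient by the elements of degree greater than \<open>k\<close>, realised without cosets: the pieces
  up to degree \<open>k\<close> are kept, the others are replaced by zero, and so are the results of the action
  that land in them.\<close>

definition truncation :: "int \<Rightarrow> ('a, 'b, 'm) gmodule \<Rightarrow> ('a, 'b, 'm) gmodule"
  where "truncation k X =
    \<lparr>mpieces = (\<lambda>n. if n \<le> k then mpieces X n else (mpieces X n)\<lparr>carrier := {\<zero>\<^bsub>mpieces X n\<^esub>}\<rparr>),
     act = (\<lambda>m n f x. if m + n \<le> k then act X m n f x else \<zero>\<^bsub>mpieces X (m + n)\<^esub>)\<rparr>"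

definition truncation_map :: "('a, 'b, 'm) gmodule \<Rightarrow> int \<Rightarrow> int \<Rightarrow> 'm \<Rightarrow> 'm"
  where "truncation_map X k n x = (if n \<le> k then x else \<zero>\<^bsub>mpieces X n\<^esub>)"

lemma truncation_simps [simp]:
  "carrier (mpieces (truncation k X) n) = (if n \<le> k then carrier (mpieces X n) else {\<zero>\<^bsub>mpieces X n\<^esub>})"
  "\<zero>\<^bsub>mpieces (truncation k X) n\<^esub> = \<zero>\<^bsub>mpieces X n\<^esub>"
  "x \<oplus>\<^bsub>mpieces (truncation k X) n\<^esub> y = x \<oplus>\<^bsub>mpieces X n\<^esub> y"
  "a \<odot>\<^bsub>mpieces (truncation k X) n\<^esub> x = a \<odot>\<^bsub>mpieces X n\<^esub> x"
  "act (truncation k X) m n f x = (if m + n \<le> k then act X m n f x else \<zero>\<^bsub>mpieces X (m + n)\<^esub>)"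
  by (simp_all add: truncation_def)

lemma truncation_truncation: "k \<le> k' \<Longrightarrow> truncation k (truncation k' X) = truncation k X"
  by (auto simp: truncation_def fun_eq_iff)

lemma truncation_map_truncation: "truncation_map (truncation k' X) = truncation_map X"
  by (simp add: truncation_map_def fun_eq_iff)

lemma zero_module:
  assumes "module A V"
  shows "module A (V\<lparr>carrier := {\<zero>\<^bsub>V\<^esub>}\<rparr>)"
proof -
  interpret V: module A V by fact
  have "LinearCombinations.submodule A {\<zero>\<^bsub>V\<^esub>} V"
    unfolding LinearCombinations.submodule_def using V.module_axioms by simp
  then show ?thesis by (rule V.submodule_is_module)
qed

context
  fixes A :: "('a, 'r) ring_scheme" and R :: "('a, 'b) galgebra" and X :: "('a, 'b, 'm) gmodule"
  assumes R: "graded_module A (apieces R)"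
    and nonneg: "\<And>n. n < 0 \<Longrightarrow> carrier (apieces R n) = {\<zero>\<^bsub>apieces R n\<^esub>}"
    and X: "graded_left_module A R X"
begin

interpretation M: module A "mpieces X n" for n by (rule graded_left_moduleD(1)[OF X])

lemma act_negative:
  assumes "m < 0" "f \<in> carrier (apieces R m)" "x \<in> carrier (mpieces X n)"
  shows "act X m n f x = \<zero>\<^bsub>mpieces X (m + n)\<^esub>"
proof -
  have "(\<lambda>f. act X m n f x) \<in> module_hom A (apieces R m) (mpieces X (m + n))"
    using X assms(3) by (simp add: graded_left_module_def)
  from module_hom_zero[OF graded_moduleD[OF R] M.module_axioms this]
  show ?thesis using nonneg[OF assms(1)] assms(2) by simp
qed

lemma act_zero:
  assumes "f \<in> carrier (apieces R m)"
  shows "act X m n f \<zero>\<^bsub>mpieces X n\<^esub> = \<zero>\<^bsub>mpieces X (m + n)\<^esub>"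
proof -
  have "act X m n f \<in> module_hom A (mpieces X n) (mpieces X (m + n))"
    using X assms by (simp add: graded_left_module_def)
  from module_hom_zero[OF M.module_axioms M.module_axioms this] show ?thesis .
qed

text \<open>Associativity could fail only if \<open>g x\<close> were cut off while \<open>f (g x)\<close> is not. Then \<open>f\<close> has negative
  degree and acts as zero.\<close>

lemma truncation_module: "graded_left_module A R (truncation k X)"
  unfolding graded_left_module_def
proof (intro conjI allI ballI)
  show "graded_module A (mpieces (truncation k X))"
    by (simp add: graded_module_def truncation_def M.module_axioms zero_module)
next
  fix m n f assume f: "f \<in> carrier (apieces R m)"
  show "act (truncation k X) m n f \<in>
      module_hom A (mpieces (truncation k X) n) (mpieces (truncation k X) (m + n))"
    by (rule module_homI)
      (use f in \<open>auto simp: graded_left_moduleD(2-4)[OF X] act_zero split: if_splits\<close>)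
next
  fix m n x assume x: "x \<in> carrier (mpieces (truncation k X) n)"
  then have "x \<in> carrier (mpieces X n)" by (auto split: if_splits)
  then show "(\<lambda>f. act (truncation k X) m n f x) \<in>
      module_hom A (apieces R m) (mpieces (truncation k X) (m + n))"
    by (intro module_homI) (auto simp: graded_left_moduleD(2,5,6)[OF X])
next
  fix n x assume x: "x \<in> carrier (mpieces (truncation k X) n)"
  then show "act (truncation k X) 0 n (aone R) x = x"
    by (auto simp: graded_left_moduleD(7)[OF X] split: if_splits)
next
  fix l m n f g x
  assume f: "f \<in> carrier (apieces R l)" and g: "g \<in> carrier (apieces R m)"
    and "x \<in> carrier (mpieces (truncation k X) n)"
  then have x: "x \<in> carrier (mpieces X n)" by (auto split: if_splits)
  note gx = graded_left_moduleD(2)[OF X g x] and assoc = graded_left_moduleD(8)[OF X f g x]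
  show "act (truncation k X) (l + m) n (amult R l m f g) x =
      act (truncation k X) l (m + n) f (act (truncation k X) m n g x)"
  proof (cases "l + m + n \<le> k \<and> k < m + n")
    case True
    then have "l < 0" by simp
    with True show ?thesis
      using act_negative[OF _ f gx] assoc act_zero[OF f, of "m + n"] by (simp add: add.assoc)
  next
    case False
    then show ?thesis using assoc by (auto simp: add.assoc)
  qed
qed

lemma truncation_map_hom: "gmodule_hom A R X (truncation k X) (truncation_map X k)"
proof (rule gmodule_homI)
  fix m n f x assume f: "f \<in> carrier (apieces R m)" and x: "x \<in> carrier (mpieces X n)"
  show "truncation_map X k (m + n) (act X m n f x) = act (truncation k X) m n f (truncation_map X k n x)"
  proof (cases "m + n \<le> k \<and> k < n")
    case True
    then have "m < 0" by simp
    with True show ?thesis using act_negative[OF _ f x] act_zero[OF f] by (simp add: truncation_map_def)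
  next
    case False
    then show ?thesis by (auto simp: truncation_map_def)
  qed
qed (auto simp: truncation_map_def)

end

lemma mittag_leffler_surjective:
  assumes "\<And>k n. \<rho> k n ` carrier (mpieces (N (Suc k)) n) = carrier (mpieces (N k) n)"
  shows "mittag_leffler N \<rho>"
proof -
  have "transition \<rho> k d n ` carrier (mpieces (N (k + d)) n) = carrier (mpieces (N k) n)" for k d n
  proof (induction d)
    case (Suc d)
    have "transition \<rho> k (Suc d) n ` carrier (mpieces (N (k + Suc d)) n) =
        transition \<rho> k d n ` (\<rho> (k + d) n ` carrier (mpieces (N (Suc (k + d))) n))"
      by (simp add: image_image)
    then show ?case using assms Suc.IH by simp
  qed simp
  then show ?thesis unfolding mittag_leffler_def by simp
qed

context
  fixes A :: "('a, 'r) ring_scheme" and R :: "('a, 'b) galgebra" and X :: "('a, 'b, 'm) gmodule"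
  assumes R: "graded_module A (apieces R)"
    and nonneg: "\<And>n. n < 0 \<Longrightarrow> carrier (apieces R n) = {\<zero>\<^bsub>apieces R n\<^esub>}"
    and X: "graded_left_module A R X"
begin

interpretation M: module A "mpieces X n" for n by (rule graded_left_moduleD(1)[OF X])

lemma truncation_sequence:
  "inverse_sequence A R (\<lambda>k. truncation (int k) X) (\<lambda>k. truncation_map X (int k))"
proof -
  have "gmodule_hom A R (truncation (int (Suc k)) X) (truncation (int k) X) (truncation_map X (int k))" for k
    using truncation_map_hom[OF R nonneg truncation_module[OF R nonneg X, of "int (Suc k)"], of "int k"]
      truncation_truncation[of "int k" "int (Suc k)" X] truncation_map_truncation[of "int (Suc k)" X]
    by simp
  then show ?thesis
    unfolding inverse_sequence_def using truncation_module[OF R nonneg X] by blast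
qed

lemma truncation_mittag_leffler:
  "mittag_leffler (\<lambda>k. truncation (int k) X) (\<lambda>k. truncation_map X (int k))"
proof (rule mittag_leffler_surjective)
  fix k n
  show "truncation_map X (int k) n ` carrier (mpieces (truncation (int (Suc k)) X) n) =
      carrier (mpieces (truncation (int k) X) n)"
    using M.M.zero_closed by (auto simp: truncation_map_def image_def)
qed

text \<open>The components \<open>q k n\<close> of a cone agree for all \<open>k \<ge> n\<close>, so the factorisation must be and can be
  taken to be \<open>q (nat n) n\<close> in degree \<open>n\<close>. In negative degrees this is \<open>q 0 n\<close>, which is already
  stable. Linearity over \<open>R\<close> relates two degrees, and is checked at a stage beyond both.\<close>

lemma truncation_limit:
  "is_limit A R (\<lambda>k. truncation (int k) X) (\<lambda>k. truncation_map X (int k)) X (\<lambda>k. truncation_map X (int k))"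
  unfolding is_limit_def
proof (intro conjI allI impI)
  show "cone A R (\<lambda>k. truncation (int k) X) (\<lambda>k. truncation_map X (int k)) X (\<lambda>k. truncation_map X (int k))"
    unfolding cone_def using X truncation_map_hom[OF R nonneg X] by (auto simp: truncation_map_def)
next
  fix T :: "('a, 'b, nat \<Rightarrow> 'm) gmodule" and q
  assume cone: "cone A R (\<lambda>k. truncation (int k) X) (\<lambda>k. truncation_map X (int k)) T q"
  then have q: "gmodule_hom A R T (truncation (int k) X) (q k)" for k by (simp add: cone_def)
  have compat: "truncation_map X (int k) n (q (Suc k) n t) = q k n t" if "t \<in> carrier (mpieces T n)" for k n t
    using cone that by (simp add: cone_def)
  have stable: "q k n t = q (nat n) n t" if t: "t \<in> carrier (mpieces T n)" and "nat n \<le> k" for k n t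
    using that(2)
  proof (induction k rule: dec_induct)
    case (step k)
    then have "n \<le> int k" by simp
    then show ?case using compat[OF t, of k] step.IH by (simp add: truncation_map_def)
  qed simp
  have q_mem: "q k n t \<in> carrier (mpieces X n)" if "t \<in> carrier (mpieces T n)" for k n t
    using gmodule_homD(1)[OF q[of k] that] by (auto split: if_splits)
  let ?\<phi> = "\<lambda>n t. q (nat n) n t"
  have comm: "truncation_map X (int k) n (?\<phi> n t) = q k n t" if t: "t \<in> carrier (mpieces T n)" for k n t
  proof (cases "n \<le> int k")
    case True
    then show ?thesis using stable[OF t, of k] by (simp add: truncation_map_def)
  next
    case False
    then show ?thesis using gmodule_homD(1)[OF q[of k] t] by (simp add: truncation_map_def)
  qed
  have \<phi>: "gmodule_hom A R T X ?\<phi>"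
  proof (rule gmodule_homI)
    show "q (nat n) n t \<in> carrier (mpieces X n)" if "t \<in> carrier (mpieces T n)" for n t
      by (rule q_mem[OF that])
  next
    fix n s t assume "s \<in> carrier (mpieces T n)" "t \<in> carrier (mpieces T n)"
    then show "q (nat n) n (s \<oplus>\<^bsub>mpieces T n\<^esub> t) = q (nat n) n s \<oplus>\<^bsub>mpieces X n\<^esub> q (nat n) n t"
      using gmodule_homD(2)[OF q[of "nat n"]] by simp
  next
    fix n a t assume "a \<in> carrier A" "t \<in> carrier (mpieces T n)"
    then show "q (nat n) n (a \<odot>\<^bsub>mpieces T n\<^esub> t) = a \<odot>\<^bsub>mpieces X n\<^esub> q (nat n) n t"
      using gmodule_homD(3)[OF q[of "nat n"]] by simp
  next
    fix m n f t assume f: "f \<in> carrier (apieces R m)" and t: "t \<in> carrier (mpieces T n)"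
    \<comment> \<open>a stage at which the degrees \<open>n\<close> and \<open>m + n\<close> are both stable\<close>
    define K where "K = max (nat n) (nat (m + n))"
    have "act T m n f t \<in> carrier (mpieces T (m + n))"
      using cone by (intro graded_left_moduleD(2)[of A R T] f t) (simp add: cone_def)
    then have "q (nat (m + n)) (m + n) (act T m n f t) = q K (m + n) (act T m n f t)"
      by (intro stable[symmetric]) (simp_all add: K_def)
    also have "\<dots> = act X m n f (q K n t)"
      using gmodule_homD(4)[OF q[of K] f t] by (simp add: K_def split: if_splits)
    also have "q K n t = q (nat n) n t"
      by (rule stable[OF t]) (simp add: K_def)
    finally show "q (nat (m + n)) (m + n) (act T m n f t) = act X m n f (q (nat n) n t)" .
  qed
  have uniq: "\<psi> n t = q (nat n) n t"
    if "\<forall>k n. \<forall>t\<in>carrier (mpieces T n). truncation_map X (int k) n (\<psi> n t) = q k n t"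
      "t \<in> carrier (mpieces T n)" for \<psi> n t
  proof -
    have "n \<le> int (nat n)" by simp
    then show ?thesis using that(1)[rule_format, OF that(2), of "nat n"] by (simp only: truncation_map_def if_True)
  qed
  show "factors_uniquely A R X (\<lambda>k. truncation_map X (int k)) T q"
    unfolding factors_uniquely_def Let_def
  proof (intro conjI exI[of _ ?\<phi>] allI impI ballI)
    fix \<psi> \<psi>' n t
    assume "gmodule_hom A R T X \<psi> \<and>
        (\<forall>k n. \<forall>t\<in>carrier (mpieces T n). truncation_map X (int k) n (\<psi> n t) = q k n t)"
      and "gmodule_hom A R T X \<psi>' \<and>
        (\<forall>k n. \<forall>t\<in>carrier (mpieces T n). truncation_map X (int k) n (\<psi>' n t) = q k n t)"
      and "t \<in> carrier (mpieces T n)"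
    then show "\<psi> n t = \<psi>' n t" using uniq[of \<psi> t n] uniq[of \<psi>' t n] by simp
  qed (use \<phi> comm in auto)
qed

end


section \<open>Every module is a limit of rational modules\<close>

theorem corollary4p5:
  fixes A :: "('a, 'r) ring_scheme"
    and C :: "('a, 'c) gcoalgebra"
    and M :: "('a, 'c \<Rightarrow> 'a, 'm) gmodule"
  assumes "field A"
    and "graded_coalgebra A C"
    and "finite_type_connected A (dual_algebra A C)"
    and "graded_left_module A (dual_algebra A C) M"
  shows "\<exists>(N :: nat \<Rightarrow> ('a, 'c \<Rightarrow> 'a, 'm) gmodule) \<rho> p.
    inverse_sequence A (dual_algebra A C) N \<rho> \<and>
    (\<forall>k. rational A C (N k)) \<and>
    mittag_leffler N \<rho> \<and>
    is_limit A (dual_algebra A C) N \<rho> M p"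
proof -
  have \<Gamma>: "module A (pieces C n)" for n
    using assms(2) by (simp add: graded_coalgebra_def graded_module_def Let_def)
  have R: "graded_module A (apieces (dual_algebra A C))"
    by (simp add: graded_module_def dual_space_module[OF \<Gamma>])
  have nonneg: "carrier (apieces (dual_algebra A C) n) = {\<zero>\<^bsub>apieces (dual_algebra A C) n\<^esub>}"
    if "n < 0" for n
    using assms(3) that unfolding finite_type_connected_def by blast
  have "vectorspace.fin_dim A (dual_space A (pieces C j))" for j
    using assms(3)[unfolded finite_type_connected_def, THEN conjunct1, rule_format, of "- j"] by simp
  then obtain D where D: "dual_system A (pieces C j) (D j)" for j
    using dual_system_exists[OF assms(1) \<Gamma>] by metis
  have "rational A C (truncation (int k) M)" for k
  proof (rule bounded_dual_module.is_rational)
    show "bounded_dual_module A C (truncation (int k) M) D (int k)"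
      by unfold_locales
        (auto simp: assms(2) truncation_module[OF R nonneg assms(4)] D nonneg
          simp del: dual_algebra_simps)
  qed
  then show ?thesis
    using truncation_sequence[OF R nonneg assms(4)] truncation_mittag_leffler[OF R nonneg assms(4)]
      truncation_limit[OF R nonneg assms(4)] by blast
qed

end
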